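(* Let $\lambda>0$, $\gamma\in\mathbb{R}$, $\Delta>0$, and let $\nu$ be a finite measure with $\nu(\mathbb{R})=\lambda$ and $\int\log^\beta(\max\{|x|,e\})\nu(dx)<\infty$ for some $\beta>2$. Let $Z_1,\dots,Z_n$ be i.i.d. $\Delta$-increments of the compound Poisson process with drift $\gamma$, intensity $\lambda$ and jump measure $\nu$, with law $P$, empirical measure $P_n$, characteristic function $\varphi$ and empirical characteristic function $\varphi_n$. Let $K$ be symmetric with $K\in L^1(\mathbb{R})$ and $\mathrm{supp}\,\mathcal{F}K\subseteq[-1,1]$, and let $h_n\to0$ with $\log(h_n^{-1})/n^{1/(1+2\delta)}\to0$ for some $\delta>0$. Let $g_n\in L^2(\mathbb{R})$ satisfy $$\int_{-h_n^{-1}}^{h_n^{-1}}|\mathcal{F}g_n(u)|du=o\big(n^{1/2}(\log h_n^{-1})^{-(1+2\delta)}\big),\quad \sup_n\sup_x|g_n(x)|<\infty,$$ and suppose $g:=\lim_{n\to\infty}g_n*K_{h_n}$ exists at every point. Then, on events whose probability tends to one, $$\sqrt n\frac1\Delta\int g_n(x)\mathcal{F}^{-1}\Big[\mathrm{Log}\frac{\varphi_n}{\varphi}\mathcal{F}K_{h_n}\Big](x)dx=\sqrt n\frac1\Delta\int\big(g_n*K_{h_n}*M\big)(x)(P_n-P)(dx)+\sqrt n\frac1{2\pi\Delta}\int\mathcal{F}g_n(-u)R_n(u)\mathcal{F}K_{h_n}(u)du,$$ and, as $n\to\infty$, this quantity converges in distribution to $N(0,\sigma_g^2)$, where $\sigma_g^2$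 is finite and $$\Delta^2\sigma_g^2=\int\big((g*M)(x)-g(0)\big)^2P(dx)=\int\big((g*M)(x)\big)^2P(dx)-g(0)^2.$$
   Context: $\mathcal{F}\mu(u)=\int e^{iux}\mu(dx)$, $\mathcal{F}^{-1}g(x)=(2\pi)^{-1}\int e^{-iux}g(u)du$. $\varphi(u)=\exp(\Delta(i\gamma u+\mathcal{F}\nu(u)-\lambda))$, $\varphi_n(u)=n^{-1}\sum_ke^{iuZ_k}$, $P_n=n^{-1}\sum_k\delta_{Z_k}$, $\varphi^{-1}=1/\varphi$, $M:=\mathcal{F}^{-1}[\varphi^{-1}(-\cdot)]=e^{\lambda\Delta}\delta_{\gamma\Delta}*\sum_{k\ge0}\bar\nu^{*k}(-\Delta)^k/k!$ ($\bar\nu(A)=\nu(-A)$, $\bar\nu^{*0}=\delta_0$); $f*\mu(x)=\int f(x-y)\mu(dy)$; $K_h=h^{-1}K(\cdot/h)$. On the event that $\varphi_n/\varphi$ does not vanish on $[-h_n^{-1},h_n^{-1}]$, $\mathrm{Log}(\varphi_n/\varphi)$ is its continuous logarithm there with value $0$ at $u=0$ (it is multiplied by $\mathcal{F}K_{h_n}$, supported in $[-h_n^{-1},h_n^{-1}]$). $R_n(u):=R(\varphi_n(u)/\varphi(u))$ with $R(z)=\int_1^z(s-z)s^{-2}ds$. *)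

theory Defs
  imports "HOL-Probability.Probability" "HOL-Probability.Convolution" "HOL-Complex_Analysis.Contour_Integration"
    "HOL-Library.Landau_Symbols"
begin

definition FT :: "(real \<Rightarrow> complex) \<Rightarrow> real \<Rightarrow> complex" where
  "FT f u = (CLINT x|lborel. iexp (u * x) * f x)"

definition iFT :: "(real \<Rightarrow> complex) \<Rightarrow> real \<Rightarrow> complex" where
  "iFT G x = complex_of_real (1 / (2 * pi)) * (CLINT u|lborel. iexp (- (u * x)) * G u)"

text \<open>Fourier--Plancherel transform of an L2 function: the L2-limit (R to infinity) of the
  truncated transforms int_{-R}^{R} e^(iux) f(x) dx (a representative of the a.e. class).\<close>
definition FT_L2 :: "(real \<Rightarrow> complex) \<Rightarrow> real \<Rightarrow> complex" where
  "FT_L2 f = (SOME G. G \<in> borel_measurable lborel \<and> integrable lborel (\<lambda>u. (cmod (G u))\<^sup>2) \<and>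
      ((\<lambda>R. LINT u|lborel.
          (cmod (set_lebesgue_integral lborel {-R..R} (\<lambda>x. iexp (u * x) * f x) - G u))\<^sup>2)
        \<longlongrightarrow> 0) at_top)"

definition conv_fun :: "(real \<Rightarrow> real) \<Rightarrow> (real \<Rightarrow> real) \<Rightarrow> real \<Rightarrow> real" where
  "conv_fun f k x = (LINT y|lborel. f (x - y) * k y)"

definition scaled_kernel :: "(real \<Rightarrow> real) \<Rightarrow> real \<Rightarrow> real \<Rightarrow> real" where
  "scaled_kernel K h x = K (x / h) / h"

primrec conv_pow :: "real measure \<Rightarrow> nat \<Rightarrow> real measure" where
  "conv_pow \<mu> 0 = return borel 0"
| "conv_pow \<mu> (Suc k) = convolution \<mu> (conv_pow \<mu> k)"

text \<open>f * M for the signed measure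
  M = e^(lam Delta) delta_(gamma Delta) * sum_k nubar^(*k) (-Delta)^k / k!,  nubar(A) = nu(-A):
  (f * M)(x) = e^(lam Delta) sum_k (-Delta)^k/k! int f(x - gamma Delta - y) nubar^(*k)(dy).\<close>
definition conv_M :: "real \<Rightarrow> real \<Rightarrow> real \<Rightarrow> real measure \<Rightarrow> (real \<Rightarrow> real) \<Rightarrow> real \<Rightarrow> real" where
  "conv_M \<Delta> \<gamma> lam \<nu> f x = exp (lam * \<Delta>) *
     (\<Sum>k. (- \<Delta>) ^ k / fact k * (LINT y|conv_pow (distr \<nu> borel uminus) k. f (x - \<gamma> * \<Delta> - y)))"

definition cpp_char :: "real \<Rightarrow> real \<Rightarrow> real \<Rightarrow> real measure \<Rightarrow> real \<Rightarrow> complex" where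
  "cpp_char \<Delta> \<gamma> lam \<nu> u = exp (complex_of_real \<Delta> *
       (\<i> * complex_of_real (\<gamma> * u) + char \<nu> u - complex_of_real lam))"

definition emp_char :: "(nat \<Rightarrow> 'a \<Rightarrow> real) \<Rightarrow> nat \<Rightarrow> 'a \<Rightarrow> real \<Rightarrow> complex" where
  "emp_char Z n \<omega> u = complex_of_real (1 / real n) * (\<Sum>k<n. iexp (u * Z k \<omega>))"

definition cont_log :: "(real \<Rightarrow> complex) \<Rightarrow> real \<Rightarrow> real \<Rightarrow> complex" where
  "cont_log r T = (SOME L. continuous_on {-T..T} L \<and> L 0 = 0 \<and> (\<forall>u\<in>{-T..T}. exp (L u) = r u))"

definition R_fun :: "complex \<Rightarrow> complex" where
  "R_fun z = contour_integral (linepath 1 z) (\<lambda>s. (s - z) / s\<^sup>2)"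

definition lhs_stat ::
  "real \<Rightarrow> real \<Rightarrow> real \<Rightarrow> real measure \<Rightarrow> (real \<Rightarrow> real) \<Rightarrow> (nat \<Rightarrow> real \<Rightarrow> real) \<Rightarrow>
   (nat \<Rightarrow> real) \<Rightarrow> (nat \<Rightarrow> 'a \<Rightarrow> real) \<Rightarrow> nat \<Rightarrow> 'a \<Rightarrow> complex" where
  "lhs_stat \<Delta> \<gamma> lam \<nu> K g h Z n \<omega> =
     complex_of_real (sqrt (real n) / \<Delta>) *
     (CLINT x|lborel. complex_of_real (g n x) *
        iFT (\<lambda>u. cont_log (\<lambda>v. emp_char Z n \<omega> v / cpp_char \<Delta> \<gamma> lam \<nu> v) (1 / h n) u *
                  FT (\<lambda>y. complex_of_real (scaled_kernel K (h n) y)) u) x)"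

definition rhs_stat ::
  "real \<Rightarrow> real \<Rightarrow> real \<Rightarrow> real measure \<Rightarrow> real measure \<Rightarrow> (real \<Rightarrow> real) \<Rightarrow>
   (nat \<Rightarrow> real \<Rightarrow> real) \<Rightarrow> (nat \<Rightarrow> real) \<Rightarrow> (nat \<Rightarrow> 'a \<Rightarrow> real) \<Rightarrow> nat \<Rightarrow> 'a \<Rightarrow> complex" where
  "rhs_stat \<Delta> \<gamma> lam \<nu> P K g h Z n \<omega> =
     complex_of_real (sqrt (real n) / \<Delta> *
       ((1 / real n) * (\<Sum>k<n. conv_M \<Delta> \<gamma> lam \<nu> (conv_fun (g n) (scaled_kernel K (h n))) (Z k \<omega>))
        - (LINT x|P. conv_M \<Delta> \<gamma> lam \<nu> (conv_fun (g n) (scaled_kernel K (h n))) x)))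
   + complex_of_real (sqrt (real n) / (2 * pi * \<Delta>)) *
     (CLINT u|lborel. FT_L2 (\<lambda>x. complex_of_real (g n x)) (- u) *
        R_fun (emp_char Z n \<omega> u / cpp_char \<Delta> \<gamma> lam \<nu> u) *
        FT (\<lambda>y. complex_of_real (scaled_kernel K (h n) y)) u)"

definition conv_in_distr :: "'a measure \<Rightarrow> (nat \<Rightarrow> 'a \<Rightarrow> 'b::metric_space) \<Rightarrow> 'b measure \<Rightarrow> bool" where
  "conv_in_distr M X L \<longleftrightarrow> (\<forall>n. X n \<in> borel_measurable M) \<and>
     (\<forall>f :: 'b \<Rightarrow> real. continuous_on UNIV f \<and> bounded (range f) \<longrightarrow>
        (\<lambda>n. LINT \<omega>|M. f (X n \<omega>)) \<longlonglongrightarrow> (LINT x|L. f x))"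

end

theory Submission
  imports Defs
begin

text \<open>Write \<open>\<phi>\<close> for the characteristic function of \<open>P\<close> and \<open>f\<^sub>n\<close> for \<open>g\<^sub>n * K\<^bsub>h\<^esub> * M\<close>. By Fourier inversion
  for \<open>K\<close> and Parseval, \<open>f\<^sub>n(x)\<close> is the integral of \<open>FT g\<^sub>n(-u) FT K\<^bsub>h\<^esub>(u) exp(iux) / \<phi>(u)\<close> up to \<open>2 \<pi>\<close>. Integrating
  against the empirical measure minus \<open>P\<close> turns \<open>exp(iux) / \<phi>\<close> into \<open>\<phi>\<^sub>n / \<phi> - 1\<close>; integrating against \<open>P\<close>
  turns it into \<open>1\<close>, so \<open>f\<^sub>n\<close> has mean \<open>(g\<^sub>n * K\<^bsub>h\<^esub>)(0)\<close>, which tends to \<open>G 0\<close>. The identity of the two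
  statistics is then \<open>Log z = (z - 1) + R z\<close>. It holds once \<open>\<phi>\<^sub>n\<close> is within a small constant of \<open>\<phi>\<close> on
  \<open>[-1/h, 1/h]\<close>, which has probability tending to one because \<open>1/h\<close> is subexponential in \<open>n\<close>.

  As \<open>R z\<close> is of order \<open>\<bar>z - 1\<bar>\<^sup>2\<close> and \<open>\<phi>\<^sub>n(u) - \<phi>(u)\<close> has variance at most \<open>1/n\<close>, the expected
  remainder is of order \<open>1/sqrt n\<close> times the integral of \<open>\<bar>FT g\<^sub>n\<bar>\<close> over \<open>[-1/h, 1/h]\<close>, hence negligible. The \<open>f\<^sub>n\<close> are uniformly
  bounded and converge pointwise, so the linear term differs by a vanishing variance from the
  normalised sum of the fixed function \<open>G * M\<close>, to which the classical central limit theorem applies.\<close>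

section \<open>Fourier transforms and Bessel's inequality\<close>

text \<open>Deconvolution is well-posed here because the jump measure is finite: the modulus of
  \<phi> stays above exp(-2 \<lambda> \<Delta>) on the whole line, and the series for M has total
  variation at most exp(2 \<lambda> \<Delta>). The bounds that involve 1 / \<phi> or M are therefore
  uniform in the frequency and in the bandwidth, and the limit of g_n * K_h * M follows by dominated
  convergence.

  As g_n is only square integrable, its transform is a Hilbert choice of an L2 limit, about which
  nothing can be said before such a limit has been constructed. This is the reason for Bessel's
  inequality and for the bilinear duality built on it. Inversion is applied to the kernel and not to
  g_n, whose transform is only known to be integrable on bounded intervals.

  Both statistics are total functions, with default values where no continuous logarithm exists or
  where the path defining R meets its pole. The limit law is stated for the statistic with R, which
  has to be measurable over all outcomes, the exceptional ones included; so R has to be known on the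
  whole plane and not only near 1.\<close>

lemma norm_iexp [simp]: "cmod (iexp t) = 1"
  by (simp add: norm_exp_eq_Re)

lemma borel_measurable_cnj [measurable]:
  "f \<in> borel_measurable M \<Longrightarrow> (\<lambda>x. cnj (f x)) \<in> borel_measurable M"
  by (rule borel_measurable_continuous_on[where f=cnj]) (auto intro!: continuous_intros)

lemma FT_integrand_integrable:
  "integrable lborel f \<Longrightarrow> integrable lborel (\<lambda>x. iexp (u * x) * f x)"
  by (rule Bochner_Integration.integrable_bound[where f=f]) (auto simp: norm_mult)

lemma norm_FT_le: "cmod (FT f u) \<le> (LINT x|lborel. cmod (f x))"
  unfolding FT_def by (rule order_trans[OF integral_norm_bound]) (simp add: norm_mult)

lemma FT_measurable [measurable]:
  assumes [measurable]: "f \<in> borel_measurable borel"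
  shows "FT f \<in> borel_measurable borel"
  unfolding FT_def by measurable

text \<open>The kernel \<open>iexp (u * x)\<close> is symmetric in its two variables and has modulus
  one, so Fubini applies as soon as \<open>f\<close> and \<open>a\<close> are integrable. The
  Parseval identities below all go back to this bilinear formula.\<close>

lemma FT_duality:
  assumes f: "integrable lborel f" and a: "integrable lborel a"
  shows "(CLINT u|lborel. FT f u * a u) = (CLINT x|lborel. f x * FT a x)"
proof -
  have [measurable]: "f \<in> borel_measurable borel" "a \<in> borel_measurable borel"
    using f a by auto
  have "integrable (lborel \<Otimes>\<^sub>M lborel) (\<lambda>(x, u). f x * a u)"
    using f a by (intro lborel_pair.Fubini_integrable)
      (auto simp: norm_mult intro!: integrable_mult_right)
  then have *: "integrable (lborel \<Otimes>\<^sub>M lborel) (\<lambda>(x, u). iexp (u * x) * f x * a u)"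
    by (rule Bochner_Integration.integrable_bound) (auto simp: norm_mult)
  have "(CLINT u|lborel. FT f u * a u) = (CLINT u|lborel. CLINT x|lborel. iexp (u * x) * f x * a u)"
    by (simp add: FT_def)
  also have "\<dots> = (CLINT x|lborel. CLINT u|lborel. iexp (u * x) * f x * a u)"
    using lborel_pair.Fubini_integral[OF *] .
  also have "\<dots> = (CLINT x|lborel. f x * FT a x)"
    by (simp add: FT_def mult_ac flip: integral_mult_right_zero)
  finally show ?thesis .
qed

lemma normal_integral_iexp:
  assumes "\<sigma> > 0"
  shows "(CLINT u|lborel. iexp (t * u) * complex_of_real (normal_density 0 \<sigma> u)) =
    complex_of_real (exp (- (\<sigma> * t)\<^sup>2 / 2))"
proof -
  have "(CLINT u|lborel. iexp (t * u) * complex_of_real (normal_density 0 \<sigma> u)) =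
     \<sigma> *\<^sub>R (CLINT v|lborel. iexp (t * (\<sigma> * v)) * complex_of_real (normal_density 0 \<sigma> (\<sigma> * v)))"
    by (subst lborel_integral_real_affine[where c=\<sigma> and t=0]) (use assms in auto)
  also have "\<dots> = (CLINT v|lborel. std_normal_density v *\<^sub>R iexp ((\<sigma> * t) * v))"
    using assms by (subst integral_scaleR_right[symmetric])
      (auto simp: normal_density_def scaleR_conv_of_real real_sqrt_mult power_mult_distrib mult_ac intro!: Bochner_Integration.integral_cong)
  also have "\<dots> = char std_normal_distribution (\<sigma> * t)"
    unfolding char_def by (subst integral_density) auto
  finally show ?thesis by (simp add: char_std_normal_distribution)
qed

lemma cnj_FT: "cnj (FT f u) = FT (\<lambda>y. cnj (f (- y))) u"
proof -
  have "cnj (FT f u) = (CLINT x|lborel. iexp (- (u * x)) * cnj (f x))"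
    unfolding FT_def by (subst Bochner_Integration.integral_cnj[symmetric]) (simp add: exp_cnj)
  also have "\<dots> = FT (\<lambda>y. cnj (f (- y))) u"
    unfolding FT_def by (subst lborel_integral_real_affine[where c="-1" and t=0]) auto
  finally show ?thesis .
qed

lemma integrable_reflect:
  fixes f :: "real \<Rightarrow> 'b :: {banach, second_countable_topology}"
  shows "integrable lborel f \<Longrightarrow> integrable lborel (\<lambda>x. f (- x))"
  using lborel_integrable_real_affine[where f=f and c="-1" and t=0] by simp

text \<open>Duality turns the weighted integral into the double integral of
  \<open>H x * cnj (H y)\<close> against \<open>q (x - y)\<close>, where \<open>q\<close> is the
  transform of the weight. Schur's test then applies: bounding the product by half the sum of the
  squares leaves only the total mass of \<open>q\<close>, which is the constant on the right.
  Nonnegative integrals allow the right-hand side to be infinite.\<close>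

lemma Bessel_gaussian:
  assumes H: "integrable lborel H" and \<sigma>: "\<sigma> > 0"
  shows "(\<integral>\<^sup>+u. ennreal ((cmod (FT H u))\<^sup>2 * normal_density 0 \<sigma> u) \<partial>lborel) \<le>
    ennreal (sqrt (2 * pi) / \<sigma>) * (\<integral>\<^sup>+x. ennreal ((cmod (H x))\<^sup>2) \<partial>lborel)"
proof -
  have [measurable]: "H \<in> borel_measurable borel" using H by auto
  define q where "q t = exp (- (\<sigma> * t)\<^sup>2 / 2)" for t
  have [measurable]: "q \<in> borel_measurable borel" unfolding q_def by measurable
  have q0: "q t \<ge> 0" "q t \<le> 1" for t by (auto simp: q_def)
  define C where "C = (LINT x|lborel. cmod (H x))"
  define w where "w u = complex_of_real (normal_density 0 \<sigma> u)" for u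
  have w: "integrable lborel w" unfolding w_def by (intro integrable_of_real integrable_normal_density \<sigma>)
  have [measurable]: "w \<in> borel_measurable borel" using w by auto
  have qint: "(\<integral>\<^sup>+t. ennreal (q t) \<partial>lborel) = ennreal (sqrt (2 * pi) / \<sigma>)"
  proof -
    have "q t = sqrt (2 * pi) / \<sigma> * normal_density 0 (1 / \<sigma>) t" for t
      using \<sigma> by (auto simp: q_def normal_density_def real_sqrt_divide real_sqrt_mult power_mult_distrib field_simps)
    then have "(\<integral>\<^sup>+t. ennreal (q t) \<partial>lborel) = ennreal (sqrt (2 * pi) / \<sigma>) * (\<integral>\<^sup>+t. ennreal (normal_density 0 (1 / \<sigma>) t) \<partial>lborel)"
      using \<sigma> by (subst nn_integral_cmult[symmetric]) (auto simp: ennreal_mult'[symmetric])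
    also have "(\<integral>\<^sup>+t. ennreal (normal_density 0 (1 / \<sigma>) t) \<partial>lborel) = 1"
      using \<sigma> by (subst nn_integral_eq_integral) auto
    finally show ?thesis by simp
  qed
  \<comment> \<open>The function whose transform is the conjugate of \<open>FT H\<close>; it lets
    the duality be used a second time, inside the integral.\<close>
  define Hm where "Hm = (\<lambda>y. cnj (H (- y)))"
  have Hm: "integrable lborel Hm" using integrable_reflect[OF H] unfolding Hm_def by simp
  have inner: "FT (\<lambda>u. cnj (FT H u) * w u) x = (CLINT y|lborel. cnj (H y) * q (x - y))" for x
  proof -
    have i: "integrable lborel (\<lambda>u. iexp (x * u) * w u)" using w by (rule FT_integrand_integrable)
    have "FT (\<lambda>u. cnj (FT H u) * w u) x = (CLINT u|lborel. FT Hm u * (iexp (x * u) * w u))"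
      by (simp only: FT_def[where u=x] cnj_FT Hm_def mult_ac)
    also have "\<dots> = (CLINT y|lborel. Hm y * FT (\<lambda>u. iexp (x * u) * w u) y)"
      by (rule FT_duality[OF Hm i])
    also have "\<dots> = (CLINT y|lborel. Hm y * q (x + y))"
    proof (intro Bochner_Integration.integral_cong refl arg_cong2[where f="(*)"])
      fix y
      have "FT (\<lambda>u. iexp (x * u) * w u) y = (CLINT u|lborel. iexp ((x + y) * u) * complex_of_real (normal_density 0 \<sigma> u))"
        by (simp add: FT_def w_def exp_add ring_distribs mult_ac)
      then show "FT (\<lambda>u. iexp (x * u) * w u) y = complex_of_real (q (x + y))"
        using normal_integral_iexp[OF \<sigma>, of "x + y"] by (simp add: q_def)
    qed
    also have "\<dots> = (CLINT y|lborel. cnj (H y) * q (x - y))"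
      unfolding Hm_def by (subst lborel_integral_real_affine[where c="-1" and t=0]) auto
    finally show ?thesis .
  qed
  have iA: "integrable lborel (\<lambda>u. cnj (FT H u) * w u)"
  proof (rule Bochner_Integration.integrable_bound[where f="\<lambda>u. C * w u"])
    show "AE u in lborel. cmod (cnj (FT H u) * w u) \<le> cmod (complex_of_real C * w u)"
      using norm_FT_le[of H] by (auto simp: norm_mult C_def intro!: mult_right_mono AE_I2)
  qed (use w in auto)
  have eq: "(CLINT u|lborel. FT H u * (cnj (FT H u) * w u)) = (CLINT x|lborel. H x * (CLINT y|lborel. cnj (H y) * q (x - y)))"
    unfolding FT_duality[OF H iA] inner ..
  have iL: "integrable lborel (\<lambda>u. (cmod (FT H u))\<^sup>2 * normal_density 0 \<sigma> u)"
  proof (rule Bochner_Integration.integrable_bound[where f="\<lambda>u. C\<^sup>2 * normal_density 0 \<sigma> u"])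
    show "AE u in lborel. norm ((cmod (FT H u))\<^sup>2 * normal_density 0 \<sigma> u) \<le> norm (C\<^sup>2 * normal_density 0 \<sigma> u)"
      using norm_FT_le[of H] \<sigma> by (auto simp: norm_mult C_def intro!: mult_right_mono AE_I2 power_mono)
  qed (use \<sigma> in auto)
  have iH: "integrable lborel (\<lambda>y. cnj (H y) * q (x - y))" for x
    by (rule Bochner_Integration.integrable_bound[OF H])
       (use q0 in \<open>auto simp: norm_mult intro!: AE_I2 mult_left_le\<close>)
  have iHn: "integrable lborel (\<lambda>y. cmod (H y) * q (x - y))" for x
    using integrable_norm[OF iH[of x]] q0 by (simp add: norm_mult)
  define J where "J x = (CLINT y|lborel. cnj (H y) * q (x - y))" for x
  have [measurable]: "J \<in> borel_measurable borel" unfolding J_def by measurable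
  have Jb: "cmod (J x) \<le> C" for x
    unfolding J_def C_def
    by (rule order_trans[OF integral_norm_bound], rule integral_mono)
       (use H iH iHn q0 in \<open>auto simp: norm_mult intro!: mult_left_le\<close>)
  have iHJ: "integrable lborel (\<lambda>x. H x * J x)"
  proof (rule Bochner_Integration.integrable_bound[where f="\<lambda>x. C * H x"])
    show "AE x in lborel. cmod (H x * J x) \<le> cmod (complex_of_real C * H x)"
      using Jb order_trans[OF norm_ge_zero Jb] by (auto simp: norm_mult mult.commute[of "cmod (H _)"] intro!: AE_I2 mult_right_mono)
  qed (use H in auto)
  have "(\<integral>\<^sup>+u. ennreal ((cmod (FT H u))\<^sup>2 * normal_density 0 \<sigma> u) \<partial>lborel)
     = ennreal (LINT u|lborel. (cmod (FT H u))\<^sup>2 * normal_density 0 \<sigma> u)"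
    by (rule nn_integral_eq_integral[OF iL]) auto
  also have "\<dots> = ennreal (cmod (complex_of_real (LINT u|lborel. (cmod (FT H u))\<^sup>2 * normal_density 0 \<sigma> u)))"
    by (simp add: integral_nonneg_AE)
  also have "complex_of_real (LINT u|lborel. (cmod (FT H u))\<^sup>2 * normal_density 0 \<sigma> u) = (CLINT u|lborel. FT H u * (cnj (FT H u) * w u))"
    unfolding integral_complex_of_real[symmetric]
    by (intro Bochner_Integration.integral_cong) (auto simp: w_def complex_norm_square mult_ac simp del: of_real_power)
  also have "\<dots> = (CLINT x|lborel. H x * J x)" unfolding eq J_def ..
  also have "ennreal (cmod \<dots>) \<le> (\<integral>\<^sup>+x. ennreal (cmod (H x * J x)) \<partial>lborel)"
    by (rule integral_norm_bound_ennreal[OF iHJ])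
  also have "\<dots> \<le> (\<integral>\<^sup>+x. \<integral>\<^sup>+y. ennreal (((cmod (H x))\<^sup>2 + (cmod (H y))\<^sup>2) / 2 * q (x - y)) \<partial>lborel \<partial>lborel)"
  proof (rule nn_integral_mono)
    fix x
    have "ennreal (cmod (H x * J x)) = ennreal (cmod (H x)) * ennreal (cmod (J x))"
      by (simp add: norm_mult ennreal_mult)
    also have "\<dots> \<le> ennreal (cmod (H x)) * (\<integral>\<^sup>+y. ennreal (cmod (cnj (H y) * q (x - y))) \<partial>lborel)"
      unfolding J_def by (intro mult_left_mono integral_norm_bound_ennreal iH) auto
    also have "\<dots> = (\<integral>\<^sup>+y. ennreal (cmod (H x) * cmod (H y) * q (x - y)) \<partial>lborel)"
      by (subst nn_integral_cmult[symmetric]) (auto simp: norm_mult ennreal_mult'[symmetric] q0 mult_ac)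
    also have "\<dots> \<le> (\<integral>\<^sup>+y. ennreal (((cmod (H x))\<^sup>2 + (cmod (H y))\<^sup>2) / 2 * q (x - y)) \<partial>lborel)"
    proof (intro nn_integral_mono ennreal_leI mult_right_mono q0)
      fix y show "cmod (H x) * cmod (H y) \<le> ((cmod (H x))\<^sup>2 + (cmod (H y))\<^sup>2) / 2"
        using zero_le_power2[of "cmod (H x) - cmod (H y)"] by (simp add: power2_diff)
    qed
    finally show "ennreal (cmod (H x * J x)) \<le> \<dots>" .
  qed
  also have "\<dots> = (\<integral>\<^sup>+x. \<integral>\<^sup>+y. ennreal ((cmod (H x))\<^sup>2 / 2) * ennreal (q (x - y)) + ennreal ((cmod (H y))\<^sup>2 / 2) * ennreal (q (x - y)) \<partial>lborel \<partial>lborel)"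
    by (intro nn_integral_cong) (auto simp: q0 ennreal_mult'[symmetric] ennreal_plus[symmetric] add_divide_distrib ring_distribs simp del: ennreal_plus)
  also have "\<dots> = (\<integral>\<^sup>+x. \<integral>\<^sup>+y. ennreal ((cmod (H x))\<^sup>2 / 2) * ennreal (q (x - y)) \<partial>lborel \<partial>lborel)
     + (\<integral>\<^sup>+x. \<integral>\<^sup>+y. ennreal ((cmod (H y))\<^sup>2 / 2) * ennreal (q (x - y)) \<partial>lborel \<partial>lborel)"
    by (simp add: nn_integral_add)
  also have "(\<integral>\<^sup>+x. \<integral>\<^sup>+y. ennreal ((cmod (H y))\<^sup>2 / 2) * ennreal (q (x - y)) \<partial>lborel \<partial>lborel)
     = (\<integral>\<^sup>+y. \<integral>\<^sup>+x. ennreal ((cmod (H y))\<^sup>2 / 2) * ennreal (q (x - y)) \<partial>lborel \<partial>lborel)"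
    by (rule lborel_pair.Fubini'[symmetric]) measurable
  also have "\<dots> = (\<integral>\<^sup>+y. ennreal ((cmod (H y))\<^sup>2 / 2) * ennreal (sqrt (2 * pi) / \<sigma>) \<partial>lborel)"
  proof (rule nn_integral_cong)
    fix y :: real
    have "(\<integral>\<^sup>+x. ennreal (q (x - y)) \<partial>lborel) = (\<integral>\<^sup>+t. ennreal (q t) \<partial>lborel)"
      using nn_integral_real_affine[where c=1 and t="-y" and f="\<lambda>t. ennreal (q t)"] by (simp add: add.commute)
    then show "(\<integral>\<^sup>+x. ennreal ((cmod (H y))\<^sup>2 / 2) * ennreal (q (x - y)) \<partial>lborel) = ennreal ((cmod (H y))\<^sup>2 / 2) * ennreal (sqrt (2 * pi) / \<sigma>)"
      by (simp add: nn_integral_cmult qint)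
  qed
  also have "(\<integral>\<^sup>+x. \<integral>\<^sup>+y. ennreal ((cmod (H x))\<^sup>2 / 2) * ennreal (q (x - y)) \<partial>lborel \<partial>lborel)
     = (\<integral>\<^sup>+y. ennreal ((cmod (H y))\<^sup>2 / 2) * ennreal (sqrt (2 * pi) / \<sigma>) \<partial>lborel)"
  proof (rule nn_integral_cong)
    fix x :: real
    have "(\<integral>\<^sup>+y. ennreal (q (x - y)) \<partial>lborel) = (\<integral>\<^sup>+t. ennreal (q t) \<partial>lborel)"
      using nn_integral_real_affine[where c="-1" and t="x" and f="\<lambda>t. ennreal (q t)"] by simp
    then show "(\<integral>\<^sup>+y. ennreal ((cmod (H x))\<^sup>2 / 2) * ennreal (q (x - y)) \<partial>lborel) = ennreal ((cmod (H x))\<^sup>2 / 2) * ennreal (sqrt (2 * pi) / \<sigma>)"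
      by (simp add: nn_integral_cmult qint)
  qed
  also have "(\<integral>\<^sup>+y. ennreal ((cmod (H y))\<^sup>2 / 2) * ennreal (sqrt (2 * pi) / \<sigma>) \<partial>lborel) + (\<integral>\<^sup>+y. ennreal ((cmod (H y))\<^sup>2 / 2) * ennreal (sqrt (2 * pi) / \<sigma>) \<partial>lborel)
     = (\<integral>\<^sup>+y. ennreal ((cmod (H y))\<^sup>2 / 2) * ennreal (sqrt (2 * pi) / \<sigma>) + ennreal ((cmod (H y))\<^sup>2 / 2) * ennreal (sqrt (2 * pi) / \<sigma>) \<partial>lborel)"
    by (rule nn_integral_add[symmetric]) auto
  also have "\<dots> = (\<integral>\<^sup>+y. ennreal (sqrt (2 * pi) / \<sigma>) * ennreal ((cmod (H y))\<^sup>2) \<partial>lborel)"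
    using \<sigma> by (intro nn_integral_cong) (simp add: ennreal_mult'[symmetric] ennreal_plus[symmetric] mult.commute del: ennreal_plus)
  also have "\<dots> = ennreal (sqrt (2 * pi) / \<sigma>) * (\<integral>\<^sup>+x. ennreal ((cmod (H x))\<^sup>2) \<partial>lborel)"
    by (rule nn_integral_cmult) auto
  finally show ?thesis .
qed

text \<open>Rescaled to the value 1 at the origin, the Gaussian weight of width \<open>s\<close>
  costs the factor \<open>sqrt (2 * pi) * s\<close>, which cancels the \<open>s\<close> in
  \<open>Bessel_gaussian\<close> and leaves \<open>2 * pi\<close>. As the width grows the weight
  tends to 1, and Fatou's lemma removes it.\<close>

lemma Bessel_ineq:
  assumes H: "integrable lborel H"
  shows "(\<integral>\<^sup>+u. ennreal ((cmod (FT H u))\<^sup>2) \<partial>lborel) \<le> ennreal (2 * pi) * (\<integral>\<^sup>+x. ennreal ((cmod (H x))\<^sup>2) \<partial>lborel)"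
proof -
  have [measurable]: "H \<in> borel_measurable borel" using H by auto
  define N where "N = (\<integral>\<^sup>+x. ennreal ((cmod (H x))\<^sup>2) \<partial>lborel)"
  define e where "e n u = exp (- u\<^sup>2 / (2 * (real (Suc n))\<^sup>2))" for n and u :: real
  have b: "(\<integral>\<^sup>+u. ennreal ((cmod (FT H u))\<^sup>2 * e n u) \<partial>lborel) \<le> ennreal (2 * pi) * N" for n
  proof -
    define s where "s = real (Suc n)"
    have s: "s > 0" by (simp add: s_def)
    have e: "e n u = exp (- u\<^sup>2 / (2 * s\<^sup>2))" for u by (simp only: e_def s_def)
    have "(\<integral>\<^sup>+u. ennreal ((cmod (FT H u))\<^sup>2 * e n u) \<partial>lborel)
      = (\<integral>\<^sup>+u. ennreal (sqrt (2 * pi) * s) * ennreal ((cmod (FT H u))\<^sup>2 * normal_density 0 s u) \<partial>lborel)"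
      using s by (intro nn_integral_cong) (auto simp: ennreal_mult'[symmetric] e normal_density_def real_sqrt_mult field_simps)
    also have "\<dots> = ennreal (sqrt (2 * pi) * s) * (\<integral>\<^sup>+u. ennreal ((cmod (FT H u))\<^sup>2 * normal_density 0 s u) \<partial>lborel)"
      by (rule nn_integral_cmult) auto
    also have "\<dots> \<le> ennreal (sqrt (2 * pi) * s) * (ennreal (sqrt (2 * pi) / s) * N)"
      unfolding N_def by (intro mult_left_mono Bessel_gaussian H s) auto
    also have "\<dots> = ennreal (sqrt (2 * pi) * s * (sqrt (2 * pi) / s)) * N"
      using s by (subst ennreal_mult) (auto simp: mult.assoc)
    also have "sqrt (2 * pi) * s * (sqrt (2 * pi) / s) = 2 * pi" using s by (simp add: field_simps)
    finally show ?thesis .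
  qed
  have "(\<integral>\<^sup>+u. ennreal ((cmod (FT H u))\<^sup>2) \<partial>lborel) = (\<integral>\<^sup>+u. liminf (\<lambda>n. ennreal ((cmod (FT H u))\<^sup>2 * e n u)) \<partial>lborel)"
  proof (rule nn_integral_cong)
    fix u :: real
    have "(\<lambda>n. - u\<^sup>2 / (2 * (real (Suc n))\<^sup>2)) \<longlonglongrightarrow> 0" by real_asymp
    then have "(\<lambda>n. e n u) \<longlonglongrightarrow> exp 0" unfolding e_def by (rule tendsto_exp)
    then have "(\<lambda>n. ennreal ((cmod (FT H u))\<^sup>2 * e n u)) \<longlonglongrightarrow> ennreal ((cmod (FT H u))\<^sup>2 * exp 0)"
      by (intro tendsto_intros)
    from lim_imp_Liminf[OF _ this]
    show "ennreal ((cmod (FT H u))\<^sup>2) = liminf (\<lambda>n. ennreal ((cmod (FT H u))\<^sup>2 * e n u))" by simp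
  qed
  also have "\<dots> \<le> liminf (\<lambda>n. \<integral>\<^sup>+u. ennreal ((cmod (FT H u))\<^sup>2 * e n u) \<partial>lborel)"
    by (rule nn_integral_liminf) (auto simp: e_def)
  also have "\<dots> \<le> ennreal (2 * pi) * N"
    by (rule Liminf_le) (use b in auto)
  finally show ?thesis by (simp add: N_def)
qed

section \<open>The Fourier--Plancherel transform\<close>

lemma L2_mult_integrable:
  fixes a b :: "real \<Rightarrow> complex"
  assumes [measurable]: "a \<in> borel_measurable borel" "b \<in> borel_measurable borel"
    and a: "integrable lborel (\<lambda>x. (cmod (a x))\<^sup>2)" and b: "integrable lborel (\<lambda>x. (cmod (b x))\<^sup>2)"
  shows "integrable lborel (\<lambda>x. a x * b x)"
proof (rule Bochner_Integration.integrable_bound[where f="\<lambda>x. (cmod (a x))\<^sup>2 + (cmod (b x))\<^sup>2"])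
  show "AE x in lborel. norm (a x * b x) \<le> norm ((cmod (a x))\<^sup>2 + (cmod (b x))\<^sup>2)"
  proof (rule AE_I2)
    fix x
    have "2 * (cmod (a x) * cmod (b x)) \<le> (cmod (a x))\<^sup>2 + (cmod (b x))\<^sup>2"
      using zero_le_power2[of "cmod (a x) - cmod (b x)"] by (simp add: power2_diff)
    moreover have "0 \<le> cmod (a x) * cmod (b x)" by simp
    ultimately show "norm (a x * b x) \<le> norm ((cmod (a x))\<^sup>2 + (cmod (b x))\<^sup>2)"
      unfolding norm_mult real_norm_def by linarith
  qed
qed (use a b in auto)

text \<open>A weighted inequality between arithmetic and geometric mean takes the place of
  Cauchy-Schwarz. The filter is arbitrary because the truncation radius below runs through the
  reals.\<close>

lemma L2_mult_tendsto_0: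
  fixes a :: "'i \<Rightarrow> real \<Rightarrow> complex" and b :: "real \<Rightarrow> complex"
  assumes [measurable]: "\<And>i. a i \<in> borel_measurable borel" "b \<in> borel_measurable borel"
    and a: "\<And>i. integrable lborel (\<lambda>x. (cmod (a i x))\<^sup>2)" and b: "integrable lborel (\<lambda>x. (cmod (b x))\<^sup>2)"
    and lim: "((\<lambda>i. LINT x|lborel. (cmod (a i x))\<^sup>2) \<longlongrightarrow> 0) F"
  shows "((\<lambda>i. CLINT x|lborel. a i x * b x) \<longlongrightarrow> 0) F"
proof (rule tendstoI)
  fix e :: real assume e: "e > 0"
  define B where "B = (LINT x|lborel. (cmod (b x))\<^sup>2)"
  have B: "B \<ge> 0" by (simp add: B_def)
  \<comment> \<open>With this weight the contribution of the fixed function \<open>b\<close> is at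
    most \<open>e / 2\<close>; the added 1 covers the case \<open>B = 0\<close>.\<close>
  define s where "s = e / (B + 1)"
  have s: "s > 0" using e B by (simp add: s_def)
  have "eventually (\<lambda>i. dist (LINT x|lborel. (cmod (a i x))\<^sup>2) 0 < s * e) F"
    using lim s e by (intro tendstoD) auto
  then show "eventually (\<lambda>i. dist (CLINT x|lborel. a i x * b x) 0 < e) F"
  proof eventually_elim
    case (elim i)
    have am: "cmod (a i x * b x) \<le> (1 / (2 * s)) * (cmod (a i x))\<^sup>2 + (s / 2) * (cmod (b x))\<^sup>2" for x
      using zero_le_power2[of "cmod (a i x) - s * cmod (b x)"] s
      by (simp add: power2_diff norm_mult field_simps power2_eq_square)
    have "cmod (CLINT x|lborel. a i x * b x) \<le> (LINT x|lborel. (1 / (2 * s)) * (cmod (a i x))\<^sup>2 + (s / 2) * (cmod (b x))\<^sup>2)"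
      by (rule order_trans[OF integral_norm_bound], rule integral_mono)
         (use a b am in \<open>auto intro!: L2_mult_integrable integrable_norm\<close>)
    also have "\<dots> = (1 / (2 * s)) * (LINT x|lborel. (cmod (a i x))\<^sup>2) + (s / 2) * B"
      unfolding B_def using a b by (subst Bochner_Integration.integral_add) auto
    also have "(1 / (2 * s)) * (LINT x|lborel. (cmod (a i x))\<^sup>2) < (1 / (2 * s)) * (s * e)"
      using elim s by (intro mult_strict_left_mono) (auto simp: dist_real_def)
    also have "(1 / (2 * s)) * (s * e) = e / 2" using s by simp
    also have "(s / 2) * B \<le> e / 2" using e B by (simp add: s_def field_simps)
    finally show ?case by simp
  qed
qed

lemma FT_diff:
  "integrable lborel f \<Longrightarrow> integrable lborel g \<Longrightarrow> FT (\<lambda>x. f x - g x) u = FT f u - FT g u"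
  unfolding FT_def right_diff_distrib
  by (intro Bochner_Integration.integral_diff FT_integrand_integrable)

definition truncate :: "real \<Rightarrow> (real \<Rightarrow> complex) \<Rightarrow> real \<Rightarrow> complex" where
  "truncate R f x = indicator {-R..R} x *\<^sub>R f x"

lemma truncate_measurable [measurable]:
  "f \<in> borel_measurable borel \<Longrightarrow> truncate R f \<in> borel_measurable borel"
  unfolding truncate_def by measurable

lemma FT_truncate:
  "FT (truncate R f) u = set_lebesgue_integral lborel {-R..R} (\<lambda>x. iexp (u * x) * f x)"
  unfolding FT_def set_lebesgue_integral_def truncate_def by simp

lemma integrable_truncate:
  assumes [measurable]: "f \<in> borel_measurable borel" and f: "integrable lborel (\<lambda>x. (cmod (f x))\<^sup>2)"
  shows "integrable lborel (truncate R f)"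
proof (rule Bochner_Integration.integrable_bound[where f="\<lambda>x. indicat_real {-R..R} x + (cmod (f x))\<^sup>2"])
  have "cmod (f x) \<le> 1 + (cmod (f x))\<^sup>2" for x
    using zero_le_power2[of "cmod (f x) - 1"] norm_ge_zero[of "f x"] unfolding power2_diff one_power2 by linarith
  then show "AE x in lborel. norm (truncate R f x) \<le> norm (indicat_real {-R..R} x + (cmod (f x))\<^sup>2)"
    by (intro AE_I2) (auto simp: truncate_def indicator_def)
  show "integrable lborel (\<lambda>x. indicat_real {-R..R} x + (cmod (f x))\<^sup>2)"
    using f by (intro Bochner_Integration.integrable_add integrable_real_indicator) (auto intro!: emeasure_compact_finite[unfolded infinity_ennreal_def])
qed auto

text \<open>By Bessel's inequality the truncated transforms are Cauchy in L2, with distances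
  governed by the tail \<open>\<tau>\<close> of \<open>f\<close>. The limit is built as in the
  Riesz-Fischer theorem: a fast subsequence converges almost everywhere, and Fatou's lemma carries
  the bound over to the whole family. The conclusion repeats the predicate inside the choice that
  defines \<open>FT_L2\<close>.\<close>

lemma FT_L2_exists:
  assumes [measurable]: "f \<in> borel_measurable borel" and f: "integrable lborel (\<lambda>x. (cmod (f x))\<^sup>2)"
  shows "\<exists>G. G \<in> borel_measurable lborel \<and> integrable lborel (\<lambda>u. (cmod (G u))\<^sup>2) \<and>
      ((\<lambda>R. LINT u|lborel.
          (cmod (set_lebesgue_integral lborel {-R..R} (\<lambda>x. iexp (u * x) * f x) - G u))\<^sup>2)
        \<longlongrightarrow> 0) at_top"
proof -
  define T where "T R = FT (truncate R f)" for R
  have [measurable]: "T R \<in> borel_measurable borel" for R unfolding T_def by measurable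
  define \<tau> where "\<tau> R = (LINT x|lborel. indicat_real (- {-R..R}) x * (cmod (f x))\<^sup>2)" for R
  have \<tau>int: "integrable lborel (\<lambda>x. indicat_real (- {-R..R}) x * (cmod (f x))\<^sup>2)" for R
    by (rule Bochner_Integration.integrable_bound[OF f]) (auto simp: indicator_def)
  have \<tau>0: "\<tau> R \<ge> 0" for R unfolding \<tau>_def by (rule integral_nonneg_AE) auto
  have \<tau>lim: "(\<tau> \<longlongrightarrow> 0) at_top"
  proof -
    have "((\<lambda>R. LINT x|lborel. indicat_real (- {-R..R}) x * (cmod (f x))\<^sup>2) \<longlongrightarrow> integral\<^sup>L lborel (\<lambda>x::real. 0::real)) at_top"
    proof (rule integral_dominated_convergence_at_top[where w="\<lambda>x. (cmod (f x))\<^sup>2"])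
      show "\<forall>\<^sub>F R in at_top. AE x in lborel. norm (indicat_real (- {-R..R}) x * (cmod (f x))\<^sup>2) \<le> (cmod (f x))\<^sup>2"
        by (auto simp: indicator_def)
      show "AE x in lborel. ((\<lambda>R. indicat_real (- {-R..R}) x * (cmod (f x))\<^sup>2) \<longlongrightarrow> 0) at_top"
      proof (rule AE_I2, rule tendsto_eventually)
        fix x :: real
        show "\<forall>\<^sub>F R in at_top. indicat_real (- {-R..R}) x * (cmod (f x))\<^sup>2 = 0"
          using eventually_ge_at_top[of "\<bar>x\<bar>"] by eventually_elim (auto simp: indicator_def)
      qed
    qed (use f in auto)
    then show ?thesis unfolding \<tau>_def by simp
  qed
  have \<tau>mono: "\<tau> S \<le> \<tau> R" if "R \<le> S" for R S
    unfolding \<tau>_def by (rule integral_mono[OF \<tau>int \<tau>int]) (use that in \<open>auto simp: indicator_def\<close>)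
  have diff: "(\<integral>\<^sup>+u. ennreal ((cmod (T S u - T R u))\<^sup>2) \<partial>lborel) \<le> ennreal (2 * pi * \<tau> (min R S))" for R S
  proof -
    have "(\<integral>\<^sup>+u. ennreal ((cmod (T S u - T R u))\<^sup>2) \<partial>lborel)
      = (\<integral>\<^sup>+u. ennreal ((cmod (FT (\<lambda>x. truncate S f x - truncate R f x) u))\<^sup>2) \<partial>lborel)"
      unfolding T_def by (subst FT_diff) (auto intro!: integrable_truncate f)
    also have "\<dots> \<le> ennreal (2 * pi) * (\<integral>\<^sup>+x. ennreal ((cmod (truncate S f x - truncate R f x))\<^sup>2) \<partial>lborel)"
      by (intro Bessel_ineq Bochner_Integration.integrable_diff integrable_truncate f) auto
    also have "\<dots> \<le> ennreal (2 * pi) * (\<integral>\<^sup>+x. ennreal (indicat_real (- {-min R S..min R S}) x * (cmod (f x))\<^sup>2) \<partial>lborel)"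
      by (intro mult_left_mono nn_integral_mono ennreal_leI) (auto simp: truncate_def indicator_def)
    also have "\<dots> = ennreal (2 * pi * \<tau> (min R S))"
      unfolding \<tau>_def by (subst nn_integral_eq_integral[OF \<tau>int]) (auto simp: ennreal_mult'[symmetric])
    finally show ?thesis .
  qed
  have "\<exists>R. \<tau> R \<le> (1/4)^k" for k
    using order_tendstoD(2)[OF \<tau>lim, of "(1/4)^k"] by (auto dest!: eventually_happens intro: less_imp_le)
  then obtain r where r: "\<And>k. \<tau> (r k) \<le> (1/4)^k" by metis
  \<comment> \<open>Tails of size \<open>(1/4)^k\<close> leave room for the weight
    \<open>2^k\<close>: the weighted squares are still summable in the mean. Hence almost everywhere
    \<open>D k u\<close> decays like \<open>(1/2)^k\<close>, and its square root, the actual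
    increment, is geometric.\<close>
  define D where "D k u = (cmod (T (r (Suc k)) u - T (r k) u))\<^sup>2" for k u
  have D0: "D k u \<ge> 0" for k u by (simp add: D_def)
  have [measurable]: "D k \<in> borel_measurable borel" for k unfolding D_def by measurable
  have "(\<integral>\<^sup>+u. (\<Sum>k. ennreal (2^k * D k u)) \<partial>lborel) = (\<Sum>k. \<integral>\<^sup>+u. ennreal (2^k * D k u) \<partial>lborel)"
    by (rule nn_integral_suminf) auto
  also have "\<dots> \<le> (\<Sum>k. ennreal (2 * pi * (1/2)^k))"
  proof (rule suminf_le)
    fix k
    \<comment> \<open>The radii \<open>r k\<close> need not increase with \<open>k\<close>, so the
      smaller of two consecutive ones may be either.\<close>
    have m: "\<tau> (min (r k) (r (Suc k))) \<le> (1/4)^k"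
    proof (cases "r k \<le> r (Suc k)")
      case False
      have "(1/4)^Suc k \<le> (1/4::real)^k" by simp
      with r[of "Suc k"] False show ?thesis by (simp only: min_def if_False)
    qed (use r[of k] in simp)
    have "(\<integral>\<^sup>+u. ennreal (2^k * D k u) \<partial>lborel) = ennreal (2^k) * (\<integral>\<^sup>+u. ennreal (D k u) \<partial>lborel)"
      by (subst nn_integral_cmult[symmetric]) (auto simp: ennreal_mult' D0)
    also have "\<dots> \<le> ennreal (2^k) * ennreal (2 * pi * (1/4)^k)"
      unfolding D_def using m by (intro mult_left_mono order_trans[OF diff] ennreal_leI) auto
    also have "\<dots> = ennreal (2 * pi * (1/2)^k)"
      by (simp add: ennreal_mult'[symmetric] power_divide power_mult_distrib[symmetric] field_simps)
    finally show "(\<integral>\<^sup>+u. ennreal (2^k * D k u) \<partial>lborel) \<le> ennreal (2 * pi * (1/2)^k)" .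
  qed auto
  also have "\<dots> < \<infinity>"
    by (subst suminf_ennreal2) (auto intro!: summable_mult summable_geometric)
  finally have "(\<integral>\<^sup>+u. (\<Sum>k. ennreal (2^k * D k u)) \<partial>lborel) \<noteq> \<infinity>" by simp
  then have AEfin: "AE u in lborel. (\<Sum>k. ennreal (2^k * D k u)) \<noteq> \<infinity>"
    by (rule nn_integral_noteq_infinite[rotated]) auto
  \<comment> \<open>\<open>lim\<close> is total, so \<open>G\<close> is measurable everywhere
    although convergence is only known almost everywhere.\<close>
  define G where "G u = lim (\<lambda>k. T (r k) u)" for u
  have [measurable]: "G \<in> borel_measurable borel" unfolding G_def by measurable
  have AElim: "AE u in lborel. (\<lambda>k. T (r k) u) \<longlonglongrightarrow> G u"
    using AEfin
  proof eventually_elim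
    case (elim u)
    define s where "s = enn2real (\<Sum>k. ennreal (2^k * D k u))"
    have s0: "s \<ge> 0" by (simp add: s_def)
    have "2^k * D k u \<le> s" for k
    proof -
      have "ennreal (2^k * D k u) \<le> (\<Sum>k. ennreal (2^k * D k u))"
        using sum_le_suminf[of "\<lambda>k. ennreal (2^k * D k u)" "{k}"] by simp
      also have "\<dots> = ennreal s" using elim by (simp add: s_def less_top)
      finally show ?thesis using s0 by simp
    qed
    then have "D k u \<le> s * (1/2)^k" for k by (simp add: power_divide field_simps)
    then have "sqrt (D k u) \<le> sqrt s * (sqrt (1/2))^k" for k
      by (metis real_sqrt_le_mono real_sqrt_mult real_sqrt_power)
    then have le: "norm (T (r (Suc k)) u - T (r k) u) \<le> sqrt s * (sqrt (1/2))^k" for k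
      by (simp add: D_def)
    have "sqrt (1/2) < 1" by (subst real_sqrt_lt_1_iff) simp
    then have "summable (\<lambda>k. sqrt s * (sqrt (1/2))^k)"
      by (intro summable_mult summable_geometric) (simp only: real_norm_def abs_of_nonneg real_sqrt_ge_zero)
    then have "summable (\<lambda>k. T (r (Suc k)) u - T (r k) u)"
      by (rule summable_comparison_test') (rule le)
    then have "(\<lambda>n. T (r 0) u + (\<Sum>k<n. (T (r (Suc k)) u - T (r k) u))) \<longlonglongrightarrow> T (r 0) u + (\<Sum>k. T (r (Suc k)) u - T (r k) u)"
      by (intro tendsto_intros summable_LIMSEQ)
    then have "convergent (\<lambda>n. T (r n) u)"
      unfolding sum_lessThan_telescope[of "\<lambda>k. T (r k) u"] by (auto simp: convergent_def)
    then show ?case by (simp add: G_def convergent_LIMSEQ_iff)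
  qed
  \<comment> \<open>The minimum of \<open>r k\<close> and \<open>R\<close> is one of the two, so the
    tail in \<open>diff\<close> is at most \<open>\<tau> R\<close> plus a term that vanishes with
    \<open>k\<close>.\<close>
  have bd: "(\<integral>\<^sup>+u. ennreal ((cmod (T R u - G u))\<^sup>2) \<partial>lborel) \<le> ennreal (2 * pi * \<tau> R)" for R
  proof -
    have "(\<integral>\<^sup>+u. ennreal ((cmod (T R u - G u))\<^sup>2) \<partial>lborel) = (\<integral>\<^sup>+u. liminf (\<lambda>k. ennreal ((cmod (T R u - T (r k) u))\<^sup>2)) \<partial>lborel)"
    proof (rule nn_integral_cong_AE)
      show "AE u in lborel. ennreal ((cmod (T R u - G u))\<^sup>2) = liminf (\<lambda>k. ennreal ((cmod (T R u - T (r k) u))\<^sup>2))"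
        using AElim
      proof eventually_elim
        case (elim u)
        have "(\<lambda>k. ennreal ((cmod (T R u - T (r k) u))\<^sup>2)) \<longlonglongrightarrow> ennreal ((cmod (T R u - G u))\<^sup>2)"
          by (intro tendsto_intros elim)
        from lim_imp_Liminf[OF _ this] show ?case by simp
      qed
    qed
    also have "\<dots> \<le> liminf (\<lambda>k. \<integral>\<^sup>+u. ennreal ((cmod (T R u - T (r k) u))\<^sup>2) \<partial>lborel)"
      by (rule nn_integral_liminf) auto
    also have "\<dots> \<le> liminf (\<lambda>k. ennreal (2 * pi * (\<tau> R + (1/4)^k)))"
    proof (intro Liminf_mono always_eventually allI order_trans[OF diff] ennreal_leI mult_left_mono)
      fix k show "\<tau> (min (r k) R) \<le> \<tau> R + (1/4)^k"
        using r[of k] \<tau>0[of R] by (cases "r k \<le> R") (auto simp: min_def)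
    qed auto
    also have "\<dots> = ennreal (2 * pi * (\<tau> R + 0))"
      by (intro lim_imp_Liminf tendsto_intros LIMSEQ_power_zero tendsto_ennrealI) auto
    finally show ?thesis by simp
  qed
  \<comment> \<open>Any single truncated transform can serve as the reference from which
    \<open>G\<close> inherits square integrability; radius 0 is chosen.\<close>
  have sqT: "(\<integral>\<^sup>+u. ennreal ((cmod (T 0 u))\<^sup>2) \<partial>lborel) < \<infinity>"
  proof -
    have "(\<integral>\<^sup>+u. ennreal ((cmod (T 0 u))\<^sup>2) \<partial>lborel) \<le> ennreal (2 * pi) * (\<integral>\<^sup>+x. ennreal ((cmod (truncate 0 f x))\<^sup>2) \<partial>lborel)"
      unfolding T_def by (intro Bessel_ineq integrable_truncate f) auto
    also have "\<dots> \<le> ennreal (2 * pi) * (\<integral>\<^sup>+x. ennreal ((cmod (f x))\<^sup>2) \<partial>lborel)"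
      by (intro mult_left_mono nn_integral_mono) (auto simp: truncate_def indicator_def)
    also have "\<dots> = ennreal (2 * pi) * ennreal (LINT x|lborel. (cmod (f x))\<^sup>2)"
      by (subst nn_integral_eq_integral[OF f]) auto
    also have "\<dots> < \<infinity>" by (simp add: ennreal_mult'[symmetric])
    finally show ?thesis .
  qed
  have iD: "integrable lborel (\<lambda>u. (cmod (T R u - G u))\<^sup>2)" for R
    by (rule integrableI_nonneg) (auto intro!: le_less_trans[OF bd])
  have "integrable lborel (\<lambda>u. (cmod (T 0 u))\<^sup>2)"
    by (rule integrableI_nonneg) (use sqT in auto)
  with iD[of 0] have "integrable lborel (\<lambda>u. 2 * (cmod (T 0 u - G u))\<^sup>2 + 2 * (cmod (T 0 u))\<^sup>2)"
    by (intro Bochner_Integration.integrable_add integrable_mult_right)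
  then have "integrable lborel (\<lambda>u. (cmod (G u))\<^sup>2)"
  proof (rule Bochner_Integration.integrable_bound)
    show "AE u in lborel. norm ((cmod (G u))\<^sup>2) \<le> norm (2 * (cmod (T 0 u - G u))\<^sup>2 + 2 * (cmod (T 0 u))\<^sup>2)"
    proof (rule AE_I2)
      fix u
      have "cmod (G u) \<le> cmod (T 0 u - G u) + cmod (T 0 u)"
        using norm_triangle_ineq4[of "T 0 u" "T 0 u - G u"] by simp
      then have "(cmod (G u))\<^sup>2 \<le> (cmod (T 0 u - G u) + cmod (T 0 u))\<^sup>2" by (intro power_mono) auto
      also have "\<dots> \<le> 2 * (cmod (T 0 u - G u))\<^sup>2 + 2 * (cmod (T 0 u))\<^sup>2"
        using zero_le_power2[of "cmod (T 0 u - G u) - cmod (T 0 u)"] by (simp add: power2_diff power2_sum)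
      finally show "norm ((cmod (G u))\<^sup>2) \<le> norm (2 * (cmod (T 0 u - G u))\<^sup>2 + 2 * (cmod (T 0 u))\<^sup>2)" by simp
    qed
  qed auto
  moreover have "((\<lambda>R. LINT u|lborel. (cmod (T R u - G u))\<^sup>2) \<longlongrightarrow> 0) at_top"
  proof (rule tendsto_sandwich[where f="\<lambda>_. 0" and h="\<lambda>R. 2 * pi * \<tau> R"])
    show "\<forall>\<^sub>F R in at_top. (LINT u|lborel. (cmod (T R u - G u))\<^sup>2) \<le> 2 * pi * \<tau> R"
    proof (rule always_eventually, rule allI)
      fix R
      have "ennreal (LINT u|lborel. (cmod (T R u - G u))\<^sup>2) \<le> ennreal (2 * pi * \<tau> R)"
        using bd[of R] by (subst (asm) nn_integral_eq_integral[OF iD]) auto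
      then show "(LINT u|lborel. (cmod (T R u - G u))\<^sup>2) \<le> 2 * pi * \<tau> R" using \<tau>0 by simp
    qed
    show "((\<lambda>R. 2 * pi * \<tau> R) \<longlongrightarrow> 0) at_top"
      using tendsto_mult_right_zero[OF \<tau>lim] by simp
  qed auto
  ultimately show ?thesis
    by (intro exI[of _ G]) (auto simp: T_def FT_truncate)
qed

context
  fixes f :: "real \<Rightarrow> complex"
  assumes f_meas [measurable]: "f \<in> borel_measurable borel"
    and f_L2: "integrable lborel (\<lambda>x. (cmod (f x))\<^sup>2)"
begin

text \<open>\<open>FT_L2\<close> is a Hilbert choice, so these properties are the only access to
  it.\<close>

lemma
  shows FT_L2_measurable: "FT_L2 f \<in> borel_measurable borel"
    and FT_L2_square_integrable: "integrable lborel (\<lambda>u. (cmod (FT_L2 f u))\<^sup>2)"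
    and FT_L2_tendsto: "((\<lambda>R. LINT u|lborel. (cmod (FT (truncate R f) u - FT_L2 f u))\<^sup>2) \<longlongrightarrow> 0) at_top"
  using someI_ex[OF FT_L2_exists[OF f_meas f_L2]] unfolding FT_L2_def[symmetric] FT_truncate by auto

text \<open>For each truncation this is \<open>FT_duality\<close>. As the radius grows, one side
  converges by domination and the other by L2 convergence of the transforms. Integrability of
  \<open>a\<close> gives \<open>FT a\<close> a pointwise meaning, square integrability pairs
  \<open>a\<close> with the L2 limit.\<close>

lemma FT_L2_duality:
  assumes a: "integrable lborel a" and a2: "integrable lborel (\<lambda>u. (cmod (a u))\<^sup>2)"
  shows "(CLINT x|lborel. f x * FT a x) = (CLINT u|lborel. FT_L2 f u * a u)"
    and "integrable lborel (\<lambda>x. f x * FT a x)"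
proof -
  have [measurable]: "a \<in> borel_measurable borel" using a by auto
  note [measurable] = FT_L2_measurable
  note tr = integrable_truncate[OF f_meas f_L2]
  have sq: "integrable lborel (\<lambda>x. (cmod (FT b x))\<^sup>2)" if b: "integrable lborel b" "integrable lborel (\<lambda>u. (cmod (b u))\<^sup>2)" for b
  proof (rule integrableI_nonneg)
    have [measurable]: "b \<in> borel_measurable borel" using b by auto
    show "(\<lambda>x. (cmod (FT b x))\<^sup>2) \<in> borel_measurable lborel" by measurable
    have "(\<integral>\<^sup>+x. ennreal ((cmod (FT b x))\<^sup>2) \<partial>lborel) \<le> ennreal (2 * pi) * (\<integral>\<^sup>+x. ennreal ((cmod (b x))\<^sup>2) \<partial>lborel)"
      by (rule Bessel_ineq[OF b(1)])
    also have "\<dots> = ennreal (2 * pi * (LINT x|lborel. (cmod (b x))\<^sup>2))"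
      by (subst nn_integral_eq_integral[OF b(2)]) (auto simp: ennreal_mult'[symmetric])
    also have "\<dots> < \<infinity>" by simp
    finally show "(\<integral>\<^sup>+x. ennreal ((cmod (FT b x))\<^sup>2) \<partial>lborel) < \<infinity>" .
  qed auto
  have tr2: "integrable lborel (\<lambda>x. (cmod (truncate R f x))\<^sup>2)" for R
    by (rule Bochner_Integration.integrable_bound[OF f_L2]) (auto simp: truncate_def indicator_def)
  show fi: "integrable lborel (\<lambda>x. f x * FT a x)"
    by (rule L2_mult_integrable) (auto intro!: sq a a2 f_L2)
  have "((\<lambda>R. CLINT x|lborel. truncate R f x * FT a x) \<longlongrightarrow> (CLINT x|lborel. f x * FT a x)) at_top"
  proof (rule integral_dominated_convergence_at_top[where w="\<lambda>x. norm (f x * FT a x)"])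
    show "\<forall>\<^sub>F R in at_top. AE x in lborel. norm (truncate R f x * FT a x) \<le> norm (f x * FT a x)"
      by (auto simp: truncate_def indicator_def)
    show "AE x in lborel. ((\<lambda>R. truncate R f x * FT a x) \<longlongrightarrow> f x * FT a x) at_top"
    proof (rule AE_I2, rule tendsto_eventually)
      fix x :: real
      show "\<forall>\<^sub>F R in at_top. truncate R f x * FT a x = f x * FT a x"
        using eventually_ge_at_top[of "\<bar>x\<bar>"] by eventually_elim (auto simp: truncate_def indicator_def)
    qed
  qed (use fi in \<open>auto intro!: integrable_norm\<close>)
  then have l1: "((\<lambda>R. CLINT u|lborel. FT (truncate R f) u * a u) \<longlongrightarrow> (CLINT x|lborel. f x * FT a x)) at_top"
    by (simp add: FT_duality[OF tr a])
  have dsq: "integrable lborel (\<lambda>u. (cmod (FT (truncate R f) u - FT_L2 f u))\<^sup>2)" for R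
  proof (rule Bochner_Integration.integrable_bound[where f="\<lambda>u. 2 * (cmod (FT (truncate R f) u))\<^sup>2 + 2 * (cmod (FT_L2 f u))\<^sup>2"])
    show "AE u in lborel. norm ((cmod (FT (truncate R f) u - FT_L2 f u))\<^sup>2) \<le> norm (2 * (cmod (FT (truncate R f) u))\<^sup>2 + 2 * (cmod (FT_L2 f u))\<^sup>2)"
    proof (rule AE_I2)
      fix u
      let ?a = "FT (truncate R f) u" and ?b = "FT_L2 f u"
      have "(cmod (?a - ?b))\<^sup>2 \<le> (cmod ?a + cmod ?b)\<^sup>2" by (intro power_mono norm_triangle_ineq4) auto
      also have "\<dots> \<le> 2 * (cmod ?a)\<^sup>2 + 2 * (cmod ?b)\<^sup>2"
        using zero_le_power2[of "cmod ?a - cmod ?b"] by (simp add: power2_diff power2_sum)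
      finally show "norm ((cmod (?a - ?b))\<^sup>2) \<le> norm (2 * (cmod ?a)\<^sup>2 + 2 * (cmod ?b)\<^sup>2)" by simp
    qed
  qed (use FT_L2_square_integrable sq[OF tr tr2] in auto)
  have ia: "integrable lborel (\<lambda>u. FT_L2 f u * a u)" by (rule L2_mult_integrable) (auto intro!: FT_L2_square_integrable a2)
  have ib: "integrable lborel (\<lambda>u. FT (truncate R f) u * a u)" for R
    by (rule L2_mult_integrable) (auto intro!: sq tr tr2 a2)
  have "((\<lambda>R. CLINT u|lborel. (FT (truncate R f) u - FT_L2 f u) * a u) \<longlongrightarrow> 0) at_top"
    by (rule L2_mult_tendsto_0) (auto intro!: dsq a2 FT_L2_tendsto)
  then have "((\<lambda>R. (CLINT u|lborel. FT (truncate R f) u * a u) - (CLINT u|lborel. FT_L2 f u * a u)) \<longlongrightarrow> 0) at_top"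
    by (simp add: left_diff_distrib ia ib)
  then have "((\<lambda>R. CLINT u|lborel. FT (truncate R f) u * a u) \<longlongrightarrow> (CLINT u|lborel. FT_L2 f u * a u)) at_top"
    using LIM_zero_iff by blast
  with l1 show "(CLINT x|lborel. f x * FT a x) = (CLINT u|lborel. FT_L2 f u * a u)"
    by (rule tendsto_unique[rotated]) auto
qed

end

section \<open>Injectivity and inversion of the Fourier transform\<close>

text \<open>Levy's uniqueness theorem concerns probability laws, so \<open>f\<close> is split into
  its positive and negative parts. Their transforms agree, at 0 they give the common mass
  \<open>c\<close>, and after division by \<open>c\<close> the two densities have the same
  characteristic function. If \<open>c\<close> is 0 there is nothing to normalise and both parts
  vanish almost everywhere.\<close>

lemma FT_eq_0_AE_real:
  fixes f :: "real \<Rightarrow> real"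
  assumes f: "integrable lborel f" and 0: "\<And>u. FT (\<lambda>x. complex_of_real (f x)) u = 0"
  shows "AE x in lborel. f x = 0"
proof -
  have [measurable]: "f \<in> borel_measurable borel" using f by auto
  define p where "p x = max (f x) 0" for x
  define m where "m x = max (- f x) 0" for x
  have [measurable]: "p \<in> borel_measurable borel" "m \<in> borel_measurable borel"
    unfolding p_def m_def by measurable
  have p: "integrable lborel p" and m: "integrable lborel m"
    by (rule Bochner_Integration.integrable_bound[OF f]; auto simp: p_def m_def)+
  have p0: "p x \<ge> 0" and m0: "m x \<ge> 0" and fpm: "f x = p x - m x" for x
    by (auto simp: p_def m_def)
  have pc: "integrable lborel (\<lambda>x. complex_of_real (p x))" and mc: "integrable lborel (\<lambda>x. complex_of_real (m x))"
    using p m by auto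
  have eq: "FT (\<lambda>x. complex_of_real (p x)) u = FT (\<lambda>x. complex_of_real (m x)) u" for u
    using 0[of u] FT_diff[OF pc mc, of u] by (simp add: fpm)
  define c where "c = integral\<^sup>L lborel p"
  have cm: "c = integral\<^sup>L lborel m"
    using eq[of 0] by (simp add: FT_def c_def)
  have c0: "c \<ge> 0" unfolding c_def using p0 by (intro integral_nonneg_AE) auto
  have "AE x in lborel. p x = m x"
  proof (cases "c = 0")
    case True
    then have "AE x in lborel. p x = 0" "AE x in lborel. m x = 0"
      using integral_nonneg_eq_0_iff_AE[OF p] integral_nonneg_eq_0_iff_AE[OF m] p0 m0 c_def cm by auto
    then show ?thesis by eventually_elim simp
  next
    case False
    with c0 have c: "c > 0" by simp
    have rd: "real_distribution (density lborel (\<lambda>x. ennreal (q x / c)))"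
      if q: "integrable lborel q" "\<And>x. 0 \<le> q x" "integral\<^sup>L lborel q = c" for q
    proof -
      have [measurable]: "q \<in> borel_measurable borel" using q by auto
      have "(\<integral>\<^sup>+x. ennreal (q x / c) \<partial>lborel) = 1"
        using c q by (subst nn_integral_eq_integral) auto
      then have "prob_space (density lborel (\<lambda>x. ennreal (q x / c)))"
        by (intro prob_spaceI) (simp add: emeasure_density)
      then show ?thesis by (simp add: real_distribution_def real_distribution_axioms_def)
    qed
    have ch: "char (density lborel (\<lambda>x. ennreal (q x / c))) t = FT (\<lambda>x. complex_of_real (q x)) t / c"
      if q: "q \<in> borel_measurable borel" "\<And>x. 0 \<le> q x" for q t
    proof -
      note [measurable] = q(1)
      have "char (density lborel (\<lambda>x. ennreal (q x / c))) t = (CLINT x|lborel. (q x / c) *\<^sub>R iexp (t * x))"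
        unfolding char_def using c q(2) by (subst integral_density) auto
      also have "\<dots> = FT (\<lambda>x. complex_of_real (q x)) t / c"
        unfolding FT_def by (subst integral_divide_zero[symmetric])
          (auto simp: scaleR_conv_of_real mult_ac intro!: Bochner_Integration.integral_cong)
      finally show ?thesis .
    qed
    have "density lborel (\<lambda>x. ennreal (p x / c)) = density lborel (\<lambda>x. ennreal (m x / c))"
    proof (rule Levy_uniqueness)
      show "real_distribution (density lborel (\<lambda>x. ennreal (p x / c)))"
        by (rule rd) (use p p0 c_def in auto)
      show "real_distribution (density lborel (\<lambda>x. ennreal (m x / c)))"
        by (rule rd) (use m m0 cm in auto)
      show "char (density lborel (\<lambda>x. ennreal (p x / c))) = char (density lborel (\<lambda>x. ennreal (m x / c)))"
        using ch[of p] ch[of m] p0 m0 eq by auto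
    qed
    then have "AE x in lborel. ennreal (p x / c) = ennreal (m x / c)"
      by (subst (asm) sigma_finite_measure.density_unique_iff) (auto intro: sigma_finite_lborel)
    then show ?thesis by eventually_elim (use c p0 m0 in simp)
  qed
  then show ?thesis by eventually_elim (simp add: fpm)
qed

text \<open>Conjugation only reflects the frequency, so the transform of the conjugate vanishes as
  well, and with it the transforms of the real and imaginary parts.\<close>

lemma FT_eq_0_AE:
  assumes f: "integrable lborel f" and 0: "\<And>u. FT f u = 0"
  shows "AE x in lborel. f x = 0"
proof -
  have c: "FT (\<lambda>x. cnj (f x)) u = 0" for u
    using 0[of "- u"] cnj_FT[of f "-u"]
      lborel_integral_real_affine[where c="-1" and t=0 and f="\<lambda>x. iexp (u * x) * cnj (f x)"]
    by (simp add: FT_def)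
  have ci: "integrable lborel (\<lambda>x. cnj (f x))" using f by simp
  have re: "AE x in lborel. Re (f x) = 0"
  proof (rule FT_eq_0_AE_real)
    fix u
    have "FT (\<lambda>x. complex_of_real (Re (f x))) u = (CLINT x|lborel. (iexp (u * x) * f x + iexp (u * x) * cnj (f x)) / 2)"
      unfolding FT_def by (intro Bochner_Integration.integral_cong refl) (simp add: complex_add_cnj flip: distrib_left)
    also have "\<dots> = (FT f u + FT (\<lambda>x. cnj (f x)) u) / 2"
      unfolding FT_def
      using Bochner_Integration.integral_add[OF FT_integrand_integrable[OF f] FT_integrand_integrable[OF ci], of u u] by simp
    finally show "FT (\<lambda>x. complex_of_real (Re (f x))) u = 0" using 0 c by simp
  qed (use f in auto)
  have im: "AE x in lborel. Im (f x) = 0"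
  proof (rule FT_eq_0_AE_real)
    fix u
    have Im: "complex_of_real (Im z) = (z - cnj z) / (2 * \<i>)" for z
      by (simp add: complex_diff_cnj complex_eq_iff)
    have "FT (\<lambda>x. complex_of_real (Im (f x))) u = (CLINT x|lborel. (iexp (u * x) * f x - iexp (u * x) * cnj (f x)) / (2 * \<i>))"
      unfolding FT_def by (intro Bochner_Integration.integral_cong refl) (simp only: Im right_diff_distrib times_divide_eq_right)
    also have "\<dots> = (FT f u - FT (\<lambda>x. cnj (f x)) u) / (2 * \<i>)"
      unfolding FT_def
      using Bochner_Integration.integral_diff[OF FT_integrand_integrable[OF f] FT_integrand_integrable[OF ci], of u u] by simp
    finally show "FT (\<lambda>x. complex_of_real (Im (f x))) u = 0" using 0 c by simp
  qed (use f in auto)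
  from re im show ?thesis by eventually_elim (simp add: complex_eq_iff)
qed

lemma iFT_eq_FT: "iFT G x = complex_of_real (1 / (2 * pi)) * FT G (- x)"
  by (simp add: iFT_def FT_def mult.commute)

lemma FT_reflect: "FT (\<lambda>u. G (- u)) x = FT G (- x)"
  unfolding FT_def by (subst lborel_integral_real_affine[where c="-1" and t=0]) auto

lemma FT_std_normal_density:
  "FT (\<lambda>u. complex_of_real (std_normal_density u)) x = complex_of_real (exp (- x\<^sup>2 / 2))"
  using normal_integral_iexp[of 1 x] by (simp add: FT_def mult.commute)

lemma FT_gaussian:
  "FT (\<lambda>x. complex_of_real (exp (- x\<^sup>2 / 2))) s = complex_of_real (2 * pi * std_normal_density s)"
proof -
  have "FT (\<lambda>x. complex_of_real (exp (- x\<^sup>2 / 2))) s = FT (\<lambda>x. complex_of_real (sqrt (2 * pi)) * complex_of_real (std_normal_density x)) s"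
    by (simp add: std_normal_density_def)
  also have "\<dots> = complex_of_real (sqrt (2 * pi)) * FT (\<lambda>x. complex_of_real (std_normal_density x)) s"
    by (simp add: FT_def mult.left_commute[of "exp _"])
  also have "\<dots> = complex_of_real (sqrt (2 * pi) * (sqrt (2 * pi) * std_normal_density s))"
    unfolding FT_std_normal_density by (simp add: std_normal_density_def)
  finally show ?thesis by (simp flip: mult.assoc)
qed

lemma FT_modulate: "FT (\<lambda>x. iexp (v * x) * f x) u = FT f (u + v)"
  unfolding FT_def by (simp add: exp_add ring_distribs mult_ac)

text \<open>A Gaussian weight makes both sides integrable, and then their transforms coincide.\<close>

lemma Fourier_inversion:
  assumes k: "integrable lborel k" and N: "integrable lborel (FT k)"
  shows "AE x in lborel. k x = iFT (FT k) x"
proof -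
  define W where "W = (\<lambda>x::real. complex_of_real (exp (- x\<^sup>2 / 2)))"
  define w where "w = (\<lambda>x. complex_of_real (std_normal_density x))"
  have [measurable]: "k \<in> borel_measurable borel" using k by auto
  have [measurable]: "W \<in> borel_measurable borel" "w \<in> borel_measurable borel" unfolding W_def w_def by measurable
  have w: "integrable lborel w" unfolding w_def by (intro integrable_of_real) auto
  have W: "integrable lborel W"
  proof -
    have "W = (\<lambda>x. complex_of_real (sqrt (2 * pi)) * w x)" by (simp add: W_def w_def std_normal_density_def)
    then show ?thesis using w by simp
  qed
  have FTw: "FT w x = W x" for x unfolding w_def W_def by (rule FT_std_normal_density)
  have FTW: "FT W s = 2 * pi * w s" for s unfolding w_def W_def FT_gaussian by simp
  have wev: "w (- x) = w x" for x by (simp add: w_def std_normal_density_def)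
  define k0 where "k0 = iFT (FT k)"
  have k0: "k0 x = complex_of_real (1 / (2 * pi)) * FT (\<lambda>u. FT k (- u)) x" for x
    unfolding k0_def iFT_eq_FT FT_reflect ..
  have k0': "k0 = (\<lambda>x. complex_of_real (1 / (2 * pi)) * FT (\<lambda>u. FT k (- u)) x)" using k0 by auto
  have N': "integrable lborel (\<lambda>u. FT k (- u))" by (rule integrable_reflect[OF N])
  have [measurable]: "k0 \<in> borel_measurable borel" unfolding k0' by measurable
  have Wk: "integrable lborel (\<lambda>x. W x * k x)"
    by (rule Bochner_Integration.integrable_bound[OF k]) (auto simp: norm_mult W_def intro!: AE_I2 mult_left_le_one_le)
  define C where "C = 1 / (2 * pi) * (LINT u|lborel. cmod (FT k (- u)))"
  have k0b: "cmod (k0 x) \<le> C" for x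
    unfolding k0 C_def norm_mult using norm_FT_le[of "\<lambda>u. FT k (- u)" x] by (simp add: norm_divide norm_mult divide_right_mono)
  have Wk0: "integrable lborel (\<lambda>x. W x * k0 x)"
  proof (rule Bochner_Integration.integrable_bound[where f="\<lambda>x. C * W x"])
    show "AE x in lborel. norm (W x * k0 x) \<le> norm (complex_of_real C * W x)"
      using k0b order_trans[OF norm_ge_zero k0b]
      by (auto simp: norm_mult mult.commute[of "cmod (W _)"] intro!: AE_I2 mult_right_mono)
  qed (use W in auto)
  \<comment> \<open>Both transforms are the integral of \<open>FT k\<close> against a translate of
    the Gaussian \<open>w\<close>: the left one because \<open>FT w\<close> is \<open>W\<close>, the
    right one because \<open>FT W\<close> is \<open>2 * pi\<close> times \<open>w\<close>, the
    factor that cancels the one in \<open>iFT\<close>. Evenness of \<open>w\<close> absorbs the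
    reflection.\<close>
  have "FT (\<lambda>x. W x * k x) v = FT (\<lambda>x. W x * k0 x) v" for v
  proof -
    have "FT (\<lambda>x. W x * k x) v = (CLINT x|lborel. FT w x * (iexp (v * x) * k x))"
      unfolding FT_def[where u=v] FTw by (simp add: mult_ac)
    also have "\<dots> = (CLINT u|lborel. w u * FT k (u + v))"
      by (subst FT_duality[OF w FT_integrand_integrable[OF k]]) (simp only: FT_modulate)
    also have "\<dots> = (CLINT y|lborel. w (y - v) * FT k y)"
      by (subst lborel_integral_real_affine[where c=1 and t="-v"]) auto
    also have "\<dots> = (CLINT u|lborel. FT k (- u) * w (u + v))"
      using wev by (subst lborel_integral_real_affine[where c="-1" and t=0])
        (auto simp: mult.commute minus_diff_commute simp flip: wev[of "_ + v"])
    also have "\<dots> = 1 / (2 * pi) * (CLINT u|lborel. FT k (- u) * FT (\<lambda>x. iexp (v * x) * W x) u)"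
      unfolding FT_modulate FTW by (subst integral_mult_right_zero[symmetric]) (simp add: mult_ac)
    also have "\<dots> = 1 / (2 * pi) * (CLINT x|lborel. FT (\<lambda>u. FT k (- u)) x * (iexp (v * x) * W x))"
      by (subst FT_duality[OF N' FT_integrand_integrable[OF W]]) simp
    also have "\<dots> = FT (\<lambda>x. W x * k0 x) v"
      unfolding FT_def[where u=v] k0 by (subst integral_mult_right_zero[symmetric]) (simp add: mult_ac)
    finally show ?thesis .
  qed
  then have "AE x in lborel. W x * k x - W x * k0 x = 0"
    by (intro FT_eq_0_AE) (auto intro!: Wk Wk0 simp: FT_diff[OF Wk Wk0])
  then show ?thesis unfolding k0_def[symmetric] by eventually_elim (simp add: W_def)
qed

section \<open>The continuous logarithm and the remainder function\<close>

text \<open>Within distance 1/2 of 1 the principal logarithm is itself a continuous logarithm, so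
  the choice has a witness. Any two continuous logarithms differ by a continuous function with
  values in the multiples of 2 \<pi> i; on an interval it is constant, and it vanishes at 0.\<close>

lemma cont_log_eq_Ln:
  assumes r: "continuous_on {-T..T} r" "r 0 = 1" and T: "T \<ge> 0"
    and near: "\<And>u. u \<in> {-T..T} \<Longrightarrow> cmod (r u - 1) \<le> 1 / 2" and u: "u \<in> {-T..T}"
  shows "cont_log r T u = Ln (r u)"
proof -
  have Re: "Re (r u) > 0" if "u \<in> {-T..T}" for u
    using near[OF that] abs_Re_le_cmod[of "r u - 1"] by simp
  then have nz: "r u \<noteq> 0" and npos: "r u \<notin> \<real>\<^sub>\<le>\<^sub>0" if "u \<in> {-T..T}" for u
    using that by (force simp: complex_nonpos_Reals_iff)+
  have ex: "\<exists>L. continuous_on {-T..T} L \<and> L 0 = 0 \<and> (\<forall>u\<in>{-T..T}. exp (L u) = r u)"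
    using r nz npos by (intro exI[of _ "\<lambda>u. Ln (r u)"]) (auto intro!: continuous_intros)
  define L where "L = cont_log r T"
  have L: "continuous_on {-T..T} L" "L 0 = 0" "\<And>u. u \<in> {-T..T} \<Longrightarrow> exp (L u) = r u"
    using someI_ex[OF ex] unfolding L_def cont_log_def by auto
  define d where "d u = L u - Ln (r u)" for u
  have dZ: "\<exists>n::int. d u = 2 * of_int n * pi * \<i>" if "u \<in> {-T..T}" for u
    using exp_eq[of "L u" "Ln (r u)"] L(3)[OF that] nz[OF that] by (auto simp: d_def)
  have "d constant_on {-T..T}"
  proof (rule continuous_discrete_range_constant)
    show "continuous_on {-T..T} d"
      unfolding d_def by (intro continuous_intros L r npos)
    fix x assume x: "x \<in> {-T..T}"
    show "\<exists>e>0. \<forall>y. y \<in> {-T..T} \<and> d y \<noteq> d x \<longrightarrow> e \<le> norm (d y - d x)"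
    proof (intro exI[of _ 1] conjI allI impI)
      fix y assume y: "y \<in> {-T..T} \<and> d y \<noteq> d x"
      obtain n m :: int where nm: "d x = 2 * of_int n * pi * \<i>" "d y = 2 * of_int m * pi * \<i>"
        using dZ x y by blast
      with y have "n \<noteq> m" by auto
      have "d y - d x = of_int (2 * (m - n)) * pi * \<i>" by (simp add: nm algebra_simps)
      then have "norm (d y - d x) = \<bar>of_int (2 * (m - n))\<bar> * pi"
        by (simp only: norm_mult norm_of_int norm_of_real norm_ii) (simp add: abs_mult)
      also have "\<dots> \<ge> 1 * 1"
        using \<open>n \<noteq> m\<close> pi_gt3 by (intro mult_mono) auto
      finally show "1 \<le> norm (d y - d x)" by simp
    qed simp
  qed auto
  then have "d u = d 0" using u T unfolding constant_on_def by force
  then show ?thesis by (simp add: d_def L_def[symmetric] L r)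
qed

text \<open>On the slit plane \<open>Ln s + z / s\<close> is a primitive of the integrand, and the
  segment from 1 to \<open>z\<close> stays in the slit plane.\<close>

lemma R_fun_eq:
  assumes z: "z \<notin> \<real>\<^sub>\<le>\<^sub>0"
  shows "R_fun z = Ln z + 1 - z"
proof -
  have seg: "closed_segment 1 z \<subseteq> - \<real>\<^sub>\<le>\<^sub>0"
  proof
    fix w assume "w \<in> closed_segment 1 z"
    then obtain t where t: "0 \<le> t" "t \<le> 1" "w = (1 - t) *\<^sub>R 1 + t *\<^sub>R z" by (auto simp: in_segment)
    show "w \<in> - \<real>\<^sub>\<le>\<^sub>0"
    proof (cases "t = 0 \<or> Im z \<noteq> 0")
      case True
      then show ?thesis using t by (auto simp: complex_nonpos_Reals_iff)
    next
      case False
      with z have "Re z > 0" by (auto simp: complex_nonpos_Reals_iff)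
      then have "Re w > 0" using t False by (simp add: add_nonneg_pos)
      then show ?thesis by (auto simp: complex_nonpos_Reals_iff)
    qed
  qed
  have "((\<lambda>s. (s - z) / s\<^sup>2) has_contour_integral
      ((\<lambda>s. Ln s + z / s) (pathfinish (linepath 1 z)) - (\<lambda>s. Ln s + z / s) (pathstart (linepath 1 z)))) (linepath 1 z)"
  proof (rule contour_integral_primitive[where S="- \<real>\<^sub>\<le>\<^sub>0"])
    fix s :: complex assume s: "s \<in> - \<real>\<^sub>\<le>\<^sub>0"
    then have "s \<noteq> 0" by auto
    with s show "((\<lambda>s. Ln s + z / s) has_field_derivative (s - z) / s\<^sup>2) (at s within - \<real>\<^sub>\<le>\<^sub>0)"
      by (auto intro!: derivative_eq_intros simp: field_simps power2_eq_square)
  qed (use seg in auto)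
  then show ?thesis
    using z unfolding R_fun_def by (subst contour_integral_unique) (auto simp: algebra_simps)
qed

text \<open>On the negative half-line the path of integration meets the pole, where the integral
  diverges and takes its default value.\<close>

lemma R_fun_nonpos:
  assumes "z \<in> \<real>\<^sub>\<le>\<^sub>0"
  shows "R_fun z = 0"
proof -
  obtain r where zr: "z = complex_of_real r" and r: "r \<le> 0"
    using assms by (auto simp: nonpos_Reals_def)
  define F where "F t = (linepath 1 z t - z) / (linepath 1 z t)\<^sup>2 * (z - 1)" for t
  have "\<not> F integrable_on {0..1}"
  proof
    assume F: "F integrable_on {0..1}"
    \<comment> \<open>An indefinite integral is continuous, hence bounded on the unit interval; the
      primitive contradicts this near the pole.\<close>
    have "bounded ((\<lambda>t. integral {0..t} F) ` {0..1})"
      by (intro compact_imp_bounded compact_continuous_image indefinite_integral_continuous_1 F) auto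
    then obtain B where "\<forall>x\<in>(\<lambda>t. integral {0..t} F) ` {0..1}. cmod x \<le> B"
      unfolding bounded_iff ..
    then have B: "\<And>t. t \<in> {0..1} \<Longrightarrow> cmod (integral {0..t} F) \<le> B" by blast
    have B0: "B \<ge> 0" using B[of 0] by simp
    \<comment> \<open>A point before the pole at which the logarithm alone is below
      \<open>- (B + \<bar>r\<bar>)\<close>: the term \<open>r / s0\<close> is not positive and
      \<open>- r\<close> is \<open>\<bar>r\<bar>\<close>, so the integral up to there is less than
      \<open>- B\<close>. The segment passes \<open>s0\<close> at time \<open>T\<close>.\<close>
    define s0 where "s0 = exp (- (B + \<bar>r\<bar> + 1))"
    have s0: "0 < s0" "s0 \<le> 1" using B0 by (auto simp: s0_def)
    define T where "T = (1 - s0) / (1 - r)"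
    have T: "0 \<le> T" "T \<le> 1" using s0 r by (auto simp: T_def field_simps)
    define s where "s t = 1 + t * (r - 1)" for t
    have sT: "s T = s0" using r by (simp add: s_def T_def field_simps)
    have spos: "s t > 0" if "t \<in> {0..T}" for t
    proof -
      have "T * (r - 1) \<le> t * (r - 1)" using that r by (intro mult_right_mono_neg) auto
      then show ?thesis using sT s0 by (simp add: s_def)
    qed
    have "(F has_integral complex_of_real (ln (s T) + r / s T) - complex_of_real (ln (s 0) + r / s 0)) {0..T}"
    proof (rule fundamental_theorem_of_calculus)
      fix t assume t: "t \<in> {0..T}"
      have ds: "(s has_real_derivative (r - 1)) (at t within {0..T})"
        unfolding s_def by (auto intro!: derivative_eq_intros)
      have lp: "linepath 1 z t = complex_of_real (s t)" by (simp add: linepath_def s_def zr scaleR_conv_of_real algebra_simps)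
      have "F t = complex_of_real ((s t - r) / (s t)\<^sup>2 * (r - 1))" by (simp add: F_def lp) (simp add: zr)
      moreover have "((\<lambda>t. ln (s t) + r / s t) has_real_derivative (s t - r) / (s t)\<^sup>2 * (r - 1)) (at t within {0..T})"
        using spos[OF t] by (auto intro!: derivative_eq_intros ds simp: field_simps power2_eq_square)
      ultimately show "((\<lambda>t. complex_of_real (ln (s t) + r / s t)) has_vector_derivative F t) (at t within {0..T})"
        by (auto intro!: has_vector_derivative_of_real simp: has_real_derivative_iff_has_vector_derivative simp del: of_real_add of_real_divide of_real_mult)
    qed (use T in auto)
    then have "integral {0..T} F = complex_of_real (ln s0 + r / s0 - r)"
      using sT by (subst integral_unique) (auto simp: s_def)
    with B[of T] T have "\<bar>ln s0 + r / s0 - r\<bar> \<le> B" by (simp only: norm_of_real) simp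
    moreover have "ln s0 = - (B + \<bar>r\<bar> + 1)" by (simp add: s0_def)
    moreover have "r / s0 \<le> 0" using r s0 by (simp add: divide_nonpos_pos)
    ultimately show False using r by (simp add: abs_if split: if_splits)
  qed
  then have "\<not> (\<lambda>s. (s - z) / s\<^sup>2) contour_integrable_on linepath 1 z"
    unfolding contour_integrable_on_def has_contour_integral_linepath F_def[abs_def] integrable_on_def .
  then show ?thesis by (simp add: R_fun_def not_integrable_contour_integral)
qed

text \<open>Together the two cases give a closed form on the whole plane, continuous off the slit
  and zero on it. Outcomes for which the quotient of characteristic functions falls on the slit are
  thereby covered.\<close>

lemma R_fun_measurable [measurable]: "R_fun \<in> borel_measurable borel"
proof -
  have "R_fun = (\<lambda>z. indicator (- \<real>\<^sub>\<le>\<^sub>0) z *\<^sub>R (Ln z + 1 - z))"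
    by (auto simp: R_fun_eq R_fun_nonpos indicator_def)
  also have "\<dots> \<in> borel_measurable borel"
  proof (rule borel_measurable_continuous_on_indicator)
    show "(- \<real>\<^sub>\<le>\<^sub>0 :: complex set) \<in> sets borel" by (intro borel_open open_Compl) auto
    show "continuous_on (- \<real>\<^sub>\<le>\<^sub>0) (\<lambda>z. Ln z + 1 - z)" by (auto intro!: continuous_intros)
  qed
  finally show ?thesis .
qed

text \<open>\<open>R_fun\<close> is the error of the linear approximation of the logarithm at 1. The
  constant 2 is 1 / (1 - 1/2), from the radius of the disc.\<close>

lemma norm_R_fun_le:
  assumes "cmod (z - 1) \<le> 1 / 2"
  shows "cmod (R_fun z) \<le> 2 * (cmod (z - 1))\<^sup>2"
proof -
  have "Re z > 0" using assms abs_Re_le_cmod[of "z - 1"] by simp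
  then have "R_fun z = Ln (1 + (z - 1)) - (z - 1)"
    by (subst R_fun_eq) (auto simp: complex_nonpos_Reals_iff)
  also have "cmod \<dots> \<le> (cmod (z - 1))\<^sup>2 / (1 - cmod (z - 1))"
    using assms by (intro Ln_approx_linear) simp
  also have "\<dots> \<le> (cmod (z - 1))\<^sup>2 / (1 / 2)"
    using assms by (intro divide_left_mono) auto
  finally show ?thesis by simp
qed

section \<open>Convolution powers and the inverse of the compound Poisson law\<close>

lemma finite_borel_bounded_integrable:
  fixes f :: "real \<Rightarrow> 'b :: {banach, second_countable_topology}"
  assumes "finite_measure \<mu>" "sets \<mu> = sets borel" "f \<in> borel_measurable borel" "\<And>x. norm (f x) \<le> B"
  shows "integrable \<mu> f"
proof -
  interpret finite_measure \<mu> by fact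
  have "f \<in> borel_measurable \<mu>" using assms(2,3) by (simp cong: measurable_cong_sets)
  then show ?thesis by (rule integrable_const_bound[rotated]) (use assms in auto)
qed

lemma char_convolution:
  assumes \<mu>: "finite_measure \<mu>" "sets \<mu> = sets borel" and \<rho>: "finite_measure \<rho>" "sets \<rho> = sets borel"
  shows "char (convolution \<mu> \<rho>) u = char \<mu> u * char \<rho> u"
proof -
  interpret M: finite_measure \<mu> by fact
  interpret N: finite_measure \<rho> by fact
  interpret P: pair_sigma_finite \<mu> \<rho> ..
  interpret F: finite_measure "\<mu> \<Otimes>\<^sub>M \<rho>" by (intro finite_measure_pair_measure \<mu> \<rho>)
  note [measurable_cong] = \<mu>(2) \<rho>(2)
  have int: "integrable (\<mu> \<Otimes>\<^sub>M \<rho>) (\<lambda>(x, y). iexp (u * (x + y)))"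
    by (rule F.integrable_const_bound[of _ 1]) auto
  have "char (convolution \<mu> \<rho>) u = (CLINT z|(\<mu> \<Otimes>\<^sub>M \<rho>). case z of (x, y) \<Rightarrow> iexp (u * (x + y)))"
    unfolding char_def convolution_def by (subst integral_distr) (auto simp: case_prod_beta')
  also have "\<dots> = (CLINT x|\<mu>. CLINT y|\<rho>. iexp (u * (x + y)))"
    using P.integral_fst'[OF int] by simp
  also have "\<dots> = (CLINT x|\<mu>. iexp (u * x) * char \<rho> u)"
    unfolding char_def by (simp add: ring_distribs exp_add)
  also have "\<dots> = char \<mu> u * char \<rho> u"
    unfolding char_def by simp
  finally show ?thesis .
qed

context
  fixes \<mu> :: "real measure"
  assumes \<mu>: "finite_measure \<mu>" "sets \<mu> = sets borel"
begin

lemma conv_pow_finite: "finite_measure (conv_pow \<mu> k)" and sets_conv_pow: "sets (conv_pow \<mu> k) = sets borel"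
proof (induction k)
  case 0
  { case 1 show ?case by (simp add: prob_space.finite_measure prob_space_return) }
  { case 2 show ?case by simp }
next
  case (Suc k)
  { case 1 show ?case using Suc \<mu> by (simp add: convolution_finite) }
  { case 2 show ?case by simp }
qed

lemma char_conv_pow: "char (conv_pow \<mu> k) u = (char \<mu> u) ^ k"
proof (induction k)
  case 0 then show ?case by (simp add: char_def integral_return)
next
  case (Suc k) then show ?case by (simp add: char_convolution \<mu> conv_pow_finite sets_conv_pow)
qed

text \<open>Total mass is the characteristic function at the origin, so it inherits multiplicativity
  from \<open>char_conv_pow\<close>.\<close>

lemma measure_conv_pow: "measure (conv_pow \<mu> k) UNIV = measure \<mu> UNIV ^ k"
proof -
  have "char \<rho> 0 = measure \<rho> UNIV" if "sets \<rho> = sets borel" for \<rho> :: "real measure"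
    using sets_eq_imp_space_eq[OF that] by (simp add: char_def scaleR_conv_of_real)
  with char_conv_pow[of k 0] have "complex_of_real (measure (conv_pow \<mu> k) UNIV) = complex_of_real (measure \<mu> UNIV ^ k)"
    by (simp add: sets_conv_pow \<mu>)
  then show ?thesis by (simp only: of_real_eq_iff)
qed

lemma norm_integral_conv_pow_le:
  fixes f :: "real \<Rightarrow> real"
  assumes f: "f \<in> borel_measurable borel" "\<And>x. \<bar>f x\<bar> \<le> B"
  shows "\<bar>LINT y|conv_pow \<mu> k. f (c - y)\<bar> \<le> B * measure \<mu> UNIV ^ k"
proof -
  interpret finite_measure "conv_pow \<mu> k" by (rule conv_pow_finite)
  note [measurable] = f(1)
  have "norm (LINT y|conv_pow \<mu> k. f (c - y)) \<le> (LINT y|conv_pow \<mu> k. norm (f (c - y)))"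
    by (rule integral_norm_bound)
  also have "\<dots> \<le> (LINT y|conv_pow \<mu> k. B)"
    using f by (intro integral_mono finite_borel_bounded_integrable[OF conv_pow_finite sets_conv_pow, where B="\<bar>B\<bar>"])
      (auto intro: order_trans[OF _ abs_ge_self])
  also have "\<dots> = B * measure \<mu> UNIV ^ k"
    using sets_eq_imp_space_eq[OF sets_conv_pow[of k]] measure_conv_pow[of k] by simp
  finally show ?thesis by simp
qed

end

context
  fixes \<nu> :: "real measure" and lam \<gamma> \<Delta> :: real
  assumes nu: "finite_measure \<nu>" "sets \<nu> = sets borel" and mass: "measure \<nu> (space \<nu>) = lam"
    and Delta: "\<Delta> > 0"
begin

abbreviation \<nu>' where "\<nu>' \<equiv> distr \<nu> borel uminus"

lemma uminus_measurable_nu: "uminus \<in> measurable \<nu> borel"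
  using nu(2) by (simp cong: measurable_cong_sets)

lemma nu'_finite: "finite_measure \<nu>'"
  by (intro finite_measure.finite_measure_distr nu uminus_measurable_nu)

lemma measure_nu': "measure \<nu>' UNIV = lam"
  using mass sets_eq_imp_space_eq[OF nu(2)] by (subst measure_distr[OF uminus_measurable_nu]) auto

lemma char_nu': "char \<nu>' u = char \<nu> (- u)"
  unfolding char_def by (subst integral_distr[OF uminus_measurable_nu]) auto

lemma norm_char_nu_le: "cmod (char \<nu> u) \<le> lam"
  unfolding char_def using mass by (intro order_trans[OF integral_norm_bound]) simp

lemmas conv_pow_nu = conv_pow_finite[OF nu'_finite] sets_conv_pow[OF nu'_finite]

context
  fixes f :: "real \<Rightarrow> real" and B :: real
  assumes f [measurable]: "f \<in> borel_measurable borel" and fB: "\<And>x. \<bar>f x\<bar> \<le> B"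
begin

text \<open>The bound is a term of the exponential series of \<open>\<Delta> * lam\<close>,
  independent of the point \<open>c\<close> and of \<open>f\<close> beyond its bound. It dominates
  in the uniform bound, in the passage to the limit and in the Fourier representation.\<close>

lemma conv_M_term_le:
  "\<bar>(- \<Delta>) ^ k / fact k * (LINT y|conv_pow \<nu>' k. f (c - y))\<bar> \<le> B * ((\<Delta> * lam) ^ k /\<^sub>R fact k)"
proof -
  have "\<bar>(- \<Delta>) ^ k / fact k * (LINT y|conv_pow \<nu>' k. f (c - y))\<bar> = \<Delta> ^ k / fact k * \<bar>LINT y|conv_pow \<nu>' k. f (c - y)\<bar>"
    using Delta by (simp add: abs_mult power_abs)
  also have "\<dots> \<le> \<Delta> ^ k / fact k * (B * lam ^ k)"
    using norm_integral_conv_pow_le[OF nu'_finite _ f fB, of k c] Delta unfolding measure_nu'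
    by (intro mult_left_mono) auto
  finally show ?thesis by (simp add: power_mult_distrib scaleR_conv_of_real divide_inverse mult_ac)
qed

lemma conv_M_bound_summable: "summable (\<lambda>k. B * ((\<Delta> * lam) ^ k /\<^sub>R fact k))"
  by (intro summable_mult summable_exp_generic)

text \<open>One factor \<open>exp (lam * \<Delta>)\<close> is the prefactor of M, the other bounds
  its alternating series by the series of absolute values.\<close>

lemma abs_conv_M_le: "\<bar>conv_M \<Delta> \<gamma> lam \<nu> f x\<bar> \<le> exp (2 * lam * \<Delta>) * B"
proof -
  have "norm (\<Sum>k. (- \<Delta>) ^ k / fact k * (LINT y|conv_pow \<nu>' k. f (x - \<gamma> * \<Delta> - y))) \<le> (\<Sum>k. B * ((\<Delta> * lam) ^ k /\<^sub>R fact k))"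
    by (intro norm_suminf_le conv_M_bound_summable) (use conv_M_term_le in simp)
  also have "\<dots> = B * exp (\<Delta> * lam)"
    by (simp only: suminf_mult[OF summable_exp_generic] exp_def)
  finally have "\<bar>conv_M \<Delta> \<gamma> lam \<nu> f x\<bar> \<le> exp (lam * \<Delta>) * (B * exp (\<Delta> * lam))"
    unfolding conv_M_def abs_mult by (simp only: abs_exp_cancel real_norm_def mult_left_mono exp_ge_zero)
  also have "\<dots> = exp (2 * lam * \<Delta>) * B"
    by (simp add: exp_add[symmetric] algebra_simps)
  finally show ?thesis .
qed

lemma conv_M_measurable: "conv_M \<Delta> \<gamma> lam \<nu> f \<in> borel_measurable borel"
proof -
  have [measurable]: "(\<lambda>x. LINT y|conv_pow \<nu>' k. f (x - \<gamma> * \<Delta> - y)) \<in> borel_measurable borel" for k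
  proof -
    interpret finite_measure "conv_pow \<nu>' k" by (rule conv_pow_nu) simp
    note [measurable_cong] = sets_conv_pow[OF nu'_finite sets_distr]
    show ?thesis by measurable
  qed
  show ?thesis unfolding conv_M_def by measurable
qed

end

text \<open>Two dominated limits: inside each convolution power, a finite measure, with the constant
  \<open>B\<close> as majorant; then Tannery's theorem for the sum, with a majorant that does not
  depend on \<open>n\<close>.\<close>

lemma conv_M_tendsto:
  assumes f: "\<And>n. f n \<in> borel_measurable borel" and fB: "\<And>n x. \<bar>f n x\<bar> \<le> B"
    and lim: "\<And>x. (\<lambda>n. f n x) \<longlonglongrightarrow> F x"
  shows "(\<lambda>n. conv_M \<Delta> \<gamma> lam \<nu> (f n) x) \<longlonglongrightarrow> conv_M \<Delta> \<gamma> lam \<nu> F x"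
proof -
  have [measurable]: "F \<in> borel_measurable borel" by (rule borel_measurable_LIMSEQ_metric[OF f lim])
  have "(\<lambda>n. \<Sum>k. (- \<Delta>) ^ k / fact k * (LINT y|conv_pow \<nu>' k. f n (x - \<gamma> * \<Delta> - y)))
     \<longlonglongrightarrow> (\<Sum>k. (- \<Delta>) ^ k / fact k * (LINT y|conv_pow \<nu>' k. F (x - \<gamma> * \<Delta> - y)))"
  proof (rule tannerys_theorem[THEN conjunct2, THEN conjunct2])
    show "summable (\<lambda>k. B * ((\<Delta> * lam) ^ k /\<^sub>R fact k))"
      by (intro summable_mult summable_exp_generic)
    fix k
    interpret finite_measure "conv_pow \<nu>' k" by (rule conv_pow_nu) simp
    note [measurable_cong] = sets_conv_pow[OF nu'_finite sets_distr]
    show "(\<lambda>n. (- \<Delta>) ^ k / fact k * (LINT y|conv_pow \<nu>' k. f n (x - \<gamma> * \<Delta> - y)))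
      \<longlonglongrightarrow> (- \<Delta>) ^ k / fact k * (LINT y|conv_pow \<nu>' k. F (x - \<gamma> * \<Delta> - y))"
      by (intro tendsto_mult_left integral_dominated_convergence[where w="\<lambda>_. B"])
         (use f fB lim in auto)
  next
    show "\<forall>\<^sub>F (k, n) in sequentially \<times>\<^sub>F sequentially.
       norm ((- \<Delta>) ^ k / fact k * (LINT y|conv_pow \<nu>' k. f n (x - \<gamma> * \<Delta> - y))) \<le> B * ((\<Delta> * lam) ^ k /\<^sub>R fact k)"
      using conv_M_term_le[OF f fB] by (intro always_eventually) auto
  qed auto
  then show ?thesis unfolding conv_M_def by (intro tendsto_mult_left)
qed

lemma cpp_char_nonzero: "cpp_char \<Delta> \<gamma> lam \<nu> u \<noteq> 0"
  by (simp add: cpp_char_def)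

text \<open>The drift only rotates, and the real part of \<open>char \<nu>\<close> is at least
  \<open>- lam\<close>.\<close>

lemma norm_cpp_char_ge: "cmod (cpp_char \<Delta> \<gamma> lam \<nu> u) \<ge> exp (- (2 * lam * \<Delta>))"
proof -
  have "Re (char \<nu> u) \<ge> - lam" using norm_char_nu_le[of u] abs_Re_le_cmod[of "char \<nu> u"] by linarith
  then have "\<Delta> * (- lam) \<le> \<Delta> * Re (char \<nu> u)" using Delta by (intro mult_left_mono) auto
  then show ?thesis by (simp add: cpp_char_def norm_exp_eq_Re algebra_simps)
qed

lemma char_nu_continuous: "continuous_on UNIV (char \<nu>)"
proof (rule continuous_on_sequentiallyI)
  fix X :: "nat \<Rightarrow> real" and a assume X: "X \<longlonglongrightarrow> a"
  interpret finite_measure \<nu> by (rule nu)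
  note [measurable_cong] = nu(2)
  show "(\<lambda>n. char \<nu> (X n)) \<longlonglongrightarrow> char \<nu> a"
    unfolding char_def
    by (rule integral_dominated_convergence[where w="\<lambda>x. 1"])
       (use X in \<open>auto intro!: tendsto_intros\<close>)
qed

lemma cpp_char_continuous: "continuous_on UNIV (cpp_char \<Delta> \<gamma> lam \<nu>)"
  unfolding cpp_char_def by (intro continuous_intros char_nu_continuous)

lemma cpp_char_measurable: "cpp_char \<Delta> \<gamma> lam \<nu> \<in> borel_measurable borel"
  by (rule borel_measurable_continuous_onI[OF cpp_char_continuous])

lemma cpp_char_0: "cpp_char \<Delta> \<gamma> lam \<nu> 0 = 1"
  using mass by (simp add: cpp_char_def char_def scaleR_conv_of_real)

text \<open>M acts on frequencies as division by \<open>cpp_char\<close>. Reflection of the jump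
  measure makes the k-th convolution power contribute \<open>char \<nu> u ^ k\<close>, the series
  sums to \<open>exp (- \<Delta> * char \<nu> u)\<close>, and prefactor and shift complete this to
  the reciprocal. Integrability of \<open>A\<close> justifies every interchange, since all other
  factors are bounded uniformly in \<open>u\<close>.\<close>

lemma conv_M_Fourier:
  assumes A: "integrable lborel A" and f [measurable]: "f \<in> borel_measurable borel"
    and fA: "\<And>x. complex_of_real (f x) = (CLINT u|lborel. A u * iexp (u * x))"
  shows "complex_of_real (conv_M \<Delta> \<gamma> lam \<nu> f x) = (CLINT u|lborel. A u / cpp_char \<Delta> \<gamma> lam \<nu> u * iexp (u * x))"
proof -
  have [measurable]: "A \<in> borel_measurable borel" using A by auto
  have [measurable]: "char \<nu> \<in> borel_measurable borel"
    by (rule borel_measurable_continuous_onI[OF char_nu_continuous])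
  define C where "C = (LINT u|lborel. cmod (A u))"
  have fB: "\<bar>f x\<bar> \<le> C" for x
  proof -
    have "cmod (complex_of_real (f x)) \<le> (LINT u|lborel. cmod (A u * iexp (u * x)))"
      unfolding fA by (rule integral_norm_bound)
    then show ?thesis by (simp add: C_def norm_mult)
  qed
  \<comment> \<open>The shift by the drift is a phase factor and is absorbed into the density once
    and for all.\<close>
  define b where "b u = A u * iexp (u * (x - \<gamma> * \<Delta>))" for u
  have [measurable]: "b \<in> borel_measurable borel" unfolding b_def by measurable
  have b: "integrable lborel b"
    using FT_integrand_integrable[OF A, of "x - \<gamma> * \<Delta>"] by (simp add: b_def[abs_def] mult_ac)
  have nb: "cmod (b u) = cmod (A u)" for u by (simp add: b_def norm_mult)
  have inner: "complex_of_real (LINT y|conv_pow \<nu>' k. f (x - \<gamma> * \<Delta> - y)) = (CLINT u|lborel. b u * char \<nu> u ^ k)" for k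
  proof -
    interpret F: finite_measure "conv_pow \<nu>' k" by (rule conv_pow_nu) simp
    note [measurable_cong] = sets_conv_pow[OF nu'_finite sets_distr]
    interpret P: pair_sigma_finite "conv_pow \<nu>' k" "lborel :: real measure" ..
    have "integrable (conv_pow \<nu>' k \<Otimes>\<^sub>M lborel) (\<lambda>(y, u). b u * iexp (- (u * y)))"
    proof (rule P.Fubini_integrable)
      show "integrable (conv_pow \<nu>' k) (\<lambda>y. LINT u|lborel. norm (case (y, u) of (y, u) \<Rightarrow> b u * iexp (- (u * y))))"
        by (simp add: norm_mult)
      show "AE y in conv_pow \<nu>' k. integrable lborel (\<lambda>u. case (y, u) of (y, u) \<Rightarrow> b u * iexp (- (u * y)))"
      proof (rule AE_I2)
        fix y show "integrable lborel (\<lambda>u. case (y, u) of (y, u) \<Rightarrow> b u * iexp (- (u * y)))"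
          using FT_integrand_integrable[OF b, of "- y"] by (simp add: mult_ac)
      qed
    qed measurable
    note fub = P.Fubini_integral[OF this]
    have "complex_of_real (LINT y|conv_pow \<nu>' k. f (x - \<gamma> * \<Delta> - y)) = (CLINT y|conv_pow \<nu>' k. complex_of_real (f (x - \<gamma> * \<Delta> - y)))"
      by simp
    also have "\<dots> = (CLINT y|conv_pow \<nu>' k. CLINT u|lborel. b u * iexp (- (u * y)))"
      unfolding fA b_def by (simp add: ring_distribs mult_ac exp_add[symmetric])
    also have "\<dots> = (CLINT u|lborel. CLINT y|conv_pow \<nu>' k. b u * iexp (- (u * y)))"
      using fub by simp
    also have "\<dots> = (CLINT u|lborel. b u * char (conv_pow \<nu>' k) (- u))"
      by (simp add: char_def)
    also have "\<dots> = (CLINT u|lborel. b u * char \<nu> u ^ k)"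
      by (simp add: char_conv_pow[OF nu'_finite sets_distr] char_nu')
    finally show ?thesis .
  qed
  define c where "c k u = complex_of_real ((- \<Delta>) ^ k / fact k) * (b u * char \<nu> u ^ k)" for k u
  have [measurable]: "c k \<in> borel_measurable borel" for k unfolding c_def by measurable
  have nc: "cmod (c k u) \<le> cmod (A u) * ((\<Delta> * lam) ^ k /\<^sub>R fact k)" for k u
  proof -
    have "cmod (c k u) = cmod (A u) * (\<Delta> ^ k / fact k) * cmod (char \<nu> u) ^ k"
      using Delta by (simp add: c_def norm_mult norm_power norm_divide nb)
    also have "\<dots> \<le> cmod (A u) * (\<Delta> ^ k / fact k) * lam ^ k"
      using Delta norm_char_nu_le by (intro mult_left_mono power_mono) auto
    finally show ?thesis by (simp add: power_mult_distrib divide_inverse mult_ac)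
  qed
  have c: "integrable lborel (c k)" for k
  proof (rule Bochner_Integration.integrable_bound)
    show "integrable lborel (\<lambda>u. cmod (A u) * ((\<Delta> * lam) ^ k /\<^sub>R fact k))"
      using A by (intro integrable_mult_left integrable_norm)
    show "AE u in lborel. norm (c k u) \<le> norm (cmod (A u) * ((\<Delta> * lam) ^ k /\<^sub>R fact k))"
      unfolding real_norm_def by (intro AE_I2 order_trans[OF nc abs_ge_self])
  qed auto
  have sn: "summable (\<lambda>k. cmod (c k u))" for u
    by (rule summable_comparison_test'[where N=0, OF summable_mult[OF summable_exp_generic]])
       (use nc in auto)
  \<comment> \<open>Exchanging sum and integral takes absolute summability at each point and of the
    integrals; the same exponential majorant provides both.\<close>
  have sI: "summable (\<lambda>k. LINT u|lborel. cmod (c k u))"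
  proof (rule summable_comparison_test'[where N=0, OF summable_mult[OF summable_exp_generic]])
    fix k
    have "(LINT u|lborel. cmod (c k u)) \<le> (LINT u|lborel. cmod (A u) * ((\<Delta> * lam) ^ k /\<^sub>R fact k))"
      using A c by (intro integral_mono integrable_norm integrable_mult_left nc)
    then show "norm (LINT u|lborel. cmod (c k u)) \<le> C * ((\<Delta> * lam) ^ k /\<^sub>R fact k)"
      by (simp add: C_def)
  qed
  have "complex_of_real (conv_M \<Delta> \<gamma> lam \<nu> f x) =
    complex_of_real (exp (lam * \<Delta>)) * (\<Sum>k. complex_of_real ((- \<Delta>) ^ k / fact k * (LINT y|conv_pow \<nu>' k. f (x - \<gamma> * \<Delta> - y))))"
  proof -
    have "summable (\<lambda>k. (- \<Delta>) ^ k / fact k * (LINT y|conv_pow \<nu>' k. f (x - \<gamma> * \<Delta> - y)))"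
      by (rule summable_comparison_test'[where N=0, OF conv_M_bound_summable[OF f fB]])
         (use conv_M_term_le[OF f fB] in auto)
    then show ?thesis unfolding conv_M_def of_real_mult by (subst suminf_of_real) auto
  qed
  also have "(\<lambda>k. complex_of_real ((- \<Delta>) ^ k / fact k * (LINT y|conv_pow \<nu>' k. f (x - \<gamma> * \<Delta> - y)))) = (\<lambda>k. integral\<^sup>L lborel (c k))"
    unfolding of_real_mult inner c_def by simp
  also have "(\<Sum>k. integral\<^sup>L lborel (c k)) = (CLINT u|lborel. (\<Sum>k. c k u))"
    by (rule integral_suminf[symmetric]) (use c sn sI in auto)
  also have "\<dots> = (CLINT u|lborel. b u * exp (- (complex_of_real \<Delta> * char \<nu> u)))"
  proof (rule Bochner_Integration.integral_cong[OF refl])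
    fix u
    have minus: "- (complex_of_real \<Delta> * char \<nu> u) = complex_of_real (- \<Delta>) * char \<nu> u" by simp
    have "c k u = b u * ((- (complex_of_real \<Delta> * char \<nu> u)) ^ k /\<^sub>R fact k)" for k
      unfolding c_def minus power_mult_distrib scaleR_conv_of_real of_real_divide of_real_power
      by (simp add: divide_inverse mult_ac)
    then show "(\<Sum>k. c k u) = b u * exp (- (complex_of_real \<Delta> * char \<nu> u))"
      by (simp only: exp_def suminf_mult[OF summable_exp_generic])
  qed
  also have "complex_of_real (exp (lam * \<Delta>)) * \<dots> = (CLINT u|lborel. A u / cpp_char \<Delta> \<gamma> lam \<nu> u * iexp (u * x))"
    unfolding integral_mult_right_zero[symmetric]
  proof (rule Bochner_Integration.integral_cong[OF refl])
    fix u
    have "complex_of_real (exp (lam * \<Delta>)) * (b u * exp (- (complex_of_real \<Delta> * char \<nu> u)))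
       = A u * (exp (complex_of_real (lam * \<Delta>)) * iexp (u * (x - \<gamma> * \<Delta>)) * exp (- (complex_of_real \<Delta> * char \<nu> u)))"
      unfolding b_def exp_of_real[symmetric] by (simp only: mult_ac)
    also have "exp (complex_of_real (lam * \<Delta>)) * iexp (u * (x - \<gamma> * \<Delta>)) * exp (- (complex_of_real \<Delta> * char \<nu> u))
       = inverse (cpp_char \<Delta> \<gamma> lam \<nu> u) * iexp (u * x)"
      unfolding cpp_char_def exp_minus[symmetric] exp_add[symmetric] by (simp add: algebra_simps)
    finally show "complex_of_real (exp (lam * \<Delta>)) * (b u * exp (- (complex_of_real \<Delta> * char \<nu> u))) = A u / cpp_char \<Delta> \<gamma> lam \<nu> u * iexp (u * x)"
      by (simp add: divide_inverse)
  qed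
  finally show ?thesis .
qed

end

section \<open>Linearisation of the log-characteristic function\<close>

lemma bounded_support_integrable:
  fixes H :: "real \<Rightarrow> 'b :: {banach, second_countable_topology}"
  assumes [measurable]: "H \<in> borel_measurable borel" and H: "\<And>u. norm (H u) \<le> C" "\<And>u. \<bar>u\<bar> > T \<Longrightarrow> H u = 0"
  shows "integrable lborel H"
proof (rule Bochner_Integration.integrable_bound[where f="\<lambda>u. C * indicat_real {-T..T} u"])
  show "integrable lborel (\<lambda>u. C * indicat_real {-T..T} u)"
    by (intro integrable_mult_right integrable_real_indicator)
       (auto intro!: emeasure_compact_finite[unfolded infinity_ennreal_def])
  have "norm (H u) \<le> C * indicat_real {-T..T} u" for u
    using H(1)[of u] H(2)[of u] by (auto simp: indicator_def abs_if split: if_splits)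
  then show "AE u in lborel. norm (H u) \<le> norm (C * indicat_real {-T..T} u)"
    unfolding real_norm_def by (intro AE_I2 order_trans[OF _ abs_ge_self])
qed auto

lemma bounded_support_square_integrable:
  fixes H :: "real \<Rightarrow> complex"
  assumes [measurable]: "H \<in> borel_measurable borel" and H: "\<And>u. norm (H u) \<le> C" "\<And>u. \<bar>u\<bar> > T \<Longrightarrow> H u = 0"
  shows "integrable lborel (\<lambda>u. (cmod (H u))\<^sup>2)"
  by (rule bounded_support_integrable[where C="C\<^sup>2" and T=T]) (use H in \<open>auto intro!: power_mono\<close>)

text \<open>\<open>iFT\<close> is \<open>FT\<close> of the reflected function up to the factor
  \<open>2 * pi\<close>. The pairing is bilinear, without conjugation, which is why the frequency is
  reflected in \<open>FT_L2 f (- u)\<close>.\<close>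

lemma L2_Parseval:
  fixes f :: "real \<Rightarrow> complex"
  assumes f [measurable]: "f \<in> borel_measurable borel" and f2: "integrable lborel (\<lambda>x. (cmod (f x))\<^sup>2)"
    and H: "integrable lborel H" and H2: "integrable lborel (\<lambda>u. (cmod (H u))\<^sup>2)"
  shows "(CLINT x|lborel. f x * iFT H x) = 1 / (2 * pi) * (CLINT u|lborel. FT_L2 f (- u) * H u)"
    and "integrable lborel (\<lambda>u. FT_L2 f (- u) * H u)"
proof -
  note [measurable] = FT_L2_measurable[OF f f2]
  have [measurable]: "H \<in> borel_measurable borel" using H by auto
  have "(CLINT x|lborel. f x * iFT H x) = 1 / (2 * pi) * (CLINT x|lborel. f x * FT (\<lambda>u. H (- u)) x)"
    unfolding iFT_eq_FT FT_reflect by (subst integral_mult_right_zero[symmetric]) (simp add: mult_ac)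
  also have "(CLINT x|lborel. f x * FT (\<lambda>u. H (- u)) x) = (CLINT u|lborel. FT_L2 f u * H (- u))"
    by (rule FT_L2_duality[OF f f2]) (use integrable_reflect[OF H] integrable_reflect[OF H2] in auto)
  also have "\<dots> = (CLINT u|lborel. FT_L2 f (- u) * H u)"
    by (subst lborel_integral_real_affine[where c="-1" and t=0]) auto
  finally show "(CLINT x|lborel. f x * iFT H x) = 1 / (2 * pi) * (CLINT u|lborel. FT_L2 f (- u) * H u)" .
  show "integrable lborel (\<lambda>u. FT_L2 f (- u) * H u)"
    by (rule L2_mult_integrable)
       (use integrable_reflect[OF FT_L2_square_integrable[OF f f2]] H2 in auto)
qed

context
  fixes k :: "real \<Rightarrow> real" and T :: real
  assumes k: "integrable lborel k"
    and k_sym: "\<And>x. k (- x) = k x" and k_supp: "\<And>u. \<bar>u\<bar> > T \<Longrightarrow> FT (\<lambda>x. complex_of_real (k x)) u = 0"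
begin

abbreviation (input) kc where "kc \<equiv> \<lambda>x. complex_of_real (k x)"

lemma kernel_measurable: "k \<in> borel_measurable borel"
  using k by auto

text \<open>The factor \<open>b\<close> is bounded only on the band, because the logarithm and the
  remainder are controlled only there; outside, the transform of the kernel vanishes.\<close>

lemma FT_kernel_integrable:
  assumes [measurable]: "b \<in> borel_measurable borel" and b: "\<And>u. \<bar>u\<bar> \<le> T \<Longrightarrow> cmod (b u) \<le> C"
  shows "integrable lborel (\<lambda>u. b u * FT kc u)" "integrable lborel (\<lambda>u. (cmod (b u * FT kc u))\<^sup>2)"
proof -
  note [measurable] = kernel_measurable
  define D where "D = (LINT x|lborel. cmod (kc x))"
  have D: "cmod (FT kc u) \<le> D" for u unfolding D_def by (rule norm_FT_le)
  have D0: "D \<ge> 0" using order_trans[OF norm_ge_zero D] .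
  have *: "cmod (b u * FT kc u) \<le> \<bar>C\<bar> * D" for u
  proof (cases "\<bar>u\<bar> \<le> T")
    case True
    then show ?thesis
      unfolding norm_mult using b[of u] D by (intro mult_mono) auto
  qed (use k_supp D0 in auto)
  show "integrable lborel (\<lambda>u. b u * FT kc u)"
    by (rule bounded_support_integrable[OF _ *]) (use k_supp in auto)
  show "integrable lborel (\<lambda>u. (cmod (b u * FT kc u))\<^sup>2)"
    by (rule bounded_support_square_integrable[OF _ *]) (use k_supp in auto)
qed

context
  fixes g :: "real \<Rightarrow> real" and B :: real
  assumes g [measurable]: "g \<in> borel_measurable borel" and g2: "integrable lborel (\<lambda>x. (g x)\<^sup>2)"
    and gB: "\<And>x. \<bar>g x\<bar> \<le> B"
begin

abbreviation (input) gc where "gc \<equiv> \<lambda>x. complex_of_real (g x)"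

lemma gc_L2: "gc \<in> borel_measurable borel" "integrable lborel (\<lambda>x. (cmod (gc x))\<^sup>2)"
  using g2 by auto

lemmas gc_FT_L2_measurable = FT_L2_measurable[OF gc_L2]

text \<open>The Fourier density of \<open>conv_fun g k\<close>, see \<open>conv_fun_Fourier\<close>.
  The transform of \<open>g\<close> is reflected because the density is integrated against
  \<open>iexp (u * x)\<close>; that of the kernel is not, because the kernel is even.\<close>

definition multiplier where "multiplier u = 1 / (2 * pi) * (FT_L2 gc (- u) * FT kc u)"

lemma FT_L2_FT_kernel_integrable:
  assumes [measurable]: "b \<in> borel_measurable borel" and b: "\<And>u. \<bar>u\<bar> \<le> T \<Longrightarrow> cmod (b u) \<le> C"
  shows "integrable lborel (\<lambda>u. FT_L2 gc (- u) * (b u * FT kc u))"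
  by (rule L2_Parseval(2)[OF gc_L2 FT_kernel_integrable[OF assms]])

lemma multiplier_integrable: "integrable lborel multiplier"
proof -
  have "integrable lborel (\<lambda>u. FT_L2 gc (- u) * (1 * FT kc u))"
    by (rule FT_L2_FT_kernel_integrable[where C=1]) auto
  then show ?thesis unfolding multiplier_def by (intro integrable_mult_right) simp
qed

lemma conv_fun_measurable: "conv_fun g k \<in> borel_measurable borel"
  using kernel_measurable unfolding conv_fun_def by measurable

lemma abs_conv_fun_le: "\<bar>conv_fun g k x\<bar> \<le> B * (LINT y|lborel. \<bar>k y\<bar>)"
proof -
  note [measurable] = kernel_measurable
  have *: "norm (g (x - y) * k y) \<le> B * \<bar>k y\<bar>" for y
    using gB[of "x - y"] by (auto simp: abs_mult intro!: mult_right_mono)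
  have i: "integrable lborel (\<lambda>y. B * \<bar>k y\<bar>)" using k by (intro integrable_mult_right integrable_abs)
  have ig: "integrable lborel (\<lambda>y. g (x - y) * k y)"
    by (rule Bochner_Integration.integrable_bound[OF i])
       (use * in \<open>auto simp del: norm_mult intro!: AE_I2 intro: order_trans[OF _ abs_ge_self]\<close>)
  have "norm (LINT y|lborel. g (x - y) * k y) \<le> (LINT y|lborel. norm (g (x - y) * k y))"
    by (rule integral_norm_bound)
  also have "\<dots> \<le> (LINT y|lborel. B * \<bar>k y\<bar>)"
    by (intro integral_mono integrable_norm ig i *)
  finally have "norm (LINT y|lborel. g (x - y) * k y) \<le> (LINT y|lborel. B * \<bar>k y\<bar>)" .
  then show ?thesis by (simp add: conv_fun_def)
qed

text \<open>Evenness of the kernel turns the convolution at \<open>x\<close> into the pairing of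
  \<open>g\<close> with the translate \<open>kx\<close>. The translate is integrable with integrable
  transform, so inversion applies to it, and Parseval moves the pairing to the frequency
  side.\<close>

lemma conv_fun_Fourier:
  "complex_of_real (conv_fun g k x) = (CLINT u|lborel. multiplier u * iexp (u * x))"
proof -
  note [measurable] = kernel_measurable
  define kx where "kx = (\<lambda>y. kc (y - x))"
  have [measurable]: "kx \<in> borel_measurable borel" unfolding kx_def by measurable
  have kx: "integrable lborel kx"
    using k lborel_integrable_real_affine[where c=1 and t="- x" and f=k] by (simp add: kx_def)
  have FTkx: "FT kx u = iexp (u * x) * FT kc u" for u
  proof -
    have "FT kx u = (CLINT y|lborel. iexp (u * (x + y)) * kc y)"
      unfolding FT_def kx_def by (subst lborel_integral_real_affine[where c=1 and t=x]) auto
    also have "\<dots> = (CLINT y|lborel. iexp (u * x) * (iexp (u * y) * kc y))"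
      by (simp add: ring_distribs exp_add mult_ac)
    finally show ?thesis by (simp only: integral_mult_right_zero FT_def)
  qed
  have FTkx': "FT kx = (\<lambda>u. iexp (u * x) * FT kc u)" using FTkx by auto
  have i: "integrable lborel (FT kx)" "integrable lborel (\<lambda>u. (cmod (FT kx u))\<^sup>2)"
    unfolding FTkx' by (rule FT_kernel_integrable[where C=1]; auto)+
  have "conv_fun g k x = (LINT y|lborel. g y * k (x - y))"
    unfolding conv_fun_def by (subst lborel_integral_real_affine[where c="-1" and t=x]) auto
  also have "\<dots> = (LINT y|lborel. g y * k (y - x))"
    by (metis k_sym minus_diff_eq)
  also have "complex_of_real \<dots> = (CLINT y|lborel. gc y * kx y)"
    unfolding kx_def by (simp flip: of_real_mult)
  also have "\<dots> = (CLINT y|lborel. gc y * iFT (FT kx) y)"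
  proof (rule integral_cong_AE)
    show "AE y in lborel. gc y * kx y = gc y * iFT (FT kx) y"
      using Fourier_inversion[OF kx i(1)] by eventually_elim simp
    have "iFT (FT kx) = (\<lambda>y. complex_of_real (1 / (2 * pi)) * FT (FT kx) (- y))" by (auto simp: iFT_eq_FT)
    then show "(\<lambda>y. gc y * iFT (FT kx) y) \<in> borel_measurable lborel" by simp
  qed auto
  also have "\<dots> = 1 / (2 * pi) * (CLINT u|lborel. FT_L2 gc (- u) * FT kx u)"
    by (rule L2_Parseval(1)[OF gc_L2 i])
  also have "\<dots> = (CLINT u|lborel. multiplier u * iexp (u * x))"
    unfolding multiplier_def FTkx by (subst integral_mult_right_zero[symmetric]) (simp add: mult_ac)
  finally show ?thesis .
qed

context
  fixes \<nu> :: "real measure" and lam \<gamma> \<Delta> :: real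
  assumes nu: "finite_measure \<nu>" "sets \<nu> = sets borel" and mass: "measure \<nu> (space \<nu>) = lam"
    and Delta: "\<Delta> > 0"
begin

abbreviation (input) \<phi> where "\<phi> \<equiv> cpp_char \<Delta> \<gamma> lam \<nu>"

lemmas phi = cpp_char_nonzero[OF nu mass Delta, where \<gamma>=\<gamma>] norm_cpp_char_ge[OF nu mass Delta, where \<gamma>=\<gamma>]
lemmas phi_measurable = cpp_char_measurable[OF nu mass Delta, where \<gamma>=\<gamma>]

lemma norm_inverse_phi_le: "cmod (1 / \<phi> u) \<le> exp (2 * lam * \<Delta>)"
  using phi(2)[of u] le_imp_inverse_le[OF phi(2)[of u]]
  by (simp add: norm_divide norm_inverse divide_inverse exp_minus)

lemma multiplier_div_integrable: "integrable lborel (\<lambda>u. multiplier u / \<phi> u)"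
proof (rule Bochner_Integration.integrable_bound)
  show "integrable lborel (\<lambda>u. exp (2 * lam * \<Delta>) * multiplier u)"
    by (intro integrable_mult_right multiplier_integrable)
  show "(\<lambda>u. multiplier u / \<phi> u) \<in> borel_measurable lborel"
    using multiplier_integrable phi_measurable by auto
  have "cmod (multiplier u / \<phi> u) \<le> exp (2 * lam * \<Delta>) * cmod (multiplier u)" for u
    using mult_left_mono[OF norm_inverse_phi_le[of u], of "cmod (multiplier u)"]
    by (simp add: norm_divide mult.commute)
  then show "AE u in lborel. cmod (multiplier u / \<phi> u) \<le> cmod (complex_of_real (exp (2 * lam * \<Delta>)) * multiplier u)"
    by (simp add: norm_mult)
qed

lemma conv_M_conv_fun:
  "complex_of_real (conv_M \<Delta> \<gamma> lam \<nu> (conv_fun g k) x) = (CLINT u|lborel. multiplier u / \<phi> u * iexp (u * x))"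
  by (rule conv_M_Fourier[OF nu mass Delta multiplier_integrable conv_fun_measurable conv_fun_Fourier])

lemma integral_conv_M_conv_fun:
  assumes P: "prob_space P" "sets P = sets borel" and char: "\<And>u. char P u = \<phi> u"
  shows "(LINT x|P. conv_M \<Delta> \<gamma> lam \<nu> (conv_fun g k) x) = conv_fun g k 0"
proof -
  interpret P: prob_space P by fact
  interpret PL: pair_sigma_finite P "lborel :: real measure" ..
  note [measurable_cong] = P(2)
  define a where "a u = multiplier u / \<phi> u" for u
  have a: "integrable lborel a" unfolding a_def by (rule multiplier_div_integrable)
  have [measurable]: "a \<in> borel_measurable borel" using a by auto
  have "integrable (P \<Otimes>\<^sub>M lborel) (\<lambda>(x, u). a u * iexp (u * x))"
  proof (rule PL.Fubini_integrable)
    show "integrable P (\<lambda>x. LINT u|lborel. norm (case (x, u) of (x, u) \<Rightarrow> a u * iexp (u * x)))"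
      by (simp add: norm_mult)
    show "AE x in P. integrable lborel (\<lambda>u. case (x, u) of (x, u) \<Rightarrow> a u * iexp (u * x))"
    proof (rule AE_I2)
      fix x show "integrable lborel (\<lambda>u. case (x, u) of (x, u) \<Rightarrow> a u * iexp (u * x))"
        using FT_integrand_integrable[OF a, of x] by (simp add: mult_ac)
    qed
  qed measurable
  note fub = PL.Fubini_integral[OF this]
  have "complex_of_real (LINT x|P. conv_M \<Delta> \<gamma> lam \<nu> (conv_fun g k) x) = (CLINT x|P. CLINT u|lborel. a u * iexp (u * x))"
    unfolding a_def conv_M_conv_fun[symmetric] by simp
  also have "\<dots> = (CLINT u|lborel. CLINT x|P. a u * iexp (u * x))" using fub by simp
  also have "\<dots> = (CLINT u|lborel. a u * char P u)" by (simp add: char_def)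
  also have "\<dots> = (CLINT u|lborel. multiplier u * iexp (u * 0))" using phi(1) by (simp add: a_def char)
  also have "\<dots> = complex_of_real (conv_fun g k 0)" unfolding conv_fun_Fourier ..
  finally show ?thesis by (simp only: of_real_eq_iff)
qed

text \<open>The points \<open>z\<close> are deterministic; chance enters later, when
  \<open>near\<close> is verified on events of large probability.\<close>

lemma log_linearisation:
  fixes z :: "nat \<Rightarrow> real"
  assumes P: "prob_space P" "sets P = sets borel" "\<And>u. char P u = \<phi> u"
    and T: "T \<ge> 0" and n: "n > 0"
  defines "r \<equiv> \<lambda>u. complex_of_real (1 / real n) * (\<Sum>j<n. iexp (u * z j)) / \<phi> u"
  assumes near: "\<And>u. \<bar>u\<bar> \<le> T \<Longrightarrow> cmod (r u - 1) \<le> 1 / 2"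
  shows "(CLINT x|lborel. gc x * iFT (\<lambda>u. cont_log r T u * FT kc u) x) =
    complex_of_real ((1 / real n) * (\<Sum>j<n. conv_M \<Delta> \<gamma> lam \<nu> (conv_fun g k) (z j))
      - (LINT x|P. conv_M \<Delta> \<gamma> lam \<nu> (conv_fun g k) x))
    + complex_of_real (1 / (2 * pi)) * (CLINT u|lborel. FT_L2 gc (- u) * R_fun (r u) * FT kc u)"
proof -
  note [measurable] = kernel_measurable gc_FT_L2_measurable phi_measurable
  have [measurable]: "r \<in> borel_measurable borel" unfolding r_def by measurable
  have cont: "continuous_on {-T..T} r"
    unfolding r_def using phi(1)
    by (intro continuous_intros continuous_on_subset[OF cpp_char_continuous[OF nu mass Delta]]) auto
  have r0: "r 0 = 1" using n by (simp add: r_def cpp_char_0[OF nu mass Delta])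
  have Rb: "cmod (R_fun (r u)) \<le> 1 / 2" if "\<bar>u\<bar> \<le> T" for u
  proof -
    have "(cmod (r u - 1))\<^sup>2 \<le> (1/2)\<^sup>2" using near[OF that] by (intro power_mono) auto
    with norm_R_fun_le[OF near[OF that]] show ?thesis by (simp add: power2_eq_square)
  qed
  \<comment> \<open>Outside the band the logarithm is an uncontrolled choice, but there both sides
    carry the factor zero.\<close>
  have log: "cont_log r T u * FT kc u = ((r u - 1) + R_fun (r u)) * FT kc u" for u
  proof (cases "\<bar>u\<bar> \<le> T")
    case True
    have "Re (r u) > 0" using near[OF True] abs_Re_le_cmod[of "r u - 1"] by simp
    then have "R_fun (r u) = Ln (r u) + 1 - r u" by (intro R_fun_eq) (auto simp: complex_nonpos_Reals_iff)
    moreover have "cont_log r T u = Ln (r u)"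
      by (rule cont_log_eq_Ln[OF cont r0 T]) (use near True in \<open>auto simp: abs_le_iff\<close>)
    ultimately show ?thesis by simp
  qed (use k_supp in auto)
  have "cmod ((r u - 1) + R_fun (r u)) \<le> 1" if "\<bar>u\<bar> \<le> T" for u
    using norm_triangle_ineq[of "r u - 1" "R_fun (r u)"] near[OF that] Rb[OF that] by simp
  note H = FT_kernel_integrable[where b="\<lambda>u. (r u - 1) + R_fun (r u)", OF _ this]
  have "(CLINT x|lborel. gc x * iFT (\<lambda>u. cont_log r T u * FT kc u) x)
    = 1 / (2 * pi) * (CLINT u|lborel. FT_L2 gc (- u) * (((r u - 1) + R_fun (r u)) * FT kc u))"
    unfolding log by (rule L2_Parseval(1)[OF gc_L2 H]) auto
  also have "(CLINT u|lborel. FT_L2 gc (- u) * (((r u - 1) + R_fun (r u)) * FT kc u))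
    = (CLINT u|lborel. FT_L2 gc (- u) * ((r u - 1) * FT kc u)) + (CLINT u|lborel. FT_L2 gc (- u) * (R_fun (r u) * FT kc u))"
    unfolding distrib_left distrib_right
    by (intro Bochner_Integration.integral_add FT_L2_FT_kernel_integrable[where C="1/2"]) (use near Rb in auto)
  also have "1 / (2 * pi) * \<dots> = (CLINT u|lborel. multiplier u * (r u - 1)) + 1 / (2 * pi) * (CLINT u|lborel. FT_L2 gc (- u) * R_fun (r u) * FT kc u)"
    unfolding multiplier_def distrib_left
    by (intro arg_cong2[where f="(+)"], subst integral_mult_right_zero[symmetric]) (simp_all add: mult_ac)
  also have "(CLINT u|lborel. multiplier u * (r u - 1)) =
     complex_of_real ((1 / real n) * (\<Sum>j<n. conv_M \<Delta> \<gamma> lam \<nu> (conv_fun g k) (z j)) - conv_fun g k 0)"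
  proof -
    have i: "integrable lborel (\<lambda>u. multiplier u / \<phi> u * iexp (u * y))" for y
      using FT_integrand_integrable[OF multiplier_div_integrable, of y] by (simp add: mult_ac)
    have "(CLINT u|lborel. multiplier u * (r u - 1))
      = (CLINT u|lborel. complex_of_real (1 / real n) * (\<Sum>j<n. multiplier u / \<phi> u * iexp (u * z j)) - multiplier u * iexp (u * 0))"
      by (intro Bochner_Integration.integral_cong refl)
         (simp add: r_def right_diff_distrib sum_distrib_left divide_inverse mult_ac)
    also have "\<dots> = complex_of_real (1 / real n) * (\<Sum>j<n. (CLINT u|lborel. multiplier u / \<phi> u * iexp (u * z j))) - (CLINT u|lborel. multiplier u * iexp (u * 0))"
      using i multiplier_integrable
      by (subst Bochner_Integration.integral_diff)
         (auto intro!: integrable_mult_right Bochner_Integration.integrable_sum simp: Bochner_Integration.integral_sum)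
    also have "\<dots> = complex_of_real ((1 / real n) * (\<Sum>j<n. conv_M \<Delta> \<gamma> lam \<nu> (conv_fun g k) (z j)) - conv_fun g k 0)"
      unfolding conv_M_conv_fun[symmetric] conv_fun_Fourier[symmetric] by simp
    finally show ?thesis .
  qed
  also have "conv_fun g k 0 = (LINT x|P. conv_M \<Delta> \<gamma> lam \<nu> (conv_fun g k) x)"
    by (rule integral_conv_M_conv_fun[OF P, symmetric])
  finally show ?thesis by simp
qed

end

end

end

section \<open>Empirical means and characteristic functions of an i.i.d. sample\<close>

locale iid_sample = prob_space M for M :: "'a measure" +
  fixes Z :: "nat \<Rightarrow> 'a \<Rightarrow> real" and P :: "real measure"
  assumes Z_meas: "\<And>k. Z k \<in> borel_measurable M"
    and Z_indep: "indep_vars (\<lambda>_. borel) Z UNIV"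
    and Z_law: "\<And>k. distr M borel (Z k) = P"
begin

lemmas Z_measurable [measurable] = Z_meas

lemma sets_P: "sets P = sets borel"
  using Z_law[of 0] by auto

lemma prob_space_P: "prob_space P"
  using prob_space_distr[OF Z_meas[of 0]] by (simp add: Z_law)

sublocale P: prob_space P by (rule prob_space_P)

lemma measurable_P [simp]: "measurable P N = measurable borel N"
  by (rule measurable_cong_sets[OF sets_P refl])

lemma integral_Z:
  fixes f :: "real \<Rightarrow> 'b :: {banach, second_countable_topology}"
  assumes "f \<in> borel_measurable borel"
  shows "(LINT \<omega>|M. f (Z k \<omega>)) = (LINT x|P. f x)"
  using integral_distr[OF Z_meas[of k] assms] by (simp add: Z_law)

context
  fixes f :: "real \<Rightarrow> real" and B :: real
  assumes f [measurable]: "f \<in> borel_measurable borel" and fB: "\<And>x. \<bar>f x\<bar> \<le> B"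
begin

lemma integrable_P_bounded: "integrable P f" "integrable P (\<lambda>x. (f x)\<^sup>2)"
proof -
  show "integrable P f" by (rule P.integrable_const_bound[of _ B]) (use fB in auto)
  have "norm ((f x)\<^sup>2) \<le> B\<^sup>2" for x using power_mono[OF fB abs_ge_zero, of x 2] by simp
  then show "integrable P (\<lambda>x. (f x)\<^sup>2)" by (intro P.integrable_const_bound[of _ "B\<^sup>2"]) auto
qed

text \<open>The new summand is centred and independent of the partial sum, so the cross term
  vanishes in each induction step.\<close>

lemma expectation_sum_square:
  assumes 0: "(LINT x|P. f x) = 0"
  shows "expectation (\<lambda>\<omega>. (\<Sum>j<n. f (Z j \<omega>))\<^sup>2) = real n * (LINT x|P. (f x)\<^sup>2)"
proof (induction n)
  case (Suc n)
  have sB: "\<bar>\<Sum>j<n. f (Z j \<omega>)\<bar> \<le> real n * B" for \<omega>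
    using sum_bounded_above[of "{..<n}" "\<lambda>j. \<bar>f (Z j \<omega>)\<bar>" B] fB order_trans[OF sum_abs] by auto
  have i1: "integrable M (\<lambda>\<omega>. f (Z n \<omega>))"
    by (rule integrable_const_bound[of _ B]) (use fB in auto)
  have i2: "integrable M (\<lambda>\<omega>. \<Sum>j<n. f (Z j \<omega>))"
    by (rule integrable_const_bound[of _ "real n * B"]) (use sB in auto)
  have "indep_vars (\<lambda>_. borel) (\<lambda>j \<omega>. f (Z j \<omega>)) UNIV"
    by (rule indep_vars_compose2[OF Z_indep]) auto
  then have "indep_vars (\<lambda>_. borel) (\<lambda>j \<omega>. f (Z j \<omega>)) (insert n {..<n})"
    by (rule indep_vars_subset) auto
  then have ind: "indep_var borel (\<lambda>\<omega>. f (Z n \<omega>)) borel (\<lambda>\<omega>. \<Sum>j<n. f (Z j \<omega>))"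
    by (intro indep_vars_sum) auto
  have cross: "expectation (\<lambda>\<omega>. f (Z n \<omega>) * (\<Sum>j<n. f (Z j \<omega>))) = 0"
    by (subst indep_var_lebesgue_integral[OF ind i1 i2]) (simp add: integral_Z 0)
  have i3: "integrable M (\<lambda>\<omega>. f (Z n \<omega>) * (\<Sum>j<n. f (Z j \<omega>)))"
    by (rule indep_var_integrable[OF ind i1 i2])
  have i4: "integrable M (\<lambda>\<omega>. (\<Sum>j<n. f (Z j \<omega>))\<^sup>2)"
  proof (rule integrable_const_bound[of _ "(real n * B)\<^sup>2"])
    show "AE \<omega> in M. norm ((\<Sum>j<n. f (Z j \<omega>))\<^sup>2) \<le> (real n * B)\<^sup>2"
      using power_mono[OF sB abs_ge_zero, of _ 2] by auto
  qed auto
  have i5: "integrable M (\<lambda>\<omega>. (f (Z n \<omega>))\<^sup>2)"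
  proof (rule integrable_const_bound[of _ "B\<^sup>2"])
    show "AE \<omega> in M. norm ((f (Z n \<omega>))\<^sup>2) \<le> B\<^sup>2"
      using power_mono[OF fB abs_ge_zero, of _ 2] by auto
  qed auto
  have "expectation (\<lambda>\<omega>. (\<Sum>j<Suc n. f (Z j \<omega>))\<^sup>2)
    = expectation (\<lambda>\<omega>. (\<Sum>j<n. f (Z j \<omega>))\<^sup>2 + (f (Z n \<omega>))\<^sup>2 + 2 * (f (Z n \<omega>) * (\<Sum>j<n. f (Z j \<omega>))))"
    by (simp add: power2_sum mult_ac)
  also have "\<dots> = expectation (\<lambda>\<omega>. (\<Sum>j<n. f (Z j \<omega>))\<^sup>2) + expectation (\<lambda>\<omega>. (f (Z n \<omega>))\<^sup>2) + 2 * 0"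
    using i3 i4 i5 by (simp add: cross)
  also have "expectation (\<lambda>\<omega>. (f (Z n \<omega>))\<^sup>2) = (LINT x|P. (f x)\<^sup>2)"
    by (rule integral_Z) auto
  finally show ?case using Suc by (simp add: ring_distribs)
qed simp

end

definition emp_mean :: "nat \<Rightarrow> (real \<Rightarrow> real) \<Rightarrow> 'a \<Rightarrow> real" where
  "emp_mean n f \<omega> = (1 / real n) * (\<Sum>j<n. f (Z j \<omega>))"

lemma emp_mean_measurable [measurable]:
  assumes [measurable]: "f \<in> borel_measurable borel"
  shows "emp_mean n f \<in> borel_measurable M"
  unfolding emp_mean_def by measurable

context
  fixes f :: "real \<Rightarrow> real" and B :: real
  assumes f [measurable]: "f \<in> borel_measurable borel" and fB: "\<And>x. \<bar>f x\<bar> \<le> B"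
begin

lemma variance_le_square_integral: "(LINT x|P. (f x - (LINT x|P. f x))\<^sup>2) \<le> (LINT x|P. (f x)\<^sup>2)"
  using P.variance_eq[OF integrable_P_bounded[OF f fB]] by simp

lemma abs_integral_P_le: "\<bar>LINT x|P. f x\<bar> \<le> B"
proof -
  have "norm (LINT x|P. f x) \<le> (LINT x|P. norm (f x))" by (rule integral_norm_bound)
  also have "\<dots> \<le> (LINT x|P. B)"
    using integrable_P_bounded[OF f fB] fB by (intro integral_mono) auto
  finally show ?thesis using P.prob_space by simp
qed

lemma expectation_emp_mean_square:
  assumes n: "n > 0"
  shows "expectation (\<lambda>\<omega>. (emp_mean n f \<omega> - (LINT x|P. f x))\<^sup>2) = (1 / real n) * (LINT x|P. (f x - (LINT x|P. f x))\<^sup>2)"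
    and "integrable M (\<lambda>\<omega>. (emp_mean n f \<omega> - (LINT x|P. f x))\<^sup>2)"
proof -
  define m where "m = (LINT x|P. f x)"
  have B2: "\<bar>f x - m\<bar> \<le> B + B" for x
    unfolding m_def using abs_integral_P_le fB[of x] by linarith
  have eq: "emp_mean n f \<omega> - m = (1 / real n) * (\<Sum>j<n. f (Z j \<omega>) - m)" for \<omega>
    using n by (simp add: emp_mean_def sum_subtractf field_simps)
  have m0: "(LINT x|P. f x - m) = 0"
    using integrable_P_bounded[OF f fB] by (simp add: m_def P.prob_space)
  have "expectation (\<lambda>\<omega>. (emp_mean n f \<omega> - m)\<^sup>2) = (1 / real n)\<^sup>2 * expectation (\<lambda>\<omega>. (\<Sum>j<n. f (Z j \<omega>) - m)\<^sup>2)"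
    unfolding eq power_mult_distrib by simp
  also have "\<dots> = (1 / real n) * (LINT x|P. (f x - m)\<^sup>2)"
    using expectation_sum_square[of "\<lambda>x. f x - m", OF _ B2 m0, of n] n by (simp add: power2_eq_square)
  finally show "expectation (\<lambda>\<omega>. (emp_mean n f \<omega> - (LINT x|P. f x))\<^sup>2) = (1 / real n) * (LINT x|P. (f x - (LINT x|P. f x))\<^sup>2)"
    by (simp add: m_def)
  have "\<bar>\<Sum>j<n. f (Z j \<omega>) - m\<bar> \<le> real n * (B + B)" for \<omega>
    using sum_bounded_above[of "{..<n}" "\<lambda>j. \<bar>f (Z j \<omega>) - m\<bar>" "B + B"] B2 order_trans[OF sum_abs] by auto
  then have "\<bar>emp_mean n f \<omega> - m\<bar> \<le> B + B" for \<omega>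
    unfolding eq using n by (simp add: abs_mult divide_le_eq mult.commute)
  from power_mono[OF this abs_ge_zero, of _ 2]
  show "integrable M (\<lambda>\<omega>. (emp_mean n f \<omega> - (LINT x|P. f x))\<^sup>2)"
    unfolding m_def by (intro integrable_const_bound[of _ "(B + B)\<^sup>2"]) auto
qed

lemma Hoeffding_emp_mean:
  assumes n: "n > 0" and B: "B > 0" and e: "e \<ge> 0"
  shows "prob {\<omega>\<in>space M. \<bar>emp_mean n f \<omega> - (LINT x|P. f x)\<bar> \<ge> e} \<le> 2 * exp (- real n * e\<^sup>2 / (2 * B\<^sup>2))"
proof -
  interpret H: Hoeffding_ineq_iid M "{..<n}" "\<lambda>j \<omega>. f (Z j \<omega>)" "\<lambda>\<omega>. f (Z 0 \<omega>)" "-B" B "expectation (\<lambda>\<omega>. f (Z 0 \<omega>))"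
  proof unfold_locales
    show "indep_vars (\<lambda>_. borel) (\<lambda>j \<omega>. f (Z j \<omega>)) {..<n}"
      by (rule indep_vars_subset[OF indep_vars_compose2[OF Z_indep]]) auto
    show "distr M borel (\<lambda>\<omega>. f (Z i \<omega>)) = distr M borel (\<lambda>\<omega>. f (Z 0 \<omega>))" for i
      using distr_distr[of f borel borel "Z i" M] distr_distr[of f borel borel "Z 0" M]
      by (simp add: Z_law comp_def)
    have "f (Z 0 \<omega>) \<in> {-B..B}" for \<omega> using fB[of "Z 0 \<omega>"] by (auto simp: abs_le_iff)
    then show "AE \<omega> in M. f (Z 0 \<omega>) \<in> {-B..B}" by blast
  qed auto
  have "prob {\<omega>\<in>space M. \<bar>(\<Sum>i<n. f (Z i \<omega>)) / real (card {..<n}) - expectation (\<lambda>\<omega>. f (Z 0 \<omega>))\<bar> \<ge> e}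
     \<le> 2 * exp (- 2 * real (card {..<n}) * e\<^sup>2 / (B - (- B))\<^sup>2)"
    by (rule H.Hoeffding_ineq_abs_ge'[OF e]) (use n B in auto)
  also have "- 2 * real (card {..<n}) * e\<^sup>2 / (B - (- B))\<^sup>2 = - real n * e\<^sup>2 / (2 * B\<^sup>2)"
    using B by (simp add: power2_eq_square field_simps)
  finally show ?thesis by (simp add: emp_mean_def integral_Z)
qed

end

lemma emp_char_eq: "emp_char Z n \<omega> u = Complex (emp_mean n (\<lambda>x. cos (u * x)) \<omega>) (emp_mean n (\<lambda>x. sin (u * x)) \<omega>)"
  by (simp add: emp_char_def emp_mean_def complex_eq_iff Re_sum Im_sum Re_exp Im_exp Re_divide_of_nat Im_divide_of_nat)

lemma char_P_eq: "char P u = Complex (LINT x|P. cos (u * x)) (LINT x|P. sin (u * x))"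
proof -
  have i: "integrable P (\<lambda>x. iexp (u * x))" by (rule P.integrable_const_bound[of _ 1]) auto
  show ?thesis unfolding char_def using i by (simp add: complex_eq_iff Re_exp Im_exp flip: integral_Re integral_Im)
qed

lemma emp_char_measurable [measurable]:
  assumes [measurable]: "g \<in> measurable N M" "v \<in> borel_measurable N"
  shows "(\<lambda>x. emp_char Z n (g x) (v x)) \<in> borel_measurable N"
  unfolding emp_char_def by measurable

text \<open>The variances of cosine and sine are at most their second moments, and these add up to
  one. Hence the bound does not depend on \<open>u\<close>.\<close>

lemma expectation_emp_char_deviation:
  assumes n: "n > 0"
  shows "expectation (\<lambda>\<omega>. (cmod (emp_char Z n \<omega> u - char P u))\<^sup>2) \<le> 1 / real n"
    and "integrable M (\<lambda>\<omega>. (cmod (emp_char Z n \<omega> u - char P u))\<^sup>2)"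
proof -
  have eq: "(cmod (emp_char Z n \<omega> u - char P u))\<^sup>2 = (emp_mean n (\<lambda>x. cos (u * x)) \<omega> - (LINT x|P. cos (u * x)))\<^sup>2
     + (emp_mean n (\<lambda>x. sin (u * x)) \<omega> - (LINT x|P. sin (u * x)))\<^sup>2" for \<omega>
    by (simp add: emp_char_eq char_P_eq cmod_power2)
  note c = expectation_emp_mean_square[OF _ abs_cos_le_one n, of "\<lambda>x. u * x", simplified]
  note s = expectation_emp_mean_square[OF _ abs_sin_le_one n, of "\<lambda>x. u * x", simplified]
  show "integrable M (\<lambda>\<omega>. (cmod (emp_char Z n \<omega> u - char P u))\<^sup>2)"
    unfolding eq using c s by simp
  have "expectation (\<lambda>\<omega>. (cmod (emp_char Z n \<omega> u - char P u))\<^sup>2) =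
    (1 / real n) * ((LINT x|P. (cos (u * x) - (LINT x|P. cos (u * x)))\<^sup>2) + (LINT x|P. (sin (u * x) - (LINT x|P. sin (u * x)))\<^sup>2))"
    unfolding eq using c s by (simp add: add_divide_distrib)
  also have "\<dots> \<le> (1 / real n) * ((LINT x|P. (cos (u * x))\<^sup>2) + (LINT x|P. (sin (u * x))\<^sup>2))"
    by (intro mult_left_mono add_mono variance_le_square_integral[where B=1]) auto
  also have "(LINT x|P. (cos (u * x))\<^sup>2) + (LINT x|P. (sin (u * x))\<^sup>2) = (LINT x|P. (cos (u * x))\<^sup>2 + (sin (u * x))\<^sup>2)"
    by (intro Bochner_Integration.integral_add[symmetric] integrable_P_bounded[where B=1]) auto
  also have "\<dots> = 1" using P.prob_space by simp
  finally show "expectation (\<lambda>\<omega>. (cmod (emp_char Z n \<omega> u - char P u))\<^sup>2) \<le> 1 / real n" by simp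
qed

text \<open>If the modulus exceeds \<open>e\<close>, the real or the imaginary part is at least
  \<open>e / 2\<close> in absolute value. Each part is a mean of variables with values between -1
  and 1, and the two Hoeffding bounds add up.\<close>

lemma Hoeffding_emp_char:
  assumes n: "n > 0" and e: "e \<ge> 0"
  shows "prob {\<omega>\<in>space M. cmod (emp_char Z n \<omega> u - char P u) > e} \<le> 4 * exp (- real n * e\<^sup>2 / 8)"
proof -
  let ?C = "{\<omega>\<in>space M. \<bar>emp_mean n (\<lambda>x. cos (u * x)) \<omega> - (LINT x|P. cos (u * x))\<bar> \<ge> e / 2}"
  let ?S = "{\<omega>\<in>space M. \<bar>emp_mean n (\<lambda>x. sin (u * x)) \<omega> - (LINT x|P. sin (u * x))\<bar> \<ge> e / 2}"
  have "prob {\<omega>\<in>space M. cmod (emp_char Z n \<omega> u - char P u) > e} \<le> prob (?C \<union> ?S)"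
  proof (rule finite_measure_mono)
    show "{\<omega>\<in>space M. cmod (emp_char Z n \<omega> u - char P u) > e} \<subseteq> ?C \<union> ?S"
    proof
      fix \<omega> assume "\<omega> \<in> {\<omega>\<in>space M. cmod (emp_char Z n \<omega> u - char P u) > e}"
      then show "\<omega> \<in> ?C \<union> ?S"
        using cmod_le[of "emp_char Z n \<omega> u - char P u"] by (auto simp: emp_char_eq char_P_eq)
    qed
  qed measurable
  also have "\<dots> \<le> prob ?C + prob ?S"
    by (rule measure_Un_le) measurable
  also have "prob ?C \<le> 2 * exp (- real n * (e / 2)\<^sup>2 / (2 * 1\<^sup>2))"
    by (rule Hoeffding_emp_mean) (use n e in auto)
  also have "prob ?S \<le> 2 * exp (- real n * (e / 2)\<^sup>2 / (2 * 1\<^sup>2))"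
    by (rule Hoeffding_emp_mean) (use n e in auto)
  finally show ?thesis by (simp add: power_divide)
qed

end

section \<open>Limit theorems\<close>

text \<open>The test function is uniformly continuous only on compact sets. The second moments make
  \<open>Y n\<close> tight, and \<open>X n\<close> remains in a slightly larger ball wherever it is
  close to \<open>Y n\<close>; elsewhere the test function is merely bounded.\<close>

lemma (in prob_space) Slutsky_integral:
  fixes X Y :: "nat \<Rightarrow> 'a \<Rightarrow> complex" and f :: "complex \<Rightarrow> real"
  assumes [measurable]: "\<And>n. X n \<in> borel_measurable M" "\<And>n. Y n \<in> borel_measurable M"
    and Y2: "\<And>n. integrable M (\<lambda>\<omega>. (cmod (Y n \<omega>))\<^sup>2)" "\<And>n. expectation (\<lambda>\<omega>. (cmod (Y n \<omega>))\<^sup>2) \<le> C"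
    and XY: "\<And>\<eta>. \<eta> > 0 \<Longrightarrow> (\<lambda>n. prob {\<omega>\<in>space M. cmod (X n \<omega> - Y n \<omega>) > \<eta>}) \<longlonglongrightarrow> 0"
    and f: "continuous_on UNIV f" and fF: "\<And>x. \<bar>f x\<bar> \<le> F"
  shows "(\<lambda>n. expectation (\<lambda>\<omega>. f (X n \<omega>)) - expectation (\<lambda>\<omega>. f (Y n \<omega>))) \<longlonglongrightarrow> 0"
proof (rule tendstoI)
  fix e :: real assume e: "e > 0"
  have [measurable]: "f \<in> borel_measurable borel" by (rule borel_measurable_continuous_onI[OF f])
  have F0: "F \<ge> 0" using fF[of 0] by simp
  have C0: "C \<ge> 0" using Y2(2)[of 0] by (rule order_trans[rotated]) simp
  \<comment> \<open>Chosen so that Markov's bound \<open>C / R\<^sup>2\<close> for leaving the ball,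
    multiplied by the oscillation \<open>2 * F\<close>, is at most \<open>e / 4\<close>. The added
    ones keep \<open>R\<close> positive if \<open>F\<close> or \<open>C\<close> is 0.\<close>
  define R where "R = sqrt (8 * (F + 1) * (C + 1) / e)"
  have R: "R > 0" using e F0 C0 by (simp add: R_def)
  have R2: "R\<^sup>2 = 8 * (F + 1) * (C + 1) / e" using e F0 C0 by (simp add: R_def)
  have "uniformly_continuous_on (cball 0 (R + 1)) f"
    by (intro compact_uniformly_continuous continuous_on_subset[OF f]) auto
  then obtain d0 where d0: "d0 > 0"
    "\<And>x y. x \<in> cball 0 (R + 1) \<Longrightarrow> y \<in> cball 0 (R + 1) \<Longrightarrow> dist y x < d0 \<Longrightarrow> dist (f y) (f x) < e / 4"
    unfolding uniformly_continuous_on_def using e by (metis divide_pos_pos zero_less_numeral)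
  \<comment> \<open>Half of \<open>d0\<close> turns the weak inequality off \<open>A\<close> into
    the strict one required by \<open>d0\<close>; the cap at 1 keeps \<open>X n\<close> in the ball
    of radius \<open>R + 1\<close>.\<close>
  define d where "d = min (d0 / 2) 1"
  have d: "d > 0" "d < d0" "d \<le> 1" using d0 by (auto simp: d_def)
  have "eventually (\<lambda>n. prob {\<omega>\<in>space M. cmod (X n \<omega> - Y n \<omega>) > d} < e / (8 * (F + 1))) sequentially"
    by (rule order_tendstoD(2)[OF XY[OF d(1)]]) (use e F0 in auto)
  then show "eventually (\<lambda>n. dist (expectation (\<lambda>\<omega>. f (X n \<omega>)) - expectation (\<lambda>\<omega>. f (Y n \<omega>))) 0 < e) sequentially"
  proof eventually_elim
    case (elim n)
    define A where "A = {\<omega>\<in>space M. cmod (X n \<omega> - Y n \<omega>) > d}"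
    define D where "D = {\<omega>\<in>space M. (cmod (Y n \<omega>))\<^sup>2 \<ge> R\<^sup>2}"
    have [measurable]: "A \<in> events" "D \<in> events" unfolding A_def D_def by measurable
    have PD: "prob D \<le> C / R\<^sup>2"
    proof -
      have "prob D \<le> expectation (\<lambda>\<omega>. (cmod (Y n \<omega>))\<^sup>2) / R\<^sup>2"
        unfolding D_def by (rule integral_Markov_inequality_measure[where A="{}"]) (use Y2 R in auto)
      also have "\<dots> \<le> C / R\<^sup>2" using Y2(2) by (intro divide_right_mono) auto
      finally show ?thesis .
    qed
    have pw: "\<bar>f (X n \<omega>) - f (Y n \<omega>)\<bar> \<le> e / 4 + 2 * F * indicator D \<omega> + 2 * F * indicator A \<omega>" if w: "\<omega> \<in> space M" for \<omega>
    proof (cases "\<omega> \<in> A \<or> \<omega> \<in> D")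
      case True
      have "\<bar>f (X n \<omega>) - f (Y n \<omega>)\<bar> \<le> 2 * F" using fF[of "X n \<omega>"] fF[of "Y n \<omega>"] by linarith
      then show ?thesis using True e F0 by (auto simp: indicator_def)
    next
      case False
      then have 1: "cmod (X n \<omega> - Y n \<omega>) \<le> d" and 2: "(cmod (Y n \<omega>))\<^sup>2 < R\<^sup>2"
        using w by (auto simp: A_def D_def)
      from 2 have Y: "cmod (Y n \<omega>) < R" using R by (meson less_imp_le power_less_imp_less_base)
      have "cmod (X n \<omega>) \<le> R + 1"
        using norm_triangle_ineq[of "Y n \<omega>" "X n \<omega> - Y n \<omega>"] 1 Y d by simp
      then have "dist (f (X n \<omega>)) (f (Y n \<omega>)) < e / 4"
        using Y 1 d by (intro d0) (auto simp: dist_norm)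
      then show ?thesis using False by (simp add: dist_real_def)
    qed
    have i: "integrable M (\<lambda>\<omega>. f (V \<omega>))" if [measurable]: "V \<in> borel_measurable M" for V
      by (rule integrable_const_bound[of _ F]) (use fF in auto)
    have ind: "integrable M (indicat_real V)" if "V \<in> events" for V
      using that by (intro integrable_real_indicator) (auto simp: emeasure_eq_measure)
    have "\<bar>expectation (\<lambda>\<omega>. f (X n \<omega>)) - expectation (\<lambda>\<omega>. f (Y n \<omega>))\<bar> = norm (expectation (\<lambda>\<omega>. f (X n \<omega>) - f (Y n \<omega>)))"
      by (subst Bochner_Integration.integral_diff) (auto intro!: i)
    also have "\<dots> \<le> expectation (\<lambda>\<omega>. \<bar>f (X n \<omega>) - f (Y n \<omega>)\<bar>)"
      using integral_norm_bound[of M "\<lambda>\<omega>. f (X n \<omega>) - f (Y n \<omega>)"] by simp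
    also have "\<dots> \<le> expectation (\<lambda>\<omega>. e / 4 + 2 * F * indicator D \<omega> + 2 * F * indicator A \<omega>)"
    proof (rule integral_mono)
      show "integrable M (\<lambda>\<omega>. e / 4 + 2 * F * indicator D \<omega> + 2 * F * indicator A \<omega>)"
        by (intro Bochner_Integration.integrable_add integrable_mult_right ind integrable_const) measurable
    qed (auto intro!: integrable_abs Bochner_Integration.integrable_diff i pw)
    also have "\<dots> = e / 4 + 2 * F * prob D + 2 * F * prob A"
      using prob_space ind by simp
    also have "\<dots> \<le> e / 4 + 2 * F * (C / R\<^sup>2) + 2 * F * (e / (8 * (F + 1)))"
      using PD elim F0 unfolding A_def[symmetric] by (intro add_mono mult_left_mono) auto
    also have "2 * F * (C / R\<^sup>2) \<le> e / 4"
    proof -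
      have alg: "2 * F * (C / (8 * p * q / e)) = (F * C) * e / (4 * (p * q))" if "p \<noteq> 0" "q \<noteq> 0" for p q
        using that e by (simp add: field_simps)
      have "2 * F * (C / R\<^sup>2) = (F * C) * e / (4 * ((F + 1) * (C + 1)))"
        unfolding R2 by (rule alg) (use F0 C0 in auto)
      also have "\<dots> \<le> ((F + 1) * (C + 1)) * e / (4 * ((F + 1) * (C + 1)))"
        using F0 C0 e by (intro divide_right_mono mult_right_mono mult_mono) auto
      also have "\<dots> = e / 4" using F0 C0 by simp
      finally show ?thesis .
    qed
    also have "2 * F * (e / (8 * (F + 1))) \<le> e / 4"
      using F0 e by (simp add: field_simps)
    finally show ?case using e by (simp add: dist_real_def)
  qed
qed

lemma norm_iexp_diff_le: "cmod (iexp s - iexp t) \<le> min 2 \<bar>s - t\<bar>"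
proof -
  have "iexp s - iexp t = iexp t * (iexp (s - t) - 1)"
    by (simp add: right_diff_distrib exp_add[symmetric])
  then have "cmod (iexp s - iexp t) = cmod (iexp (s - t) - 1)" by (simp add: norm_mult)
  also have "\<dots> \<le> \<bar>s - t\<bar>" using iexp_approx1[of "s - t" 0] by simp
  finally have "cmod (iexp s - iexp t) \<le> \<bar>s - t\<bar>" .
  moreover have "cmod (iexp s - iexp t) \<le> 2" using norm_triangle_ineq4[of "iexp s" "iexp t"] by simp
  ultimately show ?thesis by simp
qed

context iid_sample
begin

text \<open>The cap at 2, the trivial bound for a difference of two unit phases, makes the integrand
  bounded, so dominated convergence applies even if \<open>P\<close> has no first moment.\<close>

lemma exists_small_increment:
  assumes c: "c > 0"
  obtains \<eta> :: real where "\<eta> > 0" "(LINT x|P. min 2 (\<eta> * \<bar>x\<bar>)) < c"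
proof -
  have "(\<lambda>m. LINT x|P. min 2 (1 / real (Suc m) * \<bar>x\<bar>)) \<longlonglongrightarrow> (LINT x|P. (0::real))"
  proof (rule integral_dominated_convergence[where w="\<lambda>_. 2"])
    show "AE x in P. (\<lambda>m. min 2 (1 / real (Suc m) * \<bar>x\<bar>)) \<longlonglongrightarrow> 0"
    proof (rule AE_I2)
      fix x :: real
      have "(\<lambda>m. min 2 (1 / real (Suc m) * \<bar>x\<bar>)) \<longlonglongrightarrow> min 2 (0 * \<bar>x\<bar>)"
        by (intro tendsto_intros tendsto_mult_right LIMSEQ_Suc[OF lim_1_over_n])
      then show "(\<lambda>m. min 2 (1 / real (Suc m) * \<bar>x\<bar>)) \<longlonglongrightarrow> 0" by simp
    qed
  qed auto
  then have "eventually (\<lambda>m. (LINT x|P. min 2 (1 / real (Suc m) * \<bar>x\<bar>)) < c) sequentially"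
    using c by (intro order_tendstoD(2)) auto
  then obtain m where "(LINT x|P. min 2 (1 / real (Suc m) * \<bar>x\<bar>)) < c"
    by (auto dest: eventually_happens)
  then show ?thesis by (intro that[of "1 / real (Suc m)"]) auto
qed

text \<open>Away from the points of a grid of fixed mesh \<open>\<eta>\<close> the deviation is controlled by the
  empirical mean of \<open>min 2 (\<eta> \<bar>x\<bar>)\<close>; Hoeffding's inequality then beats the number of grid points,
  which is of order \<open>T n\<close>.\<close>

lemma emp_char_uniform:
  fixes T :: "nat \<Rightarrow> real"
  assumes T: "\<And>n. T n > 0" and rate: "\<And>\<kappa>. \<kappa> > 0 \<Longrightarrow> (\<lambda>n. T n * exp (- \<kappa> * real n)) \<longlonglongrightarrow> 0" and c: "c > 0"
  shows "\<exists>A. (\<forall>n. A n \<in> events) \<and> (\<lambda>n. prob (A n)) \<longlonglongrightarrow> 1 \<and>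
    (\<forall>n. \<forall>\<omega>\<in>A n. n > 0 \<and> (\<forall>u. \<bar>u\<bar> \<le> T n \<longrightarrow> cmod (emp_char Z n \<omega> u - char P u) \<le> c))"
proof -
  obtain \<eta> :: real where \<eta>: "\<eta> > 0" and small: "(LINT x|P. min 2 (\<eta> * \<bar>x\<bar>)) < c / 8"
    using exists_small_increment[of "c / 8"] c by auto
  define b where "b x = min 2 (\<eta> * \<bar>x\<bar>)" for x
  have [measurable]: "b \<in> borel_measurable borel" unfolding b_def by measurable
  have b: "0 \<le> b x" "\<bar>b x\<bar> \<le> 2" for x using \<eta> by (auto simp: b_def)
  \<comment> \<open>The indices of the grid \<open>of_int j * \<eta>\<close> over the band, with one
    point of slack at either end.\<close>
  define J where "J n = {- (\<lceil>T n / \<eta>\<rceil> + 1)..\<lceil>T n / \<eta>\<rceil> + 1}" for n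
  have cJ: "real (card (J n)) \<le> 2 * T n / \<eta> + 5" for n
  proof -
    define t where "t = T n / \<eta>"
    have "0 < t" using T \<eta> by (auto simp: t_def)
    then have "0 \<le> \<lceil>t\<rceil>" by linarith
    then have "real (card (J n)) = 2 * of_int \<lceil>t\<rceil> + 3" unfolding J_def t_def[symmetric] by simp
    also have "\<dots> \<le> 2 * t + 5" using of_int_ceiling_le_add_one[of t] by linarith
    finally show ?thesis by (simp add: t_def)
  qed
  define E1 where "E1 n = {\<omega>\<in>space M. \<bar>emp_mean n b \<omega> - (LINT x|P. b x)\<bar> \<ge> c / 8}" for n
  define E2 where "E2 n j = {\<omega>\<in>space M. cmod (emp_char Z n \<omega> (of_int j * \<eta>) - char P (of_int j * \<eta>)) > c / 2}" for n j
  have [measurable]: "E1 n \<in> events" "E2 n j \<in> events" for n j unfolding E1_def E2_def by measurable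
  define Bad where "Bad n = E1 n \<union> (\<Union>j\<in>J n. E2 n j)" for n
  have [measurable]: "Bad n \<in> events" for n unfolding Bad_def J_def by measurable
  \<comment> \<open>The slower of the two Hoeffding rates, the one for \<open>E1\<close>; the rate
    for the grid points, with \<open>c / 2\<close> in place of \<open>c / 8\<close>, is
    faster.\<close>
  define \<kappa> where "\<kappa> = (c / 8)\<^sup>2 / 8"
  have \<kappa>: "\<kappa> > 0" using c by (simp add: \<kappa>_def)
  have PB: "prob (Bad n) \<le> 2 * exp (- \<kappa> * real n) + (2 * T n / \<eta> + 5) * (4 * exp (- \<kappa> * real n))" if n: "n > 0" for n
  proof -
    have "prob (Bad n) \<le> prob (E1 n) + prob (\<Union>j\<in>J n. E2 n j)"
      unfolding Bad_def by (rule measure_Un_le) (auto simp: J_def)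
    also have "prob (E1 n) \<le> 2 * exp (- real n * (c / 8)\<^sup>2 / (2 * 2\<^sup>2))"
      unfolding E1_def by (rule Hoeffding_emp_mean) (use n c b in auto)
    also have "- real n * (c / 8)\<^sup>2 / (2 * 2\<^sup>2) = - \<kappa> * real n" by (simp add: \<kappa>_def)
    also have "prob (\<Union>j\<in>J n. E2 n j) \<le> (\<Sum>j\<in>J n. prob (E2 n j))"
      by (rule finite_measure_subadditive_finite) (auto simp: J_def)
    also have "\<dots> \<le> (\<Sum>j\<in>J n. 4 * exp (- \<kappa> * real n))"
    proof (rule sum_mono)
      fix j
      have "prob (E2 n j) \<le> 4 * exp (- real n * (c / 2)\<^sup>2 / 8)"
        unfolding E2_def by (rule Hoeffding_emp_char) (use n c in auto)
      also have "\<dots> \<le> 4 * exp (- \<kappa> * real n)"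
      proof -
        have "\<kappa> \<le> (c / 2)\<^sup>2 / 8" using c unfolding \<kappa>_def by (intro divide_right_mono power_mono) auto
        then have "\<kappa> * real n \<le> (c / 2)\<^sup>2 / 8 * real n" by (rule mult_right_mono) simp
        then show ?thesis by (simp add: mult.commute)
      qed
      finally show "prob (E2 n j) \<le> 4 * exp (- \<kappa> * real n)" .
    qed
    also have "\<dots> \<le> (2 * T n / \<eta> + 5) * (4 * exp (- \<kappa> * real n))"
      using cJ[of n] by (simp add: mult_right_mono)
    finally show ?thesis by simp
  qed
  have ek: "(\<lambda>n. exp (- \<kappa> * real n)) \<longlonglongrightarrow> 0" using \<kappa> by real_asymp
  have "(\<lambda>n. 2 * exp (- \<kappa> * real n) + (2 / \<eta> * (T n * exp (- \<kappa> * real n)) + 5 * exp (- \<kappa> * real n)) * 4) \<longlonglongrightarrow> 2 * 0 + (2 / \<eta> * 0 + 5 * 0) * 4"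
    by (intro tendsto_intros ek rate[OF \<kappa>])
  then have lim0: "(\<lambda>n. 2 * exp (- \<kappa> * real n) + (2 * T n / \<eta> + 5) * (4 * exp (- \<kappa> * real n))) \<longlonglongrightarrow> 0"
    by (simp add: algebra_simps)
  have PB0: "(\<lambda>n. prob (Bad n)) \<longlonglongrightarrow> 0"
  proof (rule tendsto_sandwich[OF _ _ tendsto_const lim0])
    show "\<forall>\<^sub>F n in sequentially. prob (Bad n) \<le> 2 * exp (- \<kappa> * real n) + (2 * T n / \<eta> + 5) * (4 * exp (- \<kappa> * real n))"
      using eventually_gt_at_top[of 0] by eventually_elim (rule PB)
  qed simp
  \<comment> \<open>With no observations the empirical mean is the default value 0. The empty event
    at index 0 makes membership imply \<open>n > 0\<close>.\<close>
  define A where "A n = (if n = 0 then {} else space M - Bad n)" for n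
  have 1: "A n \<in> events" for n unfolding A_def by auto
  have "(\<lambda>n. 1 - prob (Bad n)) \<longlonglongrightarrow> 1 - 0" by (intro tendsto_intros PB0)
  moreover have "\<forall>\<^sub>F n in sequentially. 1 - prob (Bad n) = prob (A n)"
    using eventually_gt_at_top[of 0] by eventually_elim (auto simp: A_def prob_compl)
  ultimately have 2: "(\<lambda>n. prob (A n)) \<longlonglongrightarrow> 1"
    using Lim_transform_eventually by fastforce
  have 3: "n > 0" if "\<omega> \<in> A n" for n \<omega> using that by (auto simp: A_def split: if_splits)
  have 4: "cmod (emp_char Z n \<omega> u - char P u) \<le> c" if w: "\<omega> \<in> A n" and u: "\<bar>u\<bar> \<le> T n" for n \<omega> u
  proof -
    have n: "n > 0" using 3[OF w] .
    have ws: "\<omega> \<in> space M" and wB: "\<omega> \<notin> Bad n" using w by (auto simp: A_def split: if_splits)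
    define j where "j = \<lfloor>u / \<eta>\<rfloor>"
    define v where "v = of_int j * \<eta>"
    have "of_int j \<le> u / \<eta>" "u / \<eta> < of_int j + 1" unfolding j_def by linarith+
    then have "v \<le> u" "u < v + \<eta>" using \<eta> by (auto simp: v_def field_simps)
    then have uv: "\<bar>u - v\<bar> \<le> \<eta>" by simp
    have "j \<in> J n"
    proof -
      define s t where "s = u / \<eta>" and "t = T n / \<eta>"
      have "- t \<le> s" "s \<le> t" using u \<eta> by (auto simp: s_def t_def field_simps abs_le_iff)
      then have "- (\<lceil>t\<rceil> + 1) \<le> \<lfloor>s\<rfloor>" "\<lfloor>s\<rfloor> \<le> \<lceil>t\<rceil> + 1" by linarith+
      then show ?thesis by (simp add: J_def j_def s_def t_def)
    qed
    then have dv: "cmod (emp_char Z n \<omega> v - char P v) \<le> c / 2"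
      using wB ws by (force simp: Bad_def E2_def v_def)
    have eb: "cmod (iexp (u * x) - iexp (v * x)) \<le> b x" for x
    proof -
      have "cmod (iexp (u * x) - iexp (v * x)) \<le> min 2 \<bar>u * x - v * x\<bar>" by (rule norm_iexp_diff_le)
      also have "\<bar>u * x - v * x\<bar> = \<bar>u - v\<bar> * \<bar>x\<bar>" by (simp add: abs_mult flip: left_diff_distrib)
      also have "min 2 \<dots> \<le> b x" unfolding b_def using uv by (intro min.mono mult_right_mono) auto
      finally show ?thesis .
    qed
    have "emp_char Z n \<omega> u - emp_char Z n \<omega> v = complex_of_real (1 / real n) * (\<Sum>k<n. iexp (u * Z k \<omega>) - iexp (v * Z k \<omega>))"
      by (simp add: emp_char_def sum_subtractf right_diff_distrib diff_divide_distrib)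
    also have "cmod \<dots> \<le> 1 / real n * (\<Sum>k<n. b (Z k \<omega>))"
      unfolding norm_mult using sum_mono[of "{..<n}", OF eb]
      by (intro mult_mono) (auto simp: norm_divide intro!: order_trans[OF norm_sum])
    finally have d1: "cmod (emp_char Z n \<omega> u - emp_char Z n \<omega> v) \<le> emp_mean n b \<omega>"
      by (simp add: emp_mean_def)
    have "\<bar>emp_mean n b \<omega> - (LINT x|P. b x)\<bar> < c / 8"
      using wB ws by (auto simp: Bad_def E1_def)
    then have eb1: "emp_mean n b \<omega> \<le> c / 4" using small unfolding b_def[symmetric] by linarith
    have ii: "integrable P (\<lambda>x. iexp (w * x))" for w by (rule P.integrable_const_bound[of _ 1]) auto
    have "char P u - char P v = (CLINT x|P. iexp (u * x) - iexp (v * x))"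
      unfolding char_def by (rule Bochner_Integration.integral_diff[symmetric, OF ii ii])
    also have "cmod \<dots> \<le> (LINT x|P. cmod (iexp (u * x) - iexp (v * x)))" by (rule integral_norm_bound)
    also have "\<dots> \<le> (LINT x|P. b x)"
      by (intro integral_mono integrable_norm Bochner_Integration.integrable_diff ii integrable_P_bounded[OF _ b(2)] eb) auto
    finally have d2: "cmod (char P u - char P v) \<le> c / 8" using small by (simp add: b_def)
    \<comment> \<open>The three errors are at most \<open>c / 4\<close>, \<open>c / 2\<close> and
      \<open>c / 8\<close>; the first is the integral of \<open>b\<close> plus its own fluctuation,
      each below \<open>c / 8\<close>.\<close>
    have "emp_char Z n \<omega> u - char P u = (emp_char Z n \<omega> u - emp_char Z n \<omega> v) + (emp_char Z n \<omega> v - char P v) - (char P u - char P v)"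
      by simp
    also have "cmod \<dots> \<le> cmod (emp_char Z n \<omega> u - emp_char Z n \<omega> v) + cmod (emp_char Z n \<omega> v - char P v) + cmod (char P u - char P v)"
      by (rule order_trans[OF norm_triangle_ineq4 add_right_mono[OF norm_triangle_ineq]])
    also have "\<dots> \<le> c" using d1 d2 dv eb1 c by linarith
    finally show ?thesis .
  qed
  show ?thesis using 1 2 3 4 by (intro exI[of _ A]) auto
qed

text \<open>The remainder is an integral over \<open>u\<close>, so a pointwise variance bound suffices: no
  maximal inequality for the empirical characteristic function is needed.\<close>

lemma square_deviation_in_probability:
  fixes a :: "nat \<Rightarrow> real \<Rightarrow> real"
  assumes a: "\<And>n. integrable lborel (a n)" and a0: "\<And>n u. a n u \<ge> 0"
    and lim: "(\<lambda>n. (1 / sqrt (real n)) * (LINT u|lborel. a n u)) \<longlonglongrightarrow> 0" and \<eta>: "\<eta> > 0"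
  shows "(\<lambda>n. prob {\<omega>\<in>space M. sqrt (real n) * (LINT u|lborel. a n u * (cmod (emp_char Z n \<omega> u - char P u))\<^sup>2) \<ge> \<eta>}) \<longlonglongrightarrow> 0"
proof -
  have [measurable]: "a n \<in> borel_measurable borel" for n using a by auto
  have [measurable]: "char P \<in> borel_measurable borel"
  proof -
    interpret real_distribution P by unfold_locales (auto simp: sets_P)
    show ?thesis by (rule char_measurable)
  qed
  define q where "q n \<omega> u = a n u * (cmod (emp_char Z n \<omega> u - char P u))\<^sup>2" for n \<omega> u
  define Q where "Q n \<omega> = (LINT u|lborel. q n \<omega> u)" for n \<omega>
  have [measurable]: "Q n \<in> borel_measurable M" for n unfolding Q_def q_def by measurable
  have q0: "q n \<omega> u \<ge> 0" for n \<omega> u by (simp add: q_def a0)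
  have Q0: "Q n \<omega> \<ge> 0" for n \<omega> unfolding Q_def by (intro integral_nonneg_AE) (simp add: q0)
  have EQ: "expectation (Q n) \<le> (1 / real n) * (LINT u|lborel. a n u)" and iQ: "integrable M (Q n)" if n: "n > 0" for n
  proof -
    have iu: "integrable M (\<lambda>\<omega>. q n \<omega> u)" for u
      unfolding q_def by (intro integrable_mult_right expectation_emp_char_deviation(2) n)
    have Eu: "(LINT \<omega>|M. q n \<omega> u) \<le> a n u * (1 / real n)" for u
      unfolding q_def using expectation_emp_char_deviation(1)[OF n] a0 by (simp add: mult_left_mono del: times_divide_eq_right)
    have Eu0: "(LINT \<omega>|M. q n \<omega> u) \<ge> 0" for u by (intro integral_nonneg_AE) (simp add: q0)
    have m: "(\<lambda>(u, \<omega>). q n \<omega> u) \<in> borel_measurable (lborel \<Otimes>\<^sub>M M)" unfolding q_def by measurable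
    have iE: "integrable lborel (\<lambda>u. LINT \<omega>|M. q n \<omega> u)"
    proof (rule Bochner_Integration.integrable_bound[where f="\<lambda>u. a n u * (1 / real n)"])
      show "(\<lambda>u. LINT \<omega>|M. q n \<omega> u) \<in> borel_measurable lborel" unfolding q_def by measurable
      show "AE u in lborel. norm (LINT \<omega>|M. q n \<omega> u) \<le> norm (a n u * (1 / real n))"
        using Eu Eu0 a0 by (auto intro!: AE_I2 simp: abs_of_nonneg)
    qed (use a in auto)
    interpret LM: pair_sigma_finite "lborel :: real measure" M ..
    have i: "integrable (lborel \<Otimes>\<^sub>M M) (\<lambda>(u, \<omega>). q n \<omega> u)"
      by (rule LM.Fubini_integrable[OF m]) (use iE iu q0 in auto)
    show "integrable M (Q n)"
      using LM.integrable_snd[OF i] by (simp add: Q_def[abs_def])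
    have "expectation (Q n) = (LINT u|lborel. LINT \<omega>|M. q n \<omega> u)"
      unfolding Q_def by (rule LM.Fubini_integral[OF i])
    also have "\<dots> \<le> (LINT u|lborel. a n u * (1 / real n))"
      using a by (intro integral_mono iE Eu integrable_mult_left)
    finally show "expectation (Q n) \<le> (1 / real n) * (LINT u|lborel. a n u)" by simp
  qed
  have "prob {\<omega>\<in>space M. sqrt (real n) * Q n \<omega> \<ge> \<eta>} \<le> (1 / \<eta>) * ((1 / sqrt (real n)) * (LINT u|lborel. a n u))" if n: "n > 0" for n
  proof -
    have "prob {\<omega>\<in>space M. sqrt (real n) * Q n \<omega> \<ge> \<eta>} \<le> expectation (\<lambda>\<omega>. sqrt (real n) * Q n \<omega>) / \<eta>"
      by (rule integral_Markov_inequality_measure[where A="{}"])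
         (use iQ[OF n] \<eta> Q0 in auto)
    also have "\<dots> \<le> sqrt (real n) * ((1 / real n) * (LINT u|lborel. a n u)) / \<eta>"
      using EQ[OF n] \<eta> by (simp add: divide_right_mono mult_left_mono del: times_divide_eq_right times_divide_eq_left)
    also have "\<dots> = (1 / \<eta>) * ((1 / sqrt (real n)) * (LINT u|lborel. a n u))"
    proof -
      define s where "s = sqrt (real n)"
      have s: "s > 0" "real n = s * s" using n by (auto simp: s_def)
      show ?thesis unfolding s_def[symmetric] unfolding s(2) using s(1) by (simp add: field_simps)
    qed
    finally show ?thesis .
  qed
  note le = this
  have "(\<lambda>n. (1 / \<eta>) * ((1 / sqrt (real n)) * (LINT u|lborel. a n u))) \<longlonglongrightarrow> (1 / \<eta>) * 0"
    by (intro tendsto_intros lim)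
  then have lim0: "(\<lambda>n. (1 / \<eta>) * ((1 / sqrt (real n)) * (LINT u|lborel. a n u))) \<longlonglongrightarrow> 0" by simp
  have "(\<lambda>n. prob {\<omega>\<in>space M. sqrt (real n) * Q n \<omega> \<ge> \<eta>}) \<longlonglongrightarrow> 0"
  proof (rule tendsto_sandwich[OF _ _ tendsto_const lim0])
    show "\<forall>\<^sub>F n in sequentially. prob {\<omega>\<in>space M. sqrt (real n) * Q n \<omega> \<ge> \<eta>} \<le> (1 / \<eta>) * ((1 / sqrt (real n)) * (LINT u|lborel. a n u))"
      using eventually_gt_at_top[of 0] by eventually_elim (rule le)
  qed simp
  then show ?thesis unfolding Q_def q_def .
qed

text \<open>The classical theorem needs positive variance. If \<open>v\<close> is 0, the empirical
  mean is almost surely constant and the limit is the point mass at 0, which the form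
  \<open>sqrt v * x\<close> covers; a normal density would not.\<close>

lemma CLT_emp_mean:
  fixes f :: "real \<Rightarrow> real" and \<psi> :: "real \<Rightarrow> real"
  assumes f [measurable]: "f \<in> borel_measurable borel" and fB: "\<And>x. \<bar>f x\<bar> \<le> B"
    and \<psi>: "continuous_on UNIV \<psi>" and \<psi>F: "\<And>x. \<bar>\<psi> x\<bar> \<le> F"
  defines "v \<equiv> (LINT x|P. (f x - (LINT x|P. f x))\<^sup>2)"
  shows "(\<lambda>n. expectation (\<lambda>\<omega>. \<psi> (sqrt (real n) * (emp_mean n f \<omega> - (LINT x|P. f x)))))
    \<longlonglongrightarrow> (LINT x|std_normal_distribution. \<psi> (sqrt v * x))"
proof -
  have [measurable]: "\<psi> \<in> borel_measurable borel" by (rule borel_measurable_continuous_onI[OF \<psi>])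
  define m where "m = (LINT x|P. f x)"
  interpret N: real_distribution std_normal_distribution by (rule real_dist_normal_dist)
  have v0: "v \<ge> 0" unfolding v_def by simp
  show ?thesis
  proof (cases "v = 0")
    case True
    have "expectation (\<lambda>\<omega>. \<psi> (sqrt (real n) * (emp_mean n f \<omega> - m))) = \<psi> 0" if n: "n > 0" for n
    proof -
      have "AE \<omega> in M. (emp_mean n f \<omega> - m)\<^sup>2 = 0"
        using integral_nonneg_eq_0_iff_AE[OF expectation_emp_mean_square(2)[OF f fB n]]
          expectation_emp_mean_square(1)[OF f fB n] True by (simp add: m_def v_def)
      then have "AE \<omega> in M. \<psi> (sqrt (real n) * (emp_mean n f \<omega> - m)) = \<psi> 0"
        by eventually_elim simp
      then have "expectation (\<lambda>\<omega>. \<psi> (sqrt (real n) * (emp_mean n f \<omega> - m))) = expectation (\<lambda>\<omega>. \<psi> 0)"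
        by (intro integral_cong_AE) auto
      then show ?thesis using prob_space by simp
    qed
    then have "(\<lambda>n. expectation (\<lambda>\<omega>. \<psi> (sqrt (real n) * (emp_mean n f \<omega> - m)))) \<longlonglongrightarrow> \<psi> 0"
      by (intro tendsto_eventually eventually_mono[OF eventually_gt_at_top[of 0]]) auto
    then show ?thesis using True N.prob_space by (simp add: m_def)
  next
    case False
    with v0 have v: "v > 0" by simp
    \<comment> \<open>The standardised sum of the classical theorem; the factor
      \<open>sqrt v\<close> goes into the test function.\<close>
    define S where "S n \<omega> = (\<Sum>i<n. f (Z i \<omega>) - m) / sqrt (real n * (sqrt v)\<^sup>2)" for n \<omega>
    have [measurable]: "S n \<in> borel_measurable M" for n unfolding S_def by measurable
    have w: "weak_conv_m (\<lambda>n. distr M borel (S n)) std_normal_distribution"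
      unfolding S_def
    proof (rule central_limit_theorem[where \<mu>="distr P borel f"])
      show "indep_vars (\<lambda>i. borel) (\<lambda>i \<omega>. f (Z i \<omega>)) UNIV"
        by (rule indep_vars_compose2[OF Z_indep]) auto
      show E: "expectation (\<lambda>\<omega>. f (Z n \<omega>)) = m" for n unfolding m_def by (rule integral_Z) auto
      show "sqrt v > 0" using v by simp
      have "norm ((f x)\<^sup>2) \<le> B\<^sup>2" for x using power_mono[OF fB abs_ge_zero, of x 2] by simp
      then show "integrable M (\<lambda>x. (f (Z n x))\<^sup>2)" for n by (intro integrable_const_bound[of _ "B\<^sup>2"]) auto
      show "variance (\<lambda>\<omega>. f (Z n \<omega>)) = (sqrt v)\<^sup>2" for n
        unfolding E using integral_Z[of "\<lambda>x. (f x - m)\<^sup>2" n] v by (simp add: v_def m_def)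
      show "distr M borel (\<lambda>\<omega>. f (Z n \<omega>)) = distr P borel f" for n
        unfolding Z_law[of n, symmetric] by (subst distr_distr) (auto simp: comp_def)
    qed
    have "(\<lambda>n. integral\<^sup>L (distr M borel (S n)) (\<lambda>x. \<psi> (sqrt v * x))) \<longlonglongrightarrow> (LINT x|std_normal_distribution. \<psi> (sqrt v * x))"
    proof (rule weak_conv_imp_integral_bdd_continuous_conv[OF _ _ w])
      show "real_distribution (distr M borel (S n))" for n by (rule real_distribution_distr) simp
      have "continuous_on UNIV (\<lambda>x. \<psi> (sqrt v * x))"
        by (intro continuous_on_compose2[OF \<psi>] continuous_intros) auto
      then show "isCont (\<lambda>x. \<psi> (sqrt v * x)) x" for x by (simp add: continuous_on_eq_continuous_at)
    qed (use \<psi>F in \<open>auto intro: N.real_distribution_axioms\<close>)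
    moreover have "integral\<^sup>L (distr M borel (S n)) (\<lambda>x. \<psi> (sqrt v * x)) = expectation (\<lambda>\<omega>. \<psi> (sqrt v * S n \<omega>))" for n
      by (rule integral_distr) auto
    moreover have "sqrt v * S n \<omega> = sqrt (real n) * (emp_mean n f \<omega> - m)" for n \<omega>
    proof (cases "n = 0")
      case False
      define s where "s = sqrt (real n)"
      have s: "s > 0" "real n = s * s" using False by (auto simp: s_def)
      have "sqrt v * S n \<omega> = (\<Sum>i<n. f (Z i \<omega>) - m) / s"
        using v by (simp add: S_def s_def real_sqrt_mult)
      also have "\<dots> = s * (emp_mean n f \<omega> - m)"
        using s by (simp add: emp_mean_def sum_subtractf field_simps)
      finally show ?thesis by (simp add: s_def)
    qed (simp add: S_def)
    ultimately show ?thesis unfolding m_def by simp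
  qed
qed

end

section \<open>The central limit theorem for the spectral estimator\<close>

context
  fixes K :: "real \<Rightarrow> real" and h :: real
  assumes K: "integrable lborel K" and h: "h > 0"
begin

lemma scaled_kernel_integrable: "integrable lborel (scaled_kernel K h)"
  using lborel_integrable_real_affine[OF K, of "1 / h" 0] h
  by (simp add: scaled_kernel_def[abs_def])

lemma FT_scaled_kernel:
  "FT (\<lambda>x. complex_of_real (scaled_kernel K h x)) u = FT (\<lambda>x. complex_of_real (K x)) (h * u)"
  unfolding FT_def using h
  by (subst lborel_integral_real_affine[where c=h and t=0])
     (auto simp: scaled_kernel_def scaleR_conv_of_real mult_ac)

lemma integral_abs_scaled_kernel: "(LINT x|lborel. \<bar>scaled_kernel K h x\<bar>) = (LINT x|lborel. \<bar>K x\<bar>)"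
  using h by (subst lborel_integral_real_affine[where c=h and t=0])
     (auto simp: scaled_kernel_def abs_mult)

end

text \<open>The exponent \<open>1 / (1 + 2 * \<delta>)\<close> is below 1, so
  \<open>ln (1 / h n)\<close> is eventually at most half of \<open>\<kappa> * real n\<close>, and
  the other half of the exponential survives.\<close>

lemma exp_rate:
  fixes h :: "nat \<Rightarrow> real"
  assumes h: "\<And>n. h n > 0" and delta: "\<delta> > 0"
    and rate: "(\<lambda>n. ln (1 / h n) / real n powr (1 / (1 + 2 * \<delta>))) \<longlonglongrightarrow> 0" and \<kappa>: "\<kappa> > 0"
  shows "(\<lambda>n. 1 / h n * exp (- \<kappa> * real n)) \<longlonglongrightarrow> 0"
proof -
  have "eventually (\<lambda>n. ln (1 / h n) / real n powr (1 / (1 + 2 * \<delta>)) < \<kappa> / 2) sequentially"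
    using \<kappa> by (intro order_tendstoD(2)[OF rate]) simp
  then have ev: "eventually (\<lambda>n. 1 / h n * exp (- \<kappa> * real n) \<le> exp (- (\<kappa> / 2) * real n)) sequentially"
    using eventually_gt_at_top[of 0]
  proof eventually_elim
    case (elim n)
    have "real n powr (1 / (1 + 2 * \<delta>)) \<le> real n powr 1"
      using elim delta by (intro powr_mono) (auto simp: field_simps)
    then have p: "real n powr (1 / (1 + 2 * \<delta>)) \<le> real n" using elim by simp
    have "ln (1 / h n) < \<kappa> / 2 * real n powr (1 / (1 + 2 * \<delta>))"
      using elim by (simp add: divide_less_eq)
    also have "\<dots> \<le> \<kappa> / 2 * real n" using p \<kappa> by (intro mult_left_mono) auto
    finally have l: "ln (1 / h n) \<le> \<kappa> / 2 * real n" by simp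
    have "1 / h n * exp (- \<kappa> * real n) = exp (ln (1 / h n)) * exp (- \<kappa> * real n)" using h by simp
    also have "\<dots> = exp (ln (1 / h n) - \<kappa> * real n)" by (simp add: exp_diff exp_minus divide_inverse)
    also have "\<dots> \<le> exp (- (\<kappa> / 2) * real n)" using l by (simp add: field_simps)
    finally show ?case .
  qed
  have lim: "(\<lambda>n. exp (- (\<kappa> / 2) * real n)) \<longlonglongrightarrow> 0" using \<kappa> by real_asymp
  show ?thesis
    by (rule tendsto_sandwich[OF _ ev tendsto_const lim]) (auto intro!: always_eventually divide_nonneg_nonneg less_imp_le[OF h])
qed

lemma (in iid_sample) rhs_stat_measurable:
  assumes [measurable]: "g n \<in> borel_measurable borel" and g2: "integrable lborel (\<lambda>x. (g n x)\<^sup>2)"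
    and [measurable]: "conv_M \<Delta> \<gamma> lam \<nu> (conv_fun (g n) (scaled_kernel K (h n))) \<in> borel_measurable borel"
    and [measurable]: "cpp_char \<Delta> \<gamma> lam \<nu> \<in> borel_measurable borel" "scaled_kernel K (h n) \<in> borel_measurable borel"
  shows "rhs_stat \<Delta> \<gamma> lam \<nu> P K g h Z n \<in> borel_measurable M"
proof -
  have [measurable]: "FT_L2 (\<lambda>x. complex_of_real (g n x)) \<in> borel_measurable borel"
    by (rule FT_L2_measurable) (use g2 in auto)
  show ?thesis unfolding rhs_stat_def by measurable
qed

theorem theorem3p5:
  fixes M :: "'a measure" and Z :: "nat \<Rightarrow> 'a \<Rightarrow> real" and P \<nu> :: "real measure"
    and lam \<gamma> \<Delta> \<delta> :: real and K G :: "real \<Rightarrow> real" and g :: "nat \<Rightarrow> real \<Rightarrow> real"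
    and h :: "nat \<Rightarrow> real"
  assumes M: "prob_space M"
    and lam: "lam > 0" and Delta: "\<Delta> > 0"
    and nu_fin: "finite_measure \<nu>" and nu_sets: "sets \<nu> = sets borel"
    and nu_mass: "measure \<nu> (space \<nu>) = lam"
    and nu_log: "\<exists>\<beta>>2. integrable \<nu> (\<lambda>x. ln (max \<bar>x\<bar> (exp 1)) powr \<beta>)"
    and Z_meas: "\<forall>k. Z k \<in> borel_measurable M"
    and Z_indep: "prob_space.indep_vars M (\<lambda>_. borel) Z UNIV"
    and Z_law: "\<forall>k. distr M borel (Z k) = P"
    and P_char: "\<forall>u. char P u = cpp_char \<Delta> \<gamma> lam \<nu> u"
    and K_L1: "integrable lborel K" and K_sym: "\<forall>x. K (- x) = K x"
    and K_supp: "\<forall>u. \<bar>u\<bar> > 1 \<longrightarrow> FT (\<lambda>x. complex_of_real (K x)) u = 0"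
    and h_pos: "\<forall>n. h n > 0" and h_lim: "h \<longlonglongrightarrow> 0"
    and delta: "\<delta> > 0"
    and h_rate: "(\<lambda>n. ln (1 / h n) / real n powr (1 / (1 + 2 * \<delta>))) \<longlonglongrightarrow> 0"
    and g_L2: "\<forall>n. g n \<in> borel_measurable lborel \<and> integrable lborel (\<lambda>x. (g n x)\<^sup>2)"
    and g_FT: "(\<lambda>n. LBINT u:{- 1 / h n..1 / h n}. cmod (FT_L2 (\<lambda>x. complex_of_real (g n x)) u))
                 \<in> o(\<lambda>n. sqrt (real n) * ln (1 / h n) powr (- (1 + 2 * \<delta>)))"
    and g_bdd: "\<exists>B. \<forall>n x. \<bar>g n x\<bar> \<le> B"
    and G_lim: "\<forall>x. (\<lambda>n. conv_fun (g n) (scaled_kernel K (h n)) x) \<longlonglongrightarrow> G x"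
  shows "\<exists>A. (\<forall>n. A n \<in> sets M) \<and> (\<lambda>n. measure M (A n)) \<longlonglongrightarrow> 1 \<and>
      (\<forall>n. \<forall>\<omega>\<in>A n.
         (\<forall>u\<in>{- 1 / h n..1 / h n}. emp_char Z n \<omega> u / cpp_char \<Delta> \<gamma> lam \<nu> u \<noteq> 0) \<and>
         lhs_stat \<Delta> \<gamma> lam \<nu> K g h Z n \<omega> = rhs_stat \<Delta> \<gamma> lam \<nu> P K g h Z n \<omega>) \<and>
      (\<exists>\<sigma>2::real.
         integrable P (\<lambda>x. (conv_M \<Delta> \<gamma> lam \<nu> G x - G 0)\<^sup>2) \<and>
         integrable P (\<lambda>x. (conv_M \<Delta> \<gamma> lam \<nu> G x)\<^sup>2) \<and>
         \<Delta>\<^sup>2 * \<sigma>2 = (LINT x|P. (conv_M \<Delta> \<gamma> lam \<nu> G x - G 0)\<^sup>2) \<and>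
         \<Delta>\<^sup>2 * \<sigma>2 = (LINT x|P. (conv_M \<Delta> \<gamma> lam \<nu> G x)\<^sup>2) - (G 0)\<^sup>2 \<and>
         conv_in_distr M (rhs_stat \<Delta> \<gamma> lam \<nu> P K g h Z)
           (distr std_normal_distribution borel (\<lambda>x. complex_of_real (sqrt \<sigma>2 * x))))"
proof -
  interpret prob_space M by (rule M)
  interpret iid_sample M Z P
    by unfold_locales (use Z_meas Z_indep Z_law in auto)
  note nu = nu_fin nu_sets nu_mass Delta

  \<comment> \<open>The characteristic function and the band-limited kernels\<close>
  define \<phi> where "\<phi> = cpp_char \<Delta> \<gamma> lam \<nu>"
  have cP: "char P u = \<phi> u" for u using P_char by (simp add: \<phi>_def)
  have phi0: "\<phi> u \<noteq> 0" and phi_ge: "cmod (\<phi> u) \<ge> exp (- (2 * lam * \<Delta>))" for u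
    unfolding \<phi>_def by (rule cpp_char_nonzero[OF nu] norm_cpp_char_ge[OF nu])+
  have phi_meas [measurable]: "\<phi> \<in> borel_measurable borel"
    unfolding \<phi>_def by (rule cpp_char_measurable[OF nu])
  define k where "k n = scaled_kernel K (h n)" for n
  define T where "T n = 1 / h n" for n
  have T: "T n > 0" for n using h_pos by (simp add: T_def)
  have Tset: "{- 1 / h n..1 / h n} = {- T n..T n}" for n by (simp add: T_def)
  have k: "integrable lborel (k n)" for n
    unfolding k_def using K_L1 h_pos by (intro scaled_kernel_integrable) auto
  have [measurable]: "k n \<in> borel_measurable borel" for n using k[of n] by auto
  have k_sym: "k n (- x) = k n x" for n x using K_sym by (simp add: k_def scaled_kernel_def)
  have k_supp: "FT (\<lambda>x. complex_of_real (k n x)) u = 0" if "\<bar>u\<bar> > T n" for n u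
  proof -
    have "\<bar>h n * u\<bar> > 1" using that h_pos[rule_format, of n] by (simp add: T_def abs_mult field_simps)
    then show ?thesis
      unfolding k_def using FT_scaled_kernel[OF K_L1, of "h n" u] h_pos K_supp by simp
  qed
  define \<kappa> where "\<kappa> = (LINT x|lborel. \<bar>K x\<bar>)"
  have \<kappa>0: "\<kappa> \<ge> 0" by (simp add: \<kappa>_def)
  have k_abs: "(LINT x|lborel. \<bar>k n x\<bar>) = \<kappa>" for n
    unfolding k_def \<kappa>_def using K_L1 h_pos by (intro integral_abs_scaled_kernel) auto
  have FTk_le: "cmod (FT (\<lambda>x. complex_of_real (k n x)) u) \<le> \<kappa>" for n u
    using norm_FT_le[of "\<lambda>x. complex_of_real (k n x)" u] k_abs[of n] by simp
  obtain B where gB: "\<And>n x. \<bar>g n x\<bar> \<le> B" using g_bdd by blast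
  have g [measurable]: "g n \<in> borel_measurable borel" and g2: "integrable lborel (\<lambda>x. (g n x)\<^sup>2)" for n
    using g_L2 by auto
  define Fg where "Fg n = FT_L2 (\<lambda>x. complex_of_real (g n x))" for n
  have [measurable]: "Fg n \<in> borel_measurable borel" for n
    unfolding Fg_def by (rule FT_L2_measurable) (use g2 in auto)

  \<comment> \<open>The linearised functions, their limit and the variance\<close>
  define D where "D = B * \<kappa>"
  define F where "F n = conv_fun (g n) (k n)" for n
  have F_meas: "F n \<in> borel_measurable borel" for n
    unfolding F_def by (rule conv_fun_measurable[OF k k_sym k_supp g g2 gB])
  have FD: "\<bar>F n x\<bar> \<le> D" for n x
    unfolding F_def D_def k_abs[of n, symmetric] by (rule abs_conv_fun_le[OF k k_sym k_supp g g2 gB])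
  have FG: "(\<lambda>n. F n x) \<longlonglongrightarrow> G x" for x using G_lim by (simp add: F_def k_def)
  have G_meas: "G \<in> borel_measurable borel" by (rule borel_measurable_LIMSEQ_metric[OF F_meas FG])
  have GD: "\<bar>G x\<bar> \<le> D" for x
    by (rule LIMSEQ_le_const2[OF tendsto_rabs[OF FG]]) (use FD in auto)
  define f where "f n = conv_M \<Delta> \<gamma> lam \<nu> (F n)" for n
  define fG where "fG = conv_M \<Delta> \<gamma> lam \<nu> G"
  define E where "E = exp (2 * lam * \<Delta>) * D"
  have [measurable]: "f n \<in> borel_measurable borel" "fG \<in> borel_measurable borel" for n
    unfolding f_def fG_def by (rule conv_M_measurable[OF nu F_meas FD] conv_M_measurable[OF nu G_meas GD])+
  have fG_meas: "fG \<in> borel_measurable borel" by measurable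
  have fE: "\<bar>f n x\<bar> \<le> E" and fGE: "\<bar>fG x\<bar> \<le> E" for n x
    unfolding f_def fG_def E_def by (rule abs_conv_M_le[OF nu F_meas FD] abs_conv_M_le[OF nu G_meas GD])+
  have flim: "(\<lambda>n. f n x) \<longlonglongrightarrow> fG x" for x
    unfolding f_def fG_def by (rule conv_M_tendsto[OF nu F_meas FD FG])
  have fint: "(LINT x|P. f n x) = F n 0" for n
    unfolding f_def F_def
    by (rule integral_conv_M_conv_fun[OF k k_sym k_supp g g2 gB nu prob_space_P sets_P P_char[rule_format]])
  have "(\<lambda>n. LINT x|P. f n x) \<longlonglongrightarrow> (LINT x|P. fG x)"
    by (rule integral_dominated_convergence[where w="\<lambda>_. E"]) (use fE flim in auto)
  then have fGint: "(LINT x|P. fG x) = G 0"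
    unfolding fint using FG LIMSEQ_unique by blast
  have iG: "integrable P fG" "integrable P (\<lambda>x. (fG x)\<^sup>2)" and iF: "integrable P (f n)" for n
    by (rule integrable_P_bounded[OF _ fGE] integrable_P_bounded[OF _ fE]; simp)+
  define v where "v = (LINT x|P. (fG x - G 0)\<^sup>2)"
  have v0: "v \<ge> 0" by (simp add: v_def)
  have v_eq: "v = (LINT x|P. (fG x)\<^sup>2) - (G 0)\<^sup>2"
    unfolding v_def using P.variance_eq[OF iG] by (simp add: fGint)
  have iv: "integrable P (\<lambda>x. (fG x - G 0)\<^sup>2)"
  proof (rule integrable_P_bounded(2))
    show "\<bar>fG x - G 0\<bar> \<le> E + \<bar>G 0\<bar>" for x using fGE[of x] by linarith
  qed simp
  define \<sigma>2 where "\<sigma>2 = v / \<Delta>\<^sup>2"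

  \<comment> \<open>Good events and the identity of the two statistics\<close>
  define c where "c = exp (- (2 * lam * \<Delta>)) / 2"
  have c: "c > 0" by (simp add: c_def)
  have T_rate: "(\<lambda>n. T n * exp (- s * real n)) \<longlonglongrightarrow> 0" if "s > 0" for s
    unfolding T_def by (rule exp_rate[OF h_pos[rule_format] delta h_rate that])
  obtain A where A: "\<And>n. A n \<in> events" "(\<lambda>n. prob (A n)) \<longlonglongrightarrow> 1" "\<And>n \<omega>. \<omega> \<in> A n \<Longrightarrow> n > 0"
    "\<And>n \<omega> u. \<omega> \<in> A n \<Longrightarrow> \<bar>u\<bar> \<le> T n \<Longrightarrow> cmod (emp_char Z n \<omega> u - char P u) \<le> c"
    using emp_char_uniform[OF T T_rate c] by metis
  define r where "r n \<omega> u = emp_char Z n \<omega> u / \<phi> u" for n \<omega> u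
  have r1: "cmod (r n \<omega> u - 1) \<le> exp (2 * lam * \<Delta>) * cmod (emp_char Z n \<omega> u - char P u)" for n \<omega> u
  proof -
    have "r n \<omega> u - 1 = (emp_char Z n \<omega> u - char P u) / \<phi> u"
      using phi0[of u] by (simp add: r_def cP field_simps)
    then have "cmod (r n \<omega> u - 1) = cmod (emp_char Z n \<omega> u - char P u) / cmod (\<phi> u)"
      by (simp add: norm_divide)
    also have "\<dots> \<le> cmod (emp_char Z n \<omega> u - char P u) / exp (- (2 * lam * \<Delta>))"
      using phi_ge[of u] phi0[of u] by (intro divide_left_mono) auto
    finally show ?thesis by (simp add: exp_minus divide_inverse mult.commute)
  qed
  \<comment> \<open>The threshold \<open>c\<close> is half of the lower bound for the modulus of
    \<phi>, so division by \<phi> turns it into the radius 1/2 on which the logarithm and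
    \<open>R_fun\<close> are controlled.\<close>
  have near: "cmod (r n \<omega> u - 1) \<le> 1 / 2" if "\<omega> \<in> A n" "\<bar>u\<bar> \<le> T n" for n \<omega> u
  proof -
    have "exp (2 * lam * \<Delta>) * cmod (emp_char Z n \<omega> u - char P u) \<le> exp (2 * lam * \<Delta>) * c"
      using A(4)[OF that] by (intro mult_left_mono) auto
    also have "\<dots> = 1 / 2" by (simp add: c_def exp_minus)
    finally show ?thesis using r1 order_trans by blast
  qed
  have nz: "r n \<omega> u \<noteq> 0" if "\<omega> \<in> A n" "\<bar>u\<bar> \<le> T n" for n \<omega> u
    using near[OF that] by auto
  have eq: "lhs_stat \<Delta> \<gamma> lam \<nu> K g h Z n \<omega> = rhs_stat \<Delta> \<gamma> lam \<nu> P K g h Z n \<omega>" if w: "\<omega> \<in> A n" for n \<omega>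
  proof -
    have "(CLINT x|lborel. complex_of_real (g n x) * iFT (\<lambda>u. cont_log (r n \<omega>) (T n) u * FT (\<lambda>x. complex_of_real (k n x)) u) x) =
      complex_of_real ((1 / real n) * (\<Sum>j<n. f n (Z j \<omega>)) - (LINT x|P. f n x))
      + complex_of_real (1 / (2 * pi)) * (CLINT u|lborel. Fg n (- u) * R_fun (r n \<omega> u) * FT (\<lambda>x. complex_of_real (k n x)) u)"
      unfolding r_def emp_char_def \<phi>_def f_def F_def Fg_def
      by (rule log_linearisation[OF k k_sym k_supp g g2 gB nu prob_space_P sets_P P_char[rule_format] less_imp_le[OF T] A(3)[OF w]])
         (use near[OF w] in \<open>simp_all add: r_def emp_char_def \<phi>_def\<close>)
    note key = this
    have alg: "complex_of_real (s / \<Delta>) * (complex_of_real x + complex_of_real (1 / (2 * pi)) * W)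
      = complex_of_real (s / \<Delta> * x) + complex_of_real (s / (2 * pi * \<Delta>)) * W" for s x W
      by (simp add: distrib_left mult_ac)
    show ?thesis
      unfolding lhs_stat_def rhs_stat_def k_def[symmetric] T_def[symmetric] \<phi>_def[symmetric] r_def[symmetric]
        F_def[symmetric] f_def[symmetric] Fg_def[symmetric] key alg ..
  qed

  \<comment> \<open>Linear part and remainder\<close>
  define X where "X = rhs_stat \<Delta> \<gamma> lam \<nu> P K g h Z"
  define S where "S n \<omega> = sqrt (real n) / \<Delta> * (emp_mean n (f n) \<omega> - (LINT x|P. f n x))" for n \<omega>
  define S' where "S' n \<omega> = sqrt (real n) / \<Delta> * (emp_mean n fG \<omega> - (LINT x|P. fG x))" for n \<omega>
  define Rem where "Rem n \<omega> = complex_of_real (sqrt (real n) / (2 * pi * \<Delta>)) *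
    (CLINT u|lborel. Fg n (- u) * R_fun (r n \<omega> u) * FT (\<lambda>x. complex_of_real (k n x)) u)" for n \<omega>
  have X: "X n \<omega> = complex_of_real (S n \<omega>) + Rem n \<omega>" for n \<omega>
    unfolding X_def S_def Rem_def rhs_stat_def emp_mean_def r_def \<phi>_def f_def F_def k_def Fg_def ..
  have [measurable]: "S n \<in> borel_measurable M" "S' n \<in> borel_measurable M" for n
    unfolding S_def S'_def by measurable
  have X_meas [measurable]: "X n \<in> borel_measurable M" for n
    unfolding X_def using phi_meas \<open>\<And>n. f n \<in> borel_measurable borel\<close>[of n] \<open>\<And>n. k n \<in> borel_measurable borel\<close>[of n]
    by (intro rhs_stat_measurable g g2) (simp_all add: \<phi>_def f_def F_def k_def)

  \<comment> \<open>The factors are the constant of \<open>norm_R_fun_le\<close>, the square of the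
    bound for 1 / \<phi>, the bound \<open>\<kappa>\<close> for the transform of the kernel, and the
    prefactor of the remainder.\<close>
  define C where "C = 2 * exp (2 * lam * \<Delta>) ^ 2 * \<kappa> / (2 * pi * \<Delta>)"
  have C0: "C \<ge> 0" using \<kappa>0 Delta by (simp add: C_def)
  define a where "a n u = C * (indicat_real {- T n..T n} u * cmod (Fg n (- u)))" for n u
  have a0: "a n u \<ge> 0" for n u using C0 by (simp add: a_def)
  have FgI: "integrable lborel (\<lambda>u. indicat_real {- T n..T n} u * cmod (Fg n u))" for n
  proof -
    have "integrable lborel (\<lambda>u. Fg n u * complex_of_real (indicat_real {- T n..T n} u))"
    proof (rule L2_mult_integrable)
      show "integrable lborel (\<lambda>u. (cmod (Fg n u))\<^sup>2)"
        unfolding Fg_def by (rule FT_L2_square_integrable) (use g2 in auto)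
      show "integrable lborel (\<lambda>u. (cmod (complex_of_real (indicat_real {- T n..T n} u)))\<^sup>2)"
        by (rule bounded_support_integrable[where C=1 and T="T n"]) (auto simp: indicator_def)
    qed auto
    from integrable_norm[OF this] show ?thesis by (simp add: norm_mult mult.commute)
  qed
  have a: "integrable lborel (a n)" for n
  proof -
    have "indicat_real {- T n..T n} (- u) = indicat_real {- T n..T n} u" for u
      by (auto simp: indicator_def)
    then show ?thesis
      unfolding a_def using integrable_reflect[OF FgI[of n]] by (intro integrable_mult_right) simp
  qed
  define I where "I n = (LBINT u:{- 1 / h n..1 / h n}. cmod (Fg n u))" for n
  have aI: "(LINT u|lborel. a n u) = C * I n" for n
  proof -
    have ind: "indicat_real {- T n..T n} (- u) = indicat_real {- T n..T n} u" for u
      by (auto simp: indicator_def)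
    have "(LINT u|lborel. indicat_real {- T n..T n} u * cmod (Fg n (- u))) = (LINT u|lborel. indicat_real {- T n..T n} u * cmod (Fg n u))"
      by (subst lborel_integral_real_affine[where c="-1" and t=0]) (auto simp: ind)
    then show ?thesis unfolding a_def I_def Tset set_lebesgue_integral_def by simp
  qed
  \<comment> \<open>Once \<open>h n\<close> is below \<open>exp (- 1)\<close>, the logarithm is at
    least 1 and its negative power at most 1, so the assumed rate gives in particular o(sqrt
    n).\<close>
  have Ilim: "(\<lambda>n. (1 / sqrt (real n)) * I n) \<longlonglongrightarrow> 0"
  proof (rule tendstoI)
    fix e :: real assume e: "e > 0"
    have 1: "eventually (\<lambda>n. norm (I n) \<le> e / 2 * norm (sqrt (real n) * ln (1 / h n) powr (- (1 + 2 * \<delta>)))) sequentially"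
      using landau_o.smallD[OF g_FT, of "e / 2"] e unfolding I_def Fg_def by simp
    have "eventually (\<lambda>n. h n < exp (- 1)) sequentially"
      by (rule order_tendstoD(2)[OF h_lim]) simp
    with 1 show "eventually (\<lambda>n. dist ((1 / sqrt (real n)) * I n) 0 < e) sequentially"
      using eventually_gt_at_top[of 0]
    proof eventually_elim
      case (elim n)
      have "ln (h n) < - 1" using elim(2) h_pos[rule_format, of n] by (metis exp_gt_zero ln_exp ln_less_cancel_iff)
      then have "ln (1 / h n) \<ge> 1" using h_pos[rule_format, of n] by (simp add: ln_div)
      then have "ln (1 / h n) powr (- (1 + 2 * \<delta>)) \<le> ln (1 / h n) powr 0"
        using delta by (intro powr_mono) auto
      then have "ln (1 / h n) powr (- (1 + 2 * \<delta>)) \<le> 1" using \<open>ln (1 / h n) \<ge> 1\<close> by simp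
      then have "norm (sqrt (real n) * ln (1 / h n) powr (- (1 + 2 * \<delta>))) \<le> sqrt (real n)"
        by (simp add: abs_mult mult_left_le)
      then have "norm (I n) \<le> e / 2 * sqrt (real n)"
        using elim(1) e by (smt (verit) mult_left_mono half_gt_zero)
      then have "\<bar>I n\<bar> / sqrt (real n) \<le> e / 2" using elim(3) by (simp add: divide_le_eq)
      then have "\<bar>I n\<bar> / sqrt (real n) < e" using e by linarith
      then show ?case by (simp add: dist_real_def)
    qed
  qed
  have alim: "(\<lambda>n. (1 / sqrt (real n)) * (LINT u|lborel. a n u)) \<longlonglongrightarrow> 0"
    using tendsto_mult_left[OF Ilim, of C] by (simp add: aI mult_ac)
  define Q where "Q n \<omega> = sqrt (real n) * (LINT u|lborel. a n u * (cmod (emp_char Z n \<omega> u - char P u))\<^sup>2)" for n \<omega>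
  have [measurable]: "Q n \<in> borel_measurable M" for n
  proof -
    have [measurable]: "char P \<in> borel_measurable borel" unfolding cP[abs_def] by measurable
    have [measurable]: "a n \<in> borel_measurable borel" using a by auto
    show ?thesis unfolding Q_def by measurable
  qed
  have RQ: "cmod (Rem n \<omega>) \<le> Q n \<omega>" if w: "\<omega> \<in> A n" for n \<omega>
  proof -
    define q where "q u = emp_char Z n \<omega> u - char P u" for u
    have ws: "\<omega> \<in> space M" using A(1) w sets.sets_into_space by blast
    have [measurable]: "q \<in> borel_measurable borel"
    proof -
      have [measurable]: "char P \<in> borel_measurable borel" unfolding cP[abs_def] by measurable
      show ?thesis unfolding q_def emp_char_def by measurable
    qed
    have pw: "sqrt (real n) / (2 * pi * \<Delta>) * cmod (Fg n (- u) * R_fun (r n \<omega> u) * FT (\<lambda>x. complex_of_real (k n x)) u)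
       \<le> sqrt (real n) * (a n u * (cmod (q u))\<^sup>2)" for u
    proof (cases "\<bar>u\<bar> \<le> T n")
      case True
      have "cmod (R_fun (r n \<omega> u)) \<le> 2 * (cmod (r n \<omega> u - 1))\<^sup>2" by (rule norm_R_fun_le[OF near[OF w True]])
      also have "\<dots> \<le> 2 * (exp (2 * lam * \<Delta>) * cmod (q u))\<^sup>2"
        unfolding q_def by (intro mult_left_mono power_mono r1) auto
      finally have "cmod (R_fun (r n \<omega> u)) \<le> 2 * (exp (2 * lam * \<Delta>) ^ 2 * (cmod (q u))\<^sup>2)"
        by (simp add: power_mult_distrib)
      then have "cmod (Fg n (- u)) * cmod (R_fun (r n \<omega> u)) * cmod (FT (\<lambda>x. complex_of_real (k n x)) u)
        \<le> cmod (Fg n (- u)) * (2 * (exp (2 * lam * \<Delta>) ^ 2 * (cmod (q u))\<^sup>2)) * \<kappa>"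
        using FTk_le by (intro mult_mono) auto
      then have "sqrt (real n) / (2 * pi * \<Delta>) * cmod (Fg n (- u) * R_fun (r n \<omega> u) * FT (\<lambda>x. complex_of_real (k n x)) u)
        \<le> sqrt (real n) / (2 * pi * \<Delta>) * (cmod (Fg n (- u)) * (2 * (exp (2 * lam * \<Delta>) ^ 2 * (cmod (q u))\<^sup>2)) * \<kappa>)"
        unfolding norm_mult using Delta by (intro mult_left_mono) auto
      also have "\<dots> = sqrt (real n) * (a n u * (cmod (q u))\<^sup>2)"
        using True by (simp add: a_def C_def abs_le_iff indicator_def)
      finally show ?thesis .
    next
      case False
      then show ?thesis using k_supp[of n u] a0 by simp
    qed
    \<comment> \<open>Comparing the integrals takes an integrable majorant: on the band the
      deviation is at most \<open>c\<close> because \<open>\<omega>\<close> lies in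
      \<open>A n\<close>, and outside it \<open>a n\<close> vanishes.\<close>
    have qc: "a n u * (cmod (q u))\<^sup>2 \<le> c\<^sup>2 * a n u" for u
    proof (cases "\<bar>u\<bar> \<le> T n")
      case True
      then have "(cmod (q u))\<^sup>2 \<le> c\<^sup>2" unfolding q_def using A(4)[OF w] by (intro power_mono) auto
      then show ?thesis using a0[of n u] by (simp add: mult.commute[of "c\<^sup>2"] mult_left_mono)
    next
      case False
      then show ?thesis by (auto simp: a_def indicator_def)
    qed
    have "integrable lborel (\<lambda>u. a n u * (cmod (q u))\<^sup>2)"
    proof (rule Bochner_Integration.integrable_bound)
      show "integrable lborel (\<lambda>u. c\<^sup>2 * a n u)" by (intro integrable_mult_right a)
      show "(\<lambda>u. a n u * (cmod (q u))\<^sup>2) \<in> borel_measurable lborel" using a[of n] by auto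
      show "AE u in lborel. norm (a n u * (cmod (q u))\<^sup>2) \<le> norm (c\<^sup>2 * a n u)"
        using qc a0 by (auto simp: abs_mult)
    qed
    then have i: "integrable lborel (\<lambda>u. sqrt (real n) * (a n u * (cmod (q u))\<^sup>2))" by (rule integrable_mult_right)
    have "cmod (Rem n \<omega>) = sqrt (real n) / (2 * pi * \<Delta>) * cmod (CLINT u|lborel. Fg n (- u) * R_fun (r n \<omega> u) * FT (\<lambda>x. complex_of_real (k n x)) u)"
      unfolding Rem_def norm_mult using Delta by (simp only: norm_of_real) simp
    also have "\<dots> \<le> sqrt (real n) / (2 * pi * \<Delta>) * (LINT u|lborel. cmod (Fg n (- u) * R_fun (r n \<omega> u) * FT (\<lambda>x. complex_of_real (k n x)) u))"
      using Delta by (intro mult_left_mono integral_norm_bound) auto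
    also have "\<dots> = (LINT u|lborel. sqrt (real n) / (2 * pi * \<Delta>) * cmod (Fg n (- u) * R_fun (r n \<omega> u) * FT (\<lambda>x. complex_of_real (k n x)) u))"
      by (rule integral_mult_right_zero[symmetric])
    also have "\<dots> \<le> (LINT u|lborel. sqrt (real n) * (a n u * (cmod (q u))\<^sup>2))"
      by (rule integral_mono'[OF i pw]) (use a0 in auto)
    also have "\<dots> = Q n \<omega>" unfolding Q_def q_def by simp
    finally show ?thesis .
  qed

  \<comment> \<open>Replacing the linearised functions by their limit\<close>
  define V where "V n = (1 / \<Delta>\<^sup>2) * (LINT x|P. (f n x - fG x)\<^sup>2)" for n
  have fd: "\<bar>f n x - fG x\<bar> \<le> 2 * E" for n x using fE[of n x] fGE[of x] by linarith
  have Vlim: "V \<longlonglongrightarrow> 0"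
  proof -
    have "(\<lambda>n. LINT x|P. (f n x - fG x)\<^sup>2) \<longlonglongrightarrow> (LINT x|P. (0::real))"
    proof (rule integral_dominated_convergence[where w="\<lambda>_. (2 * E)\<^sup>2"])
      show "AE x in P. (\<lambda>n. (f n x - fG x)\<^sup>2) \<longlonglongrightarrow> 0"
      proof (rule AE_I2)
        fix x
        have "(\<lambda>n. (f n x - fG x)\<^sup>2) \<longlonglongrightarrow> (fG x - fG x)\<^sup>2" by (intro tendsto_intros flim)
        then show "(\<lambda>n. (f n x - fG x)\<^sup>2) \<longlonglongrightarrow> 0" by simp
      qed
      show "AE x in P. norm ((f n x - fG x)\<^sup>2) \<le> (2 * E)\<^sup>2" for n
        using power_mono[OF fd abs_ge_zero, of _ _ 2] by auto
    qed auto
    then have "(\<lambda>n. LINT x|P. (f n x - fG x)\<^sup>2) \<longlonglongrightarrow> 0" by simp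
    then show ?thesis unfolding V_def by (rule tendsto_mult_right_zero)
  qed
  \<comment> \<open>The factor \<open>n\<close> from the normalisation cancels the
    \<open>1 / n\<close> in the variance of the mean, which leaves the squared L2 distance of
    \<open>f n\<close> and \<open>fG\<close> under \<open>P\<close>.\<close>
  have SV: "integrable M (\<lambda>\<omega>. (S n \<omega> - S' n \<omega>)\<^sup>2)" "expectation (\<lambda>\<omega>. (S n \<omega> - S' n \<omega>)\<^sup>2) \<le> V n" if n: "n > 0" for n
  proof -
    let ?d = "\<lambda>x. f n x - fG x"
    have m: "?d \<in> borel_measurable borel" by measurable
    have "emp_mean n ?d \<omega> = emp_mean n (f n) \<omega> - emp_mean n fG \<omega>" for \<omega>
      by (simp add: emp_mean_def sum_subtractf diff_divide_distrib)
    moreover have "(LINT x|P. ?d x) = (LINT x|P. f n x) - (LINT x|P. fG x)"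
      using iF iG by simp
    ultimately have d: "S n \<omega> - S' n \<omega> = sqrt (real n) / \<Delta> * (emp_mean n ?d \<omega> - (LINT x|P. ?d x))" for \<omega>
      by (simp add: S_def S'_def right_diff_distrib)
    have d2: "(S n \<omega> - S' n \<omega>)\<^sup>2 = real n / \<Delta>\<^sup>2 * (emp_mean n ?d \<omega> - (LINT x|P. ?d x))\<^sup>2" for \<omega>
      unfolding d by (simp add: power_mult_distrib power_divide)
    note e = expectation_emp_mean_square[OF m fd n]
    show "integrable M (\<lambda>\<omega>. (S n \<omega> - S' n \<omega>)\<^sup>2)" unfolding d2 by (intro integrable_mult_right e)
    have "expectation (\<lambda>\<omega>. (S n \<omega> - S' n \<omega>)\<^sup>2) = real n / \<Delta>\<^sup>2 * ((1 / real n) * (LINT x|P. (?d x - (LINT x|P. ?d x))\<^sup>2))"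
      unfolding d2 integral_mult_right_zero e(1) ..
    also have "\<dots> \<le> real n / \<Delta>\<^sup>2 * ((1 / real n) * (LINT x|P. (?d x)\<^sup>2))"
      by (intro mult_left_mono variance_le_square_integral[OF m fd]) auto
    also have "\<dots> = V n" using n by (simp add: V_def)
    finally show "expectation (\<lambda>\<omega>. (S n \<omega> - S' n \<omega>)\<^sup>2) \<le> V n" .
  qed
  have XS: "(\<lambda>n. prob {\<omega>\<in>space M. cmod (X n \<omega> - complex_of_real (S' n \<omega>)) > \<eta>}) \<longlonglongrightarrow> 0" if \<eta>: "\<eta> > 0" for \<eta>
  proof -
    \<comment> \<open>The three ways to fail: leaving the good event, a remainder of at least
      \<open>\<eta> / 2\<close>, and a linear error of at least \<open>\<eta> / 2\<close>.\<close>
    let ?b = "\<lambda>n. (1 - prob (A n)) + prob {\<omega>\<in>space M. Q n \<omega> \<ge> \<eta> / 2} + V n / (\<eta> / 2)\<^sup>2"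
    have Qlim: "(\<lambda>n. prob {\<omega>\<in>space M. Q n \<omega> \<ge> \<eta> / 2}) \<longlonglongrightarrow> 0"
      unfolding Q_def by (rule square_deviation_in_probability[OF a a0 alim]) (use \<eta> in auto)
    have "?b \<longlonglongrightarrow> (1 - 1) + 0 + 0 / (\<eta> / 2)\<^sup>2"
      by (intro tendsto_intros A Qlim Vlim) (use \<eta> in auto)
    then have b0: "?b \<longlonglongrightarrow> 0" by simp
    have "prob {\<omega>\<in>space M. cmod (X n \<omega> - complex_of_real (S' n \<omega>)) > \<eta>} \<le> ?b n" if n: "n > 0" for n
    proof -
      let ?B1 = "space M - A n" and ?B2 = "{\<omega>\<in>space M. Q n \<omega> \<ge> \<eta> / 2}"
        and ?B3 = "{\<omega>\<in>space M. (S n \<omega> - S' n \<omega>)\<^sup>2 \<ge> (\<eta> / 2)\<^sup>2}"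
      have [measurable]: "A n \<in> events" by (rule A)
      have "prob {\<omega>\<in>space M. cmod (X n \<omega> - complex_of_real (S' n \<omega>)) > \<eta>} \<le> prob (?B1 \<union> ?B2 \<union> ?B3)"
      proof (rule finite_measure_mono)
        show "{\<omega>\<in>space M. cmod (X n \<omega> - complex_of_real (S' n \<omega>)) > \<eta>} \<subseteq> ?B1 \<union> ?B2 \<union> ?B3"
        proof (rule subsetI, rule ccontr)
          fix \<omega> assume 1: "\<omega> \<in> {\<omega>\<in>space M. cmod (X n \<omega> - complex_of_real (S' n \<omega>)) > \<eta>}" and 2: "\<omega> \<notin> ?B1 \<union> ?B2 \<union> ?B3"
          from 1 2 have w: "\<omega> \<in> A n" and q: "Q n \<omega> < \<eta> / 2" and s: "(S n \<omega> - S' n \<omega>)\<^sup>2 < (\<eta> / 2)\<^sup>2" by auto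
          from s have "\<bar>S n \<omega> - S' n \<omega>\<bar> < \<eta> / 2" 
            by (intro power_less_imp_less_base[of _ 2 "\<eta> / 2"]) (use \<eta> in auto)
          moreover have "X n \<omega> - complex_of_real (S' n \<omega>) = complex_of_real (S n \<omega> - S' n \<omega>) + Rem n \<omega>"
            by (simp add: X)
          then have "cmod (X n \<omega> - complex_of_real (S' n \<omega>)) \<le> \<bar>S n \<omega> - S' n \<omega>\<bar> + cmod (Rem n \<omega>)"
            by (metis norm_triangle_ineq norm_of_real)
          ultimately show False using RQ[OF w] q 1 by auto
        qed
      qed measurable
      also have "\<dots> \<le> prob (?B1 \<union> ?B2) + prob ?B3" by (rule measure_Un_le) measurable
      also have "prob (?B1 \<union> ?B2) \<le> prob ?B1 + prob ?B2" by (rule measure_Un_le) measurable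
      also have "prob ?B1 = 1 - prob (A n)" by (rule prob_compl) (rule A)
      also have "prob ?B3 \<le> expectation (\<lambda>\<omega>. (S n \<omega> - S' n \<omega>)\<^sup>2) / (\<eta> / 2)\<^sup>2"
        by (rule integral_Markov_inequality_measure[where A="{}"]) (use SV[OF n] \<eta> in auto)
      also have "\<dots> \<le> V n / (\<eta> / 2)\<^sup>2" using SV(2)[OF n] by (intro divide_right_mono) auto
      finally show ?thesis by simp
    qed
    note le = this
    show ?thesis
    proof (rule tendsto_sandwich[OF _ _ tendsto_const b0])
      show "\<forall>\<^sub>F n in sequentially. prob {\<omega>\<in>space M. cmod (X n \<omega> - complex_of_real (S' n \<omega>)) > \<eta>} \<le> ?b n"
        using eventually_gt_at_top[of 0] by eventually_elim (rule le)
    qed simp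
  qed
  \<comment> \<open>\<open>Slutsky_integral\<close> asks for the moment bound at every index; at 0
    the statistic vanishes because of its factor \<open>sqrt (real n)\<close>.\<close>
  have S'2: "integrable M (\<lambda>\<omega>. (S' n \<omega>)\<^sup>2)" "expectation (\<lambda>\<omega>. (S' n \<omega>)\<^sup>2) \<le> \<sigma>2" for n
  proof -
    have "integrable M (\<lambda>\<omega>. (S' n \<omega>)\<^sup>2) \<and> expectation (\<lambda>\<omega>. (S' n \<omega>)\<^sup>2) \<le> \<sigma>2"
    proof (cases "n = 0")
      case True
      then show ?thesis using v0 by (simp add: S'_def \<sigma>2_def)
    next
      case False
      then have n: "n > 0" by simp
      have d2: "(S' n \<omega>)\<^sup>2 = real n / \<Delta>\<^sup>2 * (emp_mean n fG \<omega> - (LINT x|P. fG x))\<^sup>2" for \<omega>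
        by (simp add: S'_def power_mult_distrib power_divide)
      note e = expectation_emp_mean_square[OF fG_meas fGE n]
      have "integrable M (\<lambda>\<omega>. (S' n \<omega>)\<^sup>2)" unfolding d2 by (intro integrable_mult_right e)
      moreover have "expectation (\<lambda>\<omega>. (S' n \<omega>)\<^sup>2) = \<sigma>2"
        unfolding d2 integral_mult_right_zero using e(1) n by (simp add: \<sigma>2_def v_def fGint)
      ultimately show ?thesis by simp
    qed
    then show "integrable M (\<lambda>\<omega>. (S' n \<omega>)\<^sup>2)" "expectation (\<lambda>\<omega>. (S' n \<omega>)\<^sup>2) \<le> \<sigma>2" by auto
  qed

  \<comment> \<open>Convergence in distribution of the whole statistic\<close>
  have "conv_in_distr M X (distr std_normal_distribution borel (\<lambda>x. complex_of_real (sqrt \<sigma>2 * x)))"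
    unfolding conv_in_distr_def
  proof (intro conjI allI impI)
    show "X n \<in> borel_measurable M" for n by measurable
    fix \<psi> :: "complex \<Rightarrow> real" assume \<psi>: "continuous_on UNIV \<psi> \<and> bounded (range \<psi>)"
    then obtain Fb where Fb: "\<And>x. \<bar>\<psi> x\<bar> \<le> Fb" by (auto simp: bounded_iff)
    have [measurable]: "\<psi> \<in> borel_measurable borel" using \<psi> by (auto intro: borel_measurable_continuous_onI)
    have "(\<lambda>n. expectation (\<lambda>\<omega>. \<psi> (X n \<omega>)) - expectation (\<lambda>\<omega>. \<psi> (complex_of_real (S' n \<omega>)))) \<longlonglongrightarrow> 0"
      by (rule Slutsky_integral[where C=\<sigma>2]) (use S'2 XS \<psi> Fb in auto)
    moreover have "(\<lambda>n. expectation (\<lambda>\<omega>. \<psi> (complex_of_real (S' n \<omega>)))) \<longlonglongrightarrow> (LINT x|std_normal_distribution. \<psi> (complex_of_real (sqrt \<sigma>2 * x)))"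
    proof -
      \<comment> \<open>The limit theorem is real-valued and has no factor
        \<open>1 / \<Delta>\<close>; the scaling and the embedding into the complex plane are moved
        into the test function.\<close>
      have "continuous_on UNIV (\<lambda>y. \<psi> (complex_of_real (y / \<Delta>)))"
        by (rule continuous_on_compose2[of UNIV \<psi>]) (use \<psi> Delta in \<open>auto intro!: continuous_intros\<close>)
      from CLT_emp_mean[OF fG_meas fGE this Fb]
      have "(\<lambda>n. expectation (\<lambda>\<omega>. \<psi> (complex_of_real (sqrt (real n) * (emp_mean n fG \<omega> - (LINT x|P. fG x)) / \<Delta>))))
        \<longlonglongrightarrow> (LINT x|std_normal_distribution. \<psi> (complex_of_real (sqrt v * x / \<Delta>)))"
        by (simp add: v_def fGint)
      moreover have "sqrt v * x / \<Delta> = sqrt \<sigma>2 * x" for x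
        using Delta by (simp add: \<sigma>2_def real_sqrt_divide)
      ultimately show ?thesis by (simp add: S'_def)
    qed
    ultimately have "(\<lambda>n. (expectation (\<lambda>\<omega>. \<psi> (X n \<omega>)) - expectation (\<lambda>\<omega>. \<psi> (complex_of_real (S' n \<omega>))))
        + expectation (\<lambda>\<omega>. \<psi> (complex_of_real (S' n \<omega>))))
      \<longlonglongrightarrow> 0 + (LINT x|std_normal_distribution. \<psi> (complex_of_real (sqrt \<sigma>2 * x)))"
      by (rule tendsto_add)
    then have "(\<lambda>n. expectation (\<lambda>\<omega>. \<psi> (X n \<omega>))) \<longlonglongrightarrow> (LINT x|std_normal_distribution. \<psi> (complex_of_real (sqrt \<sigma>2 * x)))"
      by simp
    also have "(LINT x|std_normal_distribution. \<psi> (complex_of_real (sqrt \<sigma>2 * x))) =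
      (LINT x|distr std_normal_distribution borel (\<lambda>x. complex_of_real (sqrt \<sigma>2 * x)). \<psi> x)"
      by (rule integral_distr[symmetric]) auto
    finally show "(\<lambda>n. LINT \<omega>|M. \<psi> (X n \<omega>)) \<longlonglongrightarrow> (LINT x|distr std_normal_distribution borel (\<lambda>x. complex_of_real (sqrt \<sigma>2 * x)). \<psi> x)" .
  qed
  moreover have "\<Delta>\<^sup>2 * \<sigma>2 = v" using Delta by (simp add: \<sigma>2_def)
  ultimately show ?thesis
    using A(1,2) eq nz iG(2) iv v_eq
    unfolding Tset r_def \<phi>_def X_def fG_def v_def
    by (intro exI[of _ A] conjI exI[of _ \<sigma>2]) (auto simp: abs_le_iff)
qed

end
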